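(* Let $r$ be a positive integer for which there exist an orthogonal action of the alternating group $A_5$ on $\mathbb R^r$ and a smoothly embedded $A_5$-invariant $6$-disk in $\mathbb R^r$ on which $A_5$ acts without a fixed point (i.e., no point of the disk is fixed by all of $A_5$). Then for any integers $m,n$ such that either $m\ge n+r-6\ge r$ or $m\ge n\ge r$, there is an orthogonal $A_5$-action on $\mathbb R^m$ that preserves a smoothly embedded $n$-disk on which $A_5$ acts without a fixed point. In particular, for such $m,n$, the space $\mathfrak D^{n}(\mathbb R^m)\setminus\mathfrak D^{n-1}(\mathbb R^m)$ does not admit an $O(m)$-equivariant center.
   Context: Integers $r$ as in the claim exist: it is known that $A_5$ acts smoothly on the $6$-disk without a fixed point, and by the Mostow–Palais theorem such an action embeds smoothly and equivariantly in an orthogonal $A_5$-action on some $\mathbb R^r$; $r$ is one such integer. $\mathcal X(\mathbb R^m)$ is the set of compact connected $C^1$ embedded submanifolds of $\mathbb R^m$ (of any dimension, possibly with boundary) with the $C^1$ topology: for $D\in\mathcal X(\mathbb R^m)$ the set of submanifolds $C^1$ diffeomorphic to $D$ is identified with $\mathrm{Emb}^1(D,\mathbb R^m)/\mathrm{Diff}^1(D)$ with the topology induced by the $C^1$ topology, and $\mathcal X(\mathbb R^m)$ is the disjoint union of these spaces over all $C^1$ diffeomorphism classes. $\mathfrak D^{k}(\mathbb R^m)$ is the subspace of all $D\in\mathcal X(\mathbb R^m)$ homeomorphic to a disk of dimension $\le k$. For a subspace $X\subseteq\mathcal X(\mathbb R^m)$ invariant under $O(m)$, an $O(m)$-equivariant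 center is a continuous map $\mathfrak c\colon X\to\mathbb R^m$ such that $\mathfrak c(D)$ lies in the relative interior $D\setminus\partial D$ for every $D\in X$ and $\mathfrak c(gD)=g\,\mathfrak c(D)$ for all $D\in X$, $g\in O(m)$. *)

theory Defs
  imports "HOL-Analysis.Analysis" "HOL-Algebra.Sym_Groups" "HOL-Algebra.Group_Action"
begin

section \<open>Maps of class $C^k$\<close>

text \<open>
  On an open set, \<open>f\<close> is of class $C^{n+1}$ iff it is differentiable and all its directional
  derivatives $x \mapsto Df_x(v)$ are of class $C^n$.
\<close>

primrec Cn_on_open :: "nat \<Rightarrow> 'a::euclidean_space set \<Rightarrow> ('a \<Rightarrow> 'b::euclidean_space) \<Rightarrow> bool" where
  "Cn_on_open 0 = (\<lambda>U f. continuous_on U f)"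
| "Cn_on_open (Suc n) = (\<lambda>U f. (\<forall>x\<in>U. f differentiable (at x)) \<and>
     (\<forall>v. Cn_on_open n U (\<lambda>x. frechet_derivative f (at x) v)))"

definition Ck_on_open :: "enat \<Rightarrow> 'a::euclidean_space set \<Rightarrow> ('a \<Rightarrow> 'b::euclidean_space) \<Rightarrow> bool" where
  "Ck_on_open k U f \<longleftrightarrow> (\<forall>n. enat n \<le> k \<longrightarrow> Cn_on_open n U f)"

text \<open>
  On an arbitrary subset (a closed ball, a submanifold with boundary), class $C^k$ means that
  the map extends locally to a $C^k$ map on an open subset of the ambient space.
\<close>

definition Ck_map_on :: "enat \<Rightarrow> 'a::euclidean_space set \<Rightarrow> ('a \<Rightarrow> 'b::euclidean_space) \<Rightarrow> bool" where
  "Ck_map_on k A f \<longleftrightarrow>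
     (\<forall>p\<in>A. \<exists>U F. open U \<and> p \<in> U \<and> Ck_on_open k U F \<and> (\<forall>x\<in>U \<inter> A. F x = f x))"


section \<open>Embedded $C^1$ submanifolds with boundary\<close>

text \<open>
  \<open>flattens D H p \<phi>\<close>: \<open>\<phi>\<close> is a $C^1$ diffeomorphism between open subsets \<open>U\<close> and \<open>V\<close> of the ambient
  space, with \<open>p \<in> U\<close>, taking \<open>D \<inter> U\<close> to \<open>H \<inter> V\<close>.
\<close>

definition flattens :: "'a::euclidean_space set \<Rightarrow> 'a set \<Rightarrow> 'a \<Rightarrow> ('a \<Rightarrow> 'a) \<Rightarrow> bool" where
  "flattens D H p \<phi> \<longleftrightarrow>
     (\<exists>U V \<psi>. open U \<and> open V \<and> p \<in> U \<and> homeomorphism U V \<phi> \<psi> \<and>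
        Ck_on_open 1 U \<phi> \<and> Ck_on_open 1 V \<psi> \<and> \<phi> ` (D \<inter> U) = H \<inter> V)"

definition interior_chart :: "'a::euclidean_space set \<Rightarrow> 'a \<Rightarrow> 'a set \<Rightarrow> ('a \<Rightarrow> 'a) \<Rightarrow> bool" where
  "interior_chart D p S \<phi> \<longleftrightarrow> p \<in> D \<and> subspace S \<and> flattens D S p \<phi>"

definition boundary_chart :: "'a::euclidean_space set \<Rightarrow> 'a \<Rightarrow> 'a set \<Rightarrow> ('a \<Rightarrow> 'a) \<Rightarrow> bool" where
  "boundary_chart D p S \<phi> \<longleftrightarrow> p \<in> D \<and> subspace S \<and>
     (\<exists>e\<in>S. e \<noteq> 0 \<and> e \<bullet> \<phi> p = 0 \<and> flattens D {x \<in> S. 0 \<le> e \<bullet> x} p \<phi>)"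

definition C1_submanifold :: "nat \<Rightarrow> 'a::euclidean_space set \<Rightarrow> bool" where
  "C1_submanifold d D \<longleftrightarrow>
     (\<forall>p\<in>D. \<exists>S \<phi>. dim S = d \<and> (interior_chart D p S \<phi> \<or> boundary_chart D p S \<phi>))"

definition mfld_boundary :: "'a::euclidean_space set \<Rightarrow> 'a set" where
  "mfld_boundary D = {p. \<exists>S \<phi>. boundary_chart D p S \<phi>}"

text \<open>The chain rule for the transition maps makes the following independent of the chart.\<close>

definition tangent_space :: "'a::euclidean_space set \<Rightarrow> 'a \<Rightarrow> 'a set" where
  "tangent_space D p =
     {v. \<exists>S \<phi>. (interior_chart D p S \<phi> \<or> boundary_chart D p S \<phi>) \<and>
               frechet_derivative \<phi> (at p) v \<in> S}"

text \<open>
  The derivative of a $C^1$ map on a submanifold \<open>D\<close> is \<open>frechet_derivative f (at x within D)\<close>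
  restricted to the tangent space; only there is it uniquely determined.
\<close>

definition Ck_embedding :: "enat \<Rightarrow> 'a::euclidean_space set \<Rightarrow> ('a \<Rightarrow> 'b::euclidean_space) \<Rightarrow> bool" where
  "Ck_embedding k D f \<longleftrightarrow> Ck_map_on k D f \<and> (\<exists>g. homeomorphism D (f ` D) f g) \<and>
     (\<forall>x\<in>D. inj_on (frechet_derivative f (at x within D)) (tangent_space D x))"

definition smoothly_embedded_disk :: "'n::finite itself \<Rightarrow> 'a::euclidean_space set \<Rightarrow> bool" where
  "smoothly_embedded_disk _ D \<longleftrightarrow>
     (\<exists>f :: real^'n \<Rightarrow> 'a. Ck_embedding \<infinity> (cball 0 1) f \<and> D = f ` cball 0 1)"


section \<open>The space of compact connected $C^1$ submanifolds\<close>

text \<open>Connected spaces are taken to be nonempty.\<close>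

definition submanifolds :: "'a::euclidean_space set set" where
  "submanifolds = {D. compact D \<and> connected D \<and> D \<noteq> {} \<and> (\<exists>d. C1_submanifold d D)}"

text \<open>Extensionality makes elements of \<open>Emb1 D\<close> correspond exactly to the embeddings of \<open>D\<close>.\<close>

definition Emb1 :: "'a::euclidean_space set \<Rightarrow> ('a \<Rightarrow> 'a) set" where
  "Emb1 D = {f \<in> extensional D. Ck_embedding 1 D f}"

definition C1_close :: "'a::euclidean_space set \<Rightarrow> real \<Rightarrow> ('a \<Rightarrow> 'a) \<Rightarrow> ('a \<Rightarrow> 'a) \<Rightarrow> bool" where
  "C1_close D \<epsilon> f g \<longleftrightarrow>
     (\<forall>x\<in>D. norm (g x - f x) < \<epsilon> \<and>
        (\<forall>v\<in>tangent_space D x. norm v \<le> 1 \<longrightarrow>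
           norm (frechet_derivative g (at x within D) v
                 - frechet_derivative f (at x within D) v) < \<epsilon>))"

definition C1_topology :: "'a::euclidean_space set \<Rightarrow> ('a \<Rightarrow> 'a) topology" where
  "C1_topology D = topology (\<lambda>W. W \<subseteq> Emb1 D \<and>
     (\<forall>f\<in>W. \<exists>\<epsilon>>0. \<forall>g\<in>Emb1 D. C1_close D \<epsilon> f g \<longrightarrow> g \<in> W))"

lemma C1_close_mono: "C1_close D \<delta> f g \<Longrightarrow> \<delta> \<le> \<epsilon> \<Longrightarrow> C1_close D \<epsilon> f g"
  unfolding C1_close_def by (meson less_le_trans)

lemma openin_C1_topology:
  "openin (C1_topology D) W \<longleftrightarrow> W \<subseteq> Emb1 D \<and>
     (\<forall>f\<in>W. \<exists>\<epsilon>>0. \<forall>g\<in>Emb1 D. C1_close D \<epsilon> f g \<longrightarrow> g \<in> W)"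
proof -
  define P where "P W \<longleftrightarrow> W \<subseteq> Emb1 D \<and>
     (\<forall>f\<in>W. \<exists>\<epsilon>>0. \<forall>g\<in>Emb1 D. C1_close D \<epsilon> f g \<longrightarrow> g \<in> W)" for W
  have Int: "P (V \<inter> W)" if V: "P V" and W: "P W" for V W
    unfolding P_def
  proof (intro conjI ballI)
    show "V \<inter> W \<subseteq> Emb1 D"
      using V unfolding P_def by blast
    fix f assume f: "f \<in> V \<inter> W"
    then obtain a b :: real where ab: "a > 0" "b > 0"
      "\<And>g. g \<in> Emb1 D \<Longrightarrow> C1_close D a f g \<Longrightarrow> g \<in> V"
      "\<And>g. g \<in> Emb1 D \<Longrightarrow> C1_close D b f g \<Longrightarrow> g \<in> W"
      using V W unfolding P_def by (metis IntD1 IntD2)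
    then show "\<exists>\<epsilon>>0. \<forall>g\<in>Emb1 D. C1_close D \<epsilon> f g \<longrightarrow> g \<in> V \<inter> W"
      by (intro exI[of _ "min a b"])
        (meson C1_close_mono IntI min.cobounded1 min.cobounded2 min_less_iff_conj)
  qed
  have Un: "P (\<Union>K)" if "\<forall>W\<in>K. P W" for K
    using that unfolding P_def by (meson Sup_le_iff UnionE UnionI)
  have "istopology P"
    unfolding istopology_def using Int Un by blast
  then show ?thesis
    unfolding C1_topology_def P_def by (simp add: topology_inverse')
qed

text \<open>
  For \<open>D\<close> in \<open>submanifolds\<close>, the map \<open>f \<mapsto> f ` D\<close> from \<open>Emb1 D\<close> has as its image the set of all
  submanifolds $C^1$ diffeomorphic to \<open>D\<close>, and its fibres are the $\mathrm{Diff}^1(D)$-orbits.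
  Hence a set is open in the disjoint union of the quotients
  $\mathrm{Emb}^1(D,\mathbb{R}^m)/\mathrm{Diff}^1(D)$ iff all its preimages under these maps are
  open. Letting \<open>D\<close> range over all submanifolds rather than over one representative of each
  diffeomorphism class makes no difference: precomposition with a $C^1$ diffeomorphism
  \<open>D \<rightarrow> D'\<close> is a homeomorphism from \<open>Emb1 D'\<close> to \<open>Emb1 D\<close>.
\<close>

definition submanifold_topology :: "'a::euclidean_space set topology" where
  "submanifold_topology = topology (\<lambda>\<U>. \<U> \<subseteq> submanifolds \<and>
     (\<forall>D\<in>submanifolds. openin (C1_topology D) {f \<in> Emb1 D. f ` D \<in> \<U>}))"

lemma openin_submanifold_topology:
  "openin submanifold_topology \<U> \<longleftrightarrow> \<U> \<subseteq> submanifolds \<and>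
     (\<forall>D\<in>submanifolds. openin (C1_topology D) {f \<in> Emb1 D. f ` D \<in> \<U>})"
proof -
  define P where "P \<U> \<longleftrightarrow> \<U> \<subseteq> submanifolds \<and>
     (\<forall>D\<in>submanifolds. openin (C1_topology D) {f \<in> Emb1 D. f ` D \<in> \<U>})"
    for \<U> :: "'a set set"
  have Int: "P (\<U> \<inter> \<V>)" if "P \<U>" "P \<V>" for \<U> \<V>
  proof -
    have "{f \<in> Emb1 D. f ` D \<in> \<U> \<inter> \<V>} =
          {f \<in> Emb1 D. f ` D \<in> \<U>} \<inter> {f \<in> Emb1 D. f ` D \<in> \<V>}" for D
      by blast
    with that show ?thesis
      unfolding P_def by (auto intro: openin_Int)
  qed
  have Un: "P (\<Union>K)" if "\<forall>\<U>\<in>K. P \<U>" for K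
  proof -
    have "{f \<in> Emb1 D. f ` D \<in> \<Union>K} = (\<Union>\<U>\<in>K. {f \<in> Emb1 D. f ` D \<in> \<U>})" for D
      by blast
    with that show ?thesis
      unfolding P_def by (auto intro!: openin_Union)
  qed
  have "istopology P"
    unfolding istopology_def using Int Un by blast
  then show ?thesis
    unfolding submanifold_topology_def P_def by (simp add: topology_inverse')
qed

definition standard_disk :: "nat \<Rightarrow> (nat \<Rightarrow> real) topology" where
  "standard_disk j = subtopology (Euclidean_space j) {x. (\<Sum>i<j. (x i)\<^sup>2) \<le> 1}"

definition disk_submanifolds :: "int \<Rightarrow> 'a::euclidean_space set set" where
  "disk_submanifolds k =
     {D \<in> submanifolds. \<exists>j. int j \<le> k \<and> top_of_set D homeomorphic_space standard_disk j}"

definition equivariant_center :: "'a::euclidean_space set set \<Rightarrow> ('a set \<Rightarrow> 'a) \<Rightarrow> bool" where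
  "equivariant_center X c \<longleftrightarrow>
     continuous_map (subtopology submanifold_topology X) euclidean c \<and>
     (\<forall>D\<in>X. c D \<in> D - mfld_boundary D) \<and>
     (\<forall>D\<in>X. \<forall>g. orthogonal_transformation g \<longrightarrow> c (g ` D) = g (c D))"


section \<open>Orthogonal actions of $A_5$\<close>

definition orthogonal_A5_action :: "((nat \<Rightarrow> nat) \<Rightarrow> 'a::euclidean_space \<Rightarrow> 'a) \<Rightarrow> bool" where
  "orthogonal_A5_action \<rho> \<longleftrightarrow> group_action (alt_group 5) UNIV \<rho> \<and>
     (\<forall>g\<in>carrier (alt_group 5). orthogonal_transformation (\<rho> g))"

definition A5_invariant :: "((nat \<Rightarrow> nat) \<Rightarrow> 'a \<Rightarrow> 'a) \<Rightarrow> 'a set \<Rightarrow> bool" where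
  "A5_invariant \<rho> D \<longleftrightarrow> (\<forall>g\<in>carrier (alt_group 5). \<rho> g ` D = D)"

definition A5_fixed_point_free :: "((nat \<Rightarrow> nat) \<Rightarrow> 'a \<Rightarrow> 'a) \<Rightarrow> 'a set \<Rightarrow> bool" where
  "A5_fixed_point_free \<rho> D \<longleftrightarrow> \<not> (\<exists>x\<in>D. \<forall>g\<in>carrier (alt_group 5). \<rho> g x = x)"

end

(*
  Let phi_g be the self-map of the 6-ball conjugate to the action of g on the given disk D = f(B).
  Hadamard division by 1 - |u|^2 shows that the invariant function
  h(u) = sum over g of (1 - |phi_g(u)|^2) equals (1 - |u|^2) k(u) with k smooth and k >= 1.
  If E is an equivariant bundle over D orthogonal to the tangent spaces, trivialized by smooth
  orthonormal frames w_i, then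
    { f(u) + v : u in B, v in E_u, |v|^2 <= eps^2 h(u) }
  is invariant, and it is the image of the unit ball |u|^2 + |y|^2 <= 1 under the map
  (u, y) |-> f(u) + eps * sqrt(k(u)) * (sum of y_i w_i(u)), so no corners have to be smoothed.
  For small eps this map is an embedding, and uniqueness of the representation f(u) + v shows that
  a fixed point would force phi_g(u) = u for all g.  For n + r - 6 <= m the bundle is a trivial
  summand on which A_5 acts trivially; for r <= n <= m it is the normal bundle in R^r plus such a
  summand.  A center of the resulting disk would be a fixed point on it.
*)
theory Submission
  imports Defs
begin

section \<open>Calculus of maps of class $C^k$\<close>

text \<open>A product of the given disk with a round disk has corners. The squared fibre radius 1 -
  |u|^2 would round them, but it is not invariant, because the maps phi_g are not isometries of B.
  Summing over the group restores invariance; that the sum is still divisible by 1 - |u|^2 rests on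
  phi_g preserving the sphere, a consequence of invariance of domain. The bound on k comes from the
  summand of the identity and has to hold up to the boundary, where sqrt k must stay smooth. The
  frame w_i is in general not equivariant; only the spans E_u and the norm of v enter the set, and
  the orthogonal action respects both. That the normal bundle has a global smooth frame is due to
  the contractibility of the ball, made explicit by transport along radii. Smoothness on B means
  local extension, so derivatives at boundary points are taken within the ball; they are unique
  because the ball is convex with nonempty interior.\<close>

lemma Cn_on_open_mono: "Cn_on_open n U f \<Longrightarrow> V \<subseteq> U \<Longrightarrow> Cn_on_open n V f"
proof (induction n arbitrary: f)
  case 0
  then show ?case by (auto intro: continuous_on_subset)
next
  case (Suc n)
  then show ?case by auto
qed

text \<open>A derivative at a point depends on the values nearby, hence the openness of
  \<open>U\<close>; the induction passes from the functions to their directional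
  derivatives.\<close>

lemma Cn_on_open_cong:
  assumes "open U" "\<And>x. x \<in> U \<Longrightarrow> f x = g x"
  shows "Cn_on_open n U f \<longleftrightarrow> Cn_on_open n U g"
proof -
  have imp: "Cn_on_open n U g" if "Cn_on_open n U f" "\<And>x. x \<in> U \<Longrightarrow> f x = g x" for n and f g :: "'a \<Rightarrow> 'b"
    using that
  proof (induction n arbitrary: f g)
    case 0
    then show ?case using continuous_on_cong[of U U f g] by simp
  next
    case (Suc n)
    have D: "(g has_derivative frechet_derivative f (at x)) (at x)" if "x \<in> U" for x
    proof -
      have "(f has_derivative frechet_derivative f (at x)) (at x)"
        using Suc.prems that frechet_derivative_works by auto
      then show ?thesis
        by (rule has_derivative_transform_within_open[OF _ \<open>open U\<close> that]) (use Suc.prems in auto)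
    qed
    have "Cn_on_open n U (\<lambda>x. frechet_derivative g (at x) v)" for v
      by (rule Suc.IH[of "\<lambda>x. frechet_derivative f (at x) v"])
        (use Suc.prems fun_cong[OF frechet_derivative_at[OF D]] in auto)
    then show ?case
      using D by (auto simp: differentiable_def)
  qed
  show ?thesis
    using imp[of n f g] imp[of n g f] assms(2) by auto
qed

text \<open>Any pointwise formula for the derivative may replace \<open>frechet_derivative\<close>.
  A closure property then amounts to one computation of a derivative, followed by the induction
  hypothesis.\<close>

lemma Cn_on_open_SucI:
  assumes "open U" "\<And>x. x \<in> U \<Longrightarrow> (f has_derivative f' x) (at x)"
    "\<And>v. Cn_on_open n U (\<lambda>x. f' x v)"
  shows "Cn_on_open (Suc n) U f"
proof -
  have "Cn_on_open n U (\<lambda>x. frechet_derivative f (at x) v)" for v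
    using assms(3)[of v]
    by (rule iffD1[OF Cn_on_open_cong, rotated -1])
      (use assms(1) fun_cong[OF frechet_derivative_at[OF assms(2)]] in auto)
  then show ?thesis
    using assms(2) by (auto simp: differentiable_def)
qed

lemma Cn_on_open_SucD:
  assumes "Cn_on_open (Suc n) U f"
  shows "x \<in> U \<Longrightarrow> (f has_derivative frechet_derivative f (at x)) (at x)"
    "Cn_on_open n U (\<lambda>x. frechet_derivative f (at x) v)"
  using assms frechet_derivative_works by auto

lemma Cn_on_open_Suc_imp: "Cn_on_open (Suc n) U f \<Longrightarrow> Cn_on_open n U f"
proof (induction n arbitrary: f)
  case 0
  then show ?case
    by (auto intro!: continuous_at_imp_continuous_on differentiable_imp_continuous_within)
next
  case (Suc n)
  then show ?case
    using Suc.IH by (metis Cn_on_open.simps(2))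
qed

lemma Cn_on_open_le: "Cn_on_open n U f \<Longrightarrow> m \<le> n \<Longrightarrow> Cn_on_open m U f"
  by (induction n) (auto simp: le_Suc_eq simp del: Cn_on_open.simps dest: Cn_on_open_Suc_imp)

lemma Cn_on_open_continuous: "Cn_on_open n U f \<Longrightarrow> continuous_on U f"
  using Cn_on_open_le[of n U f 0] by simp

lemma Cn_on_open_const: "Cn_on_open n U (\<lambda>x. c)"
  by (induction n arbitrary: c) auto

lemma Cn_on_open_linear:
  fixes f :: "'a::euclidean_space \<Rightarrow> 'b::euclidean_space"
  assumes "linear f" shows "Cn_on_open n U f"
proof -
  have b: "bounded_linear f" using assms linear_conv_bounded_linear by blast
  have d: "frechet_derivative f (at x) = f" for x
    using frechet_derivative_at[OF bounded_linear_imp_has_derivative[OF b]] by metis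
  show ?thesis
    by (cases n) (auto simp: d Cn_on_open_const b linear_continuous_on bounded_linear_imp_differentiable)
qed

lemma Cn_on_open_id: "Cn_on_open n U (\<lambda>x. x)"
  by (rule Cn_on_open_linear) (simp add: linear_id[unfolded id_def])

lemma Cn_on_open_add:
  assumes "open U" "Cn_on_open n U f" "Cn_on_open n U g"
  shows "Cn_on_open n U (\<lambda>x. f x + g x)"
  using assms(2,3)
proof (induction n arbitrary: f g)
  case 0
  then show ?case by (auto intro: continuous_intros)
next
  case (Suc n)
  show ?case
    by (rule Cn_on_open_SucI[OF \<open>open U\<close> has_derivative_add[OF Cn_on_open_SucD(1) Cn_on_open_SucD(1)]])
      (use Suc in auto)
qed

lemma Cn_on_open_sum:
  assumes "open U" "\<And>i. i \<in> I \<Longrightarrow> Cn_on_open n U (f i)"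
  shows "Cn_on_open n U (\<lambda>x. \<Sum>i\<in>I. f i x)"
  using assms(2)
  by (induction I rule: infinite_finite_induct) (auto simp: Cn_on_open_const intro: Cn_on_open_add[OF \<open>open U\<close>])

text \<open>By the Leibniz rule a directional derivative is a sum of two values of
  \<open>bil\<close>, each with one factor differentiated, so the induction is over both factors at
  once.\<close>

lemma Cn_on_open_bilinear:
  assumes bl: "bounded_bilinear bil" and "open U" "Cn_on_open n U f" "Cn_on_open n U g"
  shows "Cn_on_open n U (\<lambda>x. bil (f x) (g x))"
  using assms(3,4)
proof (induction n arbitrary: f g)
  case 0
  then show ?case by (auto intro: bounded_bilinear.continuous_on[OF bl])
next
  case (Suc n)
  show ?case
    by (rule Cn_on_open_SucI[OF \<open>open U\<close> bounded_bilinear.FDERIV[OF bl Cn_on_open_SucD(1) Cn_on_open_SucD(1)]])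
      (use Suc in \<open>auto intro!: Cn_on_open_add[OF \<open>open U\<close>] Suc.IH simp del: Cn_on_open.simps
        intro: Cn_on_open_Suc_imp Cn_on_open_SucD(2)\<close>)
qed

lemmas Cn_on_open_scaleR = Cn_on_open_bilinear[OF bounded_bilinear_scaleR]
lemmas Cn_on_open_inner = Cn_on_open_bilinear[OF bounded_bilinear_inner]

lemma Cn_on_open_mult:
  fixes f g :: "'a::euclidean_space \<Rightarrow> real"
  shows "open U \<Longrightarrow> Cn_on_open n U f \<Longrightarrow> Cn_on_open n U g \<Longrightarrow> Cn_on_open n U (\<lambda>x. f x * g x)"
  by (rule Cn_on_open_bilinear[OF bounded_bilinear_mult])

lemma Cn_on_open_prod:
  fixes f :: "'i \<Rightarrow> 'a::euclidean_space \<Rightarrow> real"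
  assumes "open U" "\<And>i. i \<in> I \<Longrightarrow> Cn_on_open n U (f i)"
  shows "Cn_on_open n U (\<lambda>x. \<Prod>i\<in>I. f i x)"
  using assms(2)
  by (induction I rule: infinite_finite_induct) (auto simp: Cn_on_open_const intro: Cn_on_open_mult[OF \<open>open U\<close>])

text \<open>The induction varies \<open>g\<close> and keeps \<open>f\<close>: the derivative of the
  composite is assembled from directional derivatives of \<open>g\<close> taken at
  \<open>f x\<close>, to which the hypothesis applies again.\<close>

lemma Cn_on_open_compose:
  fixes f :: "'a::euclidean_space \<Rightarrow> 'b::euclidean_space" and g :: "'b \<Rightarrow> 'c::euclidean_space"
  assumes "open U" "open V" "f ` U \<subseteq> V" "Cn_on_open n U f" "Cn_on_open n V g"
  shows "Cn_on_open n U (\<lambda>x. g (f x))"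
  using assms(4,5)
proof (induction n arbitrary: g)
  case 0
  then show ?case using assms(3) by (auto intro: continuous_on_compose2)
next
  case (Suc n)
  let ?f = "\<lambda>x. frechet_derivative f (at x)" and ?g = "\<lambda>x. frechet_derivative g (at x)"
  have gD: "(g has_derivative ?g (f x)) (at (f x))" if "x \<in> U" for x
    using Suc.prems(2) that assms(3) by (auto intro: Cn_on_open_SucD(1) simp del: Cn_on_open.simps)
  \<comment> \<open>Both the base point and the direction of \<open>?g (f x) (?f x v)\<close> move
    with \<open>x\<close>. Expansion in a basis freezes the direction and leaves products of
    functions of class \<open>n\<close>.\<close>
  have *: "?g (f x) (?f x v) = (\<Sum>b\<in>Basis. (?f x v \<bullet> b) *\<^sub>R ?g (f x) b)" if "x \<in> U" for x v
  proof -
    have "linear (?g (f x))"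
      using gD[OF that] has_derivative_linear by blast
    then show ?thesis
      by (subst euclidean_representation[of "?f x v", symmetric])
        (simp only: linear_sum linear_scale)
  qed
  have "Cn_on_open n U (\<lambda>x. \<Sum>b\<in>Basis. (?f x v \<bullet> b) *\<^sub>R ?g (f x) b)" for v
    by (intro Cn_on_open_sum Cn_on_open_scaleR Cn_on_open_inner Cn_on_open_const \<open>open U\<close> Suc.IH)
      (use Suc.prems in \<open>auto intro: Cn_on_open_Suc_imp Cn_on_open_SucD(2) simp del: Cn_on_open.simps\<close>)
  then have "Cn_on_open n U (\<lambda>x. (?g (f x) \<circ> ?f x) v)" for v
    by (rule iffD1[OF Cn_on_open_cong[OF \<open>open U\<close>], rotated]) (simp add: *)
  moreover have "((\<lambda>x. g (f x)) has_derivative (?g (f x) \<circ> ?f x)) (at x)" if "x \<in> U" for x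
    using diff_chain_at[OF Cn_on_open_SucD(1)[OF Suc.prems(1) that] gD[OF that]] by (simp add: o_def)
  ultimately show ?case
    by (intro Cn_on_open_SucI[OF \<open>open U\<close>]) auto
qed

text \<open>The derivative is a constant multiple of the square of the function itself, so each
  order follows from the previous one by products.\<close>

lemma Cn_on_open_real_inverse: "Cn_on_open n {x. x \<noteq> 0} (inverse :: real \<Rightarrow> real)"
proof (induction n)
  case 0
  show ?case by (auto intro: continuous_intros)
next
  case (Suc n)
  have o: "open {x::real. x \<noteq> 0}" by (simp add: open_Collect_neq)
  show ?case
  proof (rule Cn_on_open_SucI[OF o])
    show "(inverse has_derivative (\<lambda>h. - (inverse x * h * inverse x))) (at x)" if "x \<in> {x. x \<noteq> 0}" for x :: real
      using that by (auto intro!: derivative_eq_intros)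
    have "Cn_on_open n {x. x \<noteq> 0} (\<lambda>x::real. (- v) * (inverse x * inverse x))" for v
      by (intro Cn_on_open_mult o Suc Cn_on_open_const)
    then show "Cn_on_open n {x. x \<noteq> 0} (\<lambda>x::real. - (inverse x * v * inverse x))" for v
      by (simp add: mult_ac)
  qed
qed

text \<open>The derivative is half the reciprocal of the root, so the induction runs through
  composition with the reciprocal.\<close>

lemma Cn_on_open_real_sqrt: "Cn_on_open n {x. x > 0} (sqrt :: real \<Rightarrow> real)"
proof (induction n)
  case 0
  show ?case by (auto intro: continuous_intros)
next
  case (Suc n)
  have o: "open {x::real. x > 0}" by (simp add: open_Collect_less)
  have "Cn_on_open n {x. x > 0} (\<lambda>x. inverse (sqrt x))"
    by (rule Cn_on_open_compose[OF o _ _ Suc Cn_on_open_real_inverse]) (auto simp: open_Collect_neq)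
  then have sq: "Cn_on_open n {x. x > 0} (\<lambda>x. h * (inverse (sqrt x) * (1/2)))" for h
    by (intro Cn_on_open_mult o Cn_on_open_const)
  show ?case
    by (rule Cn_on_open_SucI[OF o _ sq]) (auto intro!: derivative_eq_intros simp: field_simps)
qed

lemma Cn_on_open_inverse:
  fixes f :: "'a::euclidean_space \<Rightarrow> real"
  assumes "open U" "Cn_on_open n U f" "\<And>x. x \<in> U \<Longrightarrow> f x \<noteq> 0"
  shows "Cn_on_open n U (\<lambda>x. inverse (f x))"
  by (rule Cn_on_open_compose[OF assms(1) _ _ assms(2) Cn_on_open_real_inverse])
    (use assms(3) in \<open>auto simp: open_Collect_neq\<close>)

lemma Cn_on_open_sqrt:
  fixes f :: "'a::euclidean_space \<Rightarrow> real"
  assumes "open U" "Cn_on_open n U f" "\<And>x. x \<in> U \<Longrightarrow> f x > 0"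
  shows "Cn_on_open n U (\<lambda>x. sqrt (f x))"
  by (rule Cn_on_open_compose[OF assms(1) _ _ assms(2) Cn_on_open_real_sqrt])
    (use assms(3) in \<open>auto simp: open_Collect_less\<close>)

lemma Cn_on_open_det:
  fixes A :: "'a::euclidean_space \<Rightarrow> real^'m^'m"
  assumes "open U" "\<And>i j. Cn_on_open n U (\<lambda>x. A x $ i $ j)"
  shows "Cn_on_open n U (\<lambda>x. det (A x))"
  unfolding det_def
  by (intro Cn_on_open_sum Cn_on_open_mult Cn_on_open_prod Cn_on_open_const assms)

text \<open>Cramer's rule writes the solution as a quotient of determinants, which are polynomials
  in the entries of the matrices.\<close>

lemma Cn_on_open_linear_solution:
  fixes L :: "'a::euclidean_space \<Rightarrow> real^'m \<Rightarrow> real^'m"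
  assumes "open U" "\<And>x. x \<in> U \<Longrightarrow> linear (L x)" "\<And>x. x \<in> U \<Longrightarrow> bij (L x)"
    and L: "\<And>v. Cn_on_open n U (\<lambda>x. L x v)"
  shows "Cn_on_open n U (\<lambda>x. inv_into UNIV (L x) b)"
proof -
  define M where "M k x = (\<chi> i j. if j = k then b $ i else matrix (L x) $ i $ j)" for k x
  have entry: "Cn_on_open n U (\<lambda>x. L x v $ i)" for v i
    using Cn_on_open_inner[OF \<open>open U\<close> L Cn_on_open_const, of v "axis i 1"] by (simp add: inner_axis)
  have inv: "invertible (matrix (L x))" if "x \<in> U" for x
  proof -
    have "(*v) (matrix (L x)) = L x"
      using assms(2)[OF that] by (simp add: fun_eq_iff matrix_works)
    then show ?thesis
      using assms(3)[OF that] by (simp add: invertible_eq_bij)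
  qed
  have det: "det (matrix (L x)) \<noteq> 0" if "x \<in> U" for x
    using inv[OF that] invertible_det_nz by blast
  have sol: "inv_into UNIV (L x) b = (\<Sum>k\<in>UNIV. (det (M k x) * inverse (det (matrix (L x)))) *\<^sub>R axis k 1)" if "x \<in> U" for x
  proof -
    have "matrix (L x) *v inv_into UNIV (L x) b = b"
      using assms(2,3)[OF that] by (simp add: matrix_works bij_is_surj surj_f_inv_f)
    then have *: "inv_into UNIV (L x) b = (\<chi> k. det (M k x) / det (matrix (L x)))"
      using cramer[OF det[OF that], of "inv_into UNIV (L x) b" b] unfolding M_def by blast
    show ?thesis
      unfolding * by (simp add: vec_eq_iff axis_def divide_inverse sum.delta if_distrib cong: if_cong)
  qed
  have mat: "Cn_on_open n U (\<lambda>x. matrix (L x) $ i $ j)" for i j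
    by (simp add: matrix_def entry)
  have M: "Cn_on_open n U (\<lambda>x. M k x $ i $ j)" for k i j
    by (cases "j = k") (simp_all add: M_def Cn_on_open_const mat)
  have "Cn_on_open n U (\<lambda>x. \<Sum>k\<in>UNIV. (det (M k x) * inverse (det (matrix (L x)))) *\<^sub>R axis k (1::real))"
    by (intro Cn_on_open_sum Cn_on_open_scaleR Cn_on_open_mult Cn_on_open_inverse Cn_on_open_const Cn_on_open_det
        \<open>open U\<close> det M mat)
  then show ?thesis
    by (rule iffD1[OF Cn_on_open_cong[OF \<open>open U\<close>], rotated]) (simp add: sol)
qed

text \<open>Bootstrapping: the derivative of \<open>g\<close> at \<open>y\<close> is the inverse of
  \<open>f' (g y)\<close>. If \<open>g\<close> is of class \<open>n\<close>, so is this inverse by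
  Cramer's rule, and \<open>g\<close> gains one order. The hypotheses on derivatives have the form
  in which the inverse function theorem delivers them.\<close>

lemma Cn_on_open_inverse_function:
  fixes f :: "real^'m \<Rightarrow> real^'m"
  assumes "open U" "open V" and hom: "homeomorphism U V f g"
    and f: "Cn_on_open n U f"
    and fD: "\<And>x. x \<in> U \<Longrightarrow> (f has_derivative f' x) (at x)"
    and gD: "\<And>y. y \<in> V \<Longrightarrow> (g has_derivative inv_into UNIV (f' (g y))) (at y)"
    and bij: "\<And>y. y \<in> V \<Longrightarrow> bij (f' (g y))"
  shows "Cn_on_open n V g"
  using f
proof (induction n)
  case 0
  show ?case using homeomorphism_cont2[OF hom] by simp
next
  case (Suc n)
  have g: "Cn_on_open n V g"
    by (rule Suc.IH[OF Cn_on_open_Suc_imp[OF Suc.prems]])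
  have gV: "g ` V \<subseteq> U"
    using homeomorphism_image2[OF hom] by simp
  have "Cn_on_open n U (\<lambda>x. f' x v)" for v
    using Cn_on_open_cong[OF \<open>open U\<close>, of "\<lambda>x. frechet_derivative f (at x) v" "\<lambda>x. f' x v" n]
      fun_cong[OF frechet_derivative_at[OF fD], of _ v] Cn_on_open_SucD(2)[OF Suc.prems] by metis
  then have "Cn_on_open n V (\<lambda>y. f' (g y) v)" for v
    by (rule Cn_on_open_compose[OF \<open>open V\<close> \<open>open U\<close> gV g])
  then have "Cn_on_open n V (\<lambda>y. inv_into UNIV (f' (g y)) v)" for v
    by (intro Cn_on_open_linear_solution \<open>open V\<close> bij) (use has_derivative_linear[OF fD] gV in auto)
  then show ?case
    by (intro Cn_on_open_SucI[OF \<open>open V\<close> gD])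
qed

section \<open>Orders up to infinity, and maps on arbitrary subsets\<close>

lemma Ck_on_open_infinity: "Ck_on_open \<infinity> U f \<longleftrightarrow> (\<forall>n. Cn_on_open n U f)"
  by (simp add: Ck_on_open_def)

lemma Ck_on_open_1: "Ck_on_open 1 U f \<longleftrightarrow> Cn_on_open (Suc 0) U f"
  unfolding Ck_on_open_def one_enat_def enat_ord_simps
  by (metis Cn_on_open_le One_nat_def order_refl)

lemma Ck_on_open_le: "Ck_on_open k U f \<Longrightarrow> l \<le> k \<Longrightarrow> Ck_on_open l U f"
  unfolding Ck_on_open_def by (meson order_trans)

lemma Ck_on_open_mono: "Ck_on_open k U f \<Longrightarrow> V \<subseteq> U \<Longrightarrow> Ck_on_open k V f"
  unfolding Ck_on_open_def by (metis Cn_on_open_mono)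

lemma Ck_on_open_continuous: "Ck_on_open k U f \<Longrightarrow> continuous_on U f"
  unfolding Ck_on_open_def by (metis Cn_on_open.simps(1) zero_le zero_enat_def)

lemma Ck_on_open_const: "Ck_on_open k U (\<lambda>x. c)"
  by (simp add: Ck_on_open_def Cn_on_open_const)

lemma Ck_on_open_linear:
  fixes f :: "'a::euclidean_space \<Rightarrow> 'b::euclidean_space"
  shows "linear f \<Longrightarrow> Ck_on_open k U f"
  by (simp add: Ck_on_open_def Cn_on_open_linear)

lemma Ck_on_open_id: "Ck_on_open k U (\<lambda>x. x)"
  by (simp add: Ck_on_open_def Cn_on_open_id)

lemma Ck_on_open_add:
  "open U \<Longrightarrow> Ck_on_open k U f \<Longrightarrow> Ck_on_open k U g \<Longrightarrow> Ck_on_open k U (\<lambda>x. f x + g x)"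
  by (simp add: Ck_on_open_def Cn_on_open_add)

lemma Ck_on_open_bilinear:
  "bounded_bilinear bil \<Longrightarrow> open U \<Longrightarrow> Ck_on_open k U f \<Longrightarrow> Ck_on_open k U g \<Longrightarrow>
    Ck_on_open k U (\<lambda>x. bil (f x) (g x))"
  by (simp add: Ck_on_open_def Cn_on_open_bilinear)

lemma Ck_on_open_diff:
  assumes "open U" "Ck_on_open k U f" "Ck_on_open k U g"
  shows "Ck_on_open k U (\<lambda>x. f x - g x)"
  using Ck_on_open_add[OF assms(1,2) Ck_on_open_bilinear[OF bounded_bilinear_scaleR assms(1) Ck_on_open_const assms(3), of "-1"]]
  by simp

lemma Ck_on_open_compose:
  "open U \<Longrightarrow> open V \<Longrightarrow> f ` U \<subseteq> V \<Longrightarrow> Ck_on_open k U f \<Longrightarrow> Ck_on_open k V g \<Longrightarrow>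
    Ck_on_open k U (\<lambda>x. g (f x))"
  unfolding Ck_on_open_def by (blast intro: Cn_on_open_compose)

lemma Ck_on_open_inverse:
  fixes f :: "'a::euclidean_space \<Rightarrow> real"
  shows "open U \<Longrightarrow> Ck_on_open k U f \<Longrightarrow> (\<And>x. x \<in> U \<Longrightarrow> f x \<noteq> 0) \<Longrightarrow> Ck_on_open k U (\<lambda>x. inverse (f x))"
  by (simp add: Ck_on_open_def Cn_on_open_inverse)

lemma Ck_on_open_sqrt:
  fixes f :: "'a::euclidean_space \<Rightarrow> real"
  shows "open U \<Longrightarrow> Ck_on_open k U f \<Longrightarrow> (\<And>x. x \<in> U \<Longrightarrow> f x > 0) \<Longrightarrow> Ck_on_open k U (\<lambda>x. sqrt (f x))"
  by (simp add: Ck_on_open_def Cn_on_open_sqrt)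

lemma Ck_on_open_derivative:
  assumes "Ck_on_open \<infinity> U f"
  shows "x \<in> U \<Longrightarrow> (f has_derivative frechet_derivative f (at x)) (at x)"
    and "Ck_on_open \<infinity> U (\<lambda>x. frechet_derivative f (at x) v)"
  using assms unfolding Ck_on_open_infinity by (metis Cn_on_open_SucD)+

lemma Ck_on_open_1_derivative:
  assumes "Ck_on_open 1 U f"
  shows "x \<in> U \<Longrightarrow> (f has_derivative frechet_derivative f (at x)) (at x)"
    and "continuous_on U (\<lambda>x. frechet_derivative f (at x) v)"
  using assms unfolding Ck_on_open_1 by (metis Cn_on_open_SucD Cn_on_open.simps(1))+

lemma Ck_map_onE:
  assumes "Ck_map_on k A f" "p \<in> A"
  obtains U F where "open U" "p \<in> U" "Ck_on_open k U F" "\<And>x. x \<in> U \<inter> A \<Longrightarrow> F x = f x"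
  using assms unfolding Ck_map_on_def by metis

lemma Ck_map_onI:
  assumes "\<And>p. p \<in> A \<Longrightarrow> \<exists>U F. open U \<and> p \<in> U \<and> Ck_on_open k U F \<and> (\<forall>x\<in>U \<inter> A. F x = f x)"
  shows "Ck_map_on k A f"
  using assms unfolding Ck_map_on_def by (rule ballI)

lemma Ck_on_open_imp_map_on:
  assumes "open U" "Ck_on_open k U f" "A \<subseteq> U" shows "Ck_map_on k A f"
proof (rule Ck_map_onI)
  fix p assume "p \<in> A"
  then show "\<exists>U F. open U \<and> p \<in> U \<and> Ck_on_open k U F \<and> (\<forall>x\<in>U \<inter> A. F x = f x)"
    using assms by (intro exI[of _ U] exI[of _ f]) auto
qed

lemma Ck_map_on_const: "Ck_map_on k A (\<lambda>x. c)"
  using Ck_on_open_imp_map_on[OF open_UNIV Ck_on_open_const] by blast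

lemma Ck_map_on_linear:
  fixes f :: "'a::euclidean_space \<Rightarrow> 'b::euclidean_space"
  shows "linear f \<Longrightarrow> Ck_map_on k A f"
  using Ck_on_open_imp_map_on[OF open_UNIV Ck_on_open_linear] by blast

lemma Ck_map_on_continuous:
  assumes "Ck_map_on k A f" shows "continuous_on A f"
  unfolding continuous_on_eq_continuous_within
proof
  fix p assume "p \<in> A"
  then obtain U F where U: "open U" "p \<in> U" "Ck_on_open k U F" "\<And>x. x \<in> U \<inter> A \<Longrightarrow> F x = f x"
    using Ck_map_onE[OF assms] by metis
  have "continuous (at p within A) F"
    using Ck_on_open_continuous[OF U(3)] U(1,2) by (simp add: continuous_on_eq_continuous_at continuous_at_imp_continuous_at_within)
  moreover obtain e where "e > 0" "ball p e \<subseteq> U"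
    using U(1,2) openE by blast
  ultimately show "continuous (at p within A) f"
    using U(4) \<open>p \<in> A\<close> by (intro continuous_transform_within[of p A F e f]) (auto simp: dist_commute subset_eq)
qed

lemma Ck_map_on_binop:
  fixes A :: "'a::euclidean_space set"
  assumes op: "\<And>(U :: 'a set) F G. open U \<Longrightarrow> Ck_on_open k U F \<Longrightarrow> Ck_on_open k U G \<Longrightarrow> Ck_on_open k U (\<lambda>x. bop (F x) (G x))"
    and f: "Ck_map_on k A f" and g: "Ck_map_on k A g"
  shows "Ck_map_on k A (\<lambda>x. bop (f x) (g x))"
  unfolding Ck_map_on_def
proof
  fix p assume p: "p \<in> A"
  obtain U F where U: "open U" "p \<in> U" "Ck_on_open k U F" "\<And>x. x \<in> U \<inter> A \<Longrightarrow> F x = f x"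
    using Ck_map_onE[OF f p] by metis
  obtain V G where V: "open V" "p \<in> V" "Ck_on_open k V G" "\<And>x. x \<in> V \<inter> A \<Longrightarrow> G x = g x"
    using Ck_map_onE[OF g p] by metis
  have "Ck_on_open k (U \<inter> V) (\<lambda>x. bop (F x) (G x))"
    by (rule op[OF open_Int[OF U(1) V(1)] Ck_on_open_mono[OF U(3)] Ck_on_open_mono[OF V(3)]]) auto
  then show "\<exists>U F. open U \<and> p \<in> U \<and> Ck_on_open k U F \<and> (\<forall>x\<in>U \<inter> A. F x = bop (f x) (g x))"
    using U V by (intro exI[of _ "U \<inter> V"] exI[of _ "\<lambda>x. bop (F x) (G x)"]) auto
qed

lemma Ck_map_on_add:
  "Ck_map_on k A f \<Longrightarrow> Ck_map_on k A g \<Longrightarrow> Ck_map_on k A (\<lambda>x. f x + g x)"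
  by (rule Ck_map_on_binop[where bop="(+)"], rule Ck_on_open_add)

lemma Ck_map_on_diff:
  "Ck_map_on k A f \<Longrightarrow> Ck_map_on k A g \<Longrightarrow> Ck_map_on k A (\<lambda>x. f x - g x)"
  by (rule Ck_map_on_binop[where bop="(-)"], rule Ck_on_open_diff)

lemma Ck_map_on_scaleR:
  "Ck_map_on k A f \<Longrightarrow> Ck_map_on k A g \<Longrightarrow> Ck_map_on k A (\<lambda>x. f x *\<^sub>R g x)"
  by (rule Ck_map_on_binop[where bop="(*\<^sub>R)"], rule Ck_on_open_bilinear[OF bounded_bilinear_scaleR])

lemma Ck_map_on_inner:
  "Ck_map_on k A f \<Longrightarrow> Ck_map_on k A g \<Longrightarrow> Ck_map_on k A (\<lambda>x. f x \<bullet> g x)"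
  by (rule Ck_map_on_binop[where bop="(\<bullet>)"], rule Ck_on_open_bilinear[OF bounded_bilinear_inner])

lemma Ck_map_on_sum:
  assumes "\<And>i. i \<in> I \<Longrightarrow> Ck_map_on k A (f i)"
  shows "Ck_map_on k A (\<lambda>x. \<Sum>i\<in>I. f i x)"
  using assms
  by (induction I rule: infinite_finite_induct) (auto simp: Ck_map_on_const intro: Ck_map_on_add)

lemma Ck_map_on_compose:
  assumes f: "Ck_map_on k A f" and g: "Ck_map_on k B g" and "f ` A \<subseteq> B"
  shows "Ck_map_on k A (\<lambda>x. g (f x))"
  unfolding Ck_map_on_def
proof
  fix p assume p: "p \<in> A"
  then have fp: "f p \<in> B" using assms(3) by blast
  obtain U F where U: "open U" "p \<in> U" "Ck_on_open k U F" "\<And>x. x \<in> U \<inter> A \<Longrightarrow> F x = f x"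
    using Ck_map_onE[OF f p] by metis
  obtain V G where V: "open V" "f p \<in> V" "Ck_on_open k V G" "\<And>x. x \<in> V \<inter> B \<Longrightarrow> G x = g x"
    using Ck_map_onE[OF g fp] by metis
  \<comment> \<open>The extension of \<open>f\<close> may leave the domain of the extension of
    \<open>g\<close>, so the neighbourhood is cut down to a preimage.\<close>
  define W where "W = U \<inter> F -` V"
  have W: "open W"
    unfolding W_def using continuous_open_preimage[OF Ck_on_open_continuous[OF U(3)] U(1) V(1)] .
  have "Ck_on_open k W (\<lambda>x. G (F x))"
    by (rule Ck_on_open_compose[OF W V(1) _ Ck_on_open_mono[OF U(3)] V(3)]) (auto simp: W_def)
  moreover have "p \<in> W" using U V p by (auto simp: W_def)
  moreover have "G (F x) = g (f x)" if "x \<in> W \<inter> A" for x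
    using that U(4)[of x] V(4)[of "f x"] assms(3) by (auto simp: W_def)
  ultimately show "\<exists>U F. open U \<and> p \<in> U \<and> Ck_on_open k U F \<and> (\<forall>x\<in>U \<inter> A. F x = g (f x))"
    using W by blast
qed

lemma Ck_map_on_inverse:
  fixes f :: "'a::euclidean_space \<Rightarrow> real"
  assumes "Ck_map_on k A f" "\<And>x. x \<in> A \<Longrightarrow> f x \<noteq> 0"
  shows "Ck_map_on k A (\<lambda>x. inverse (f x))"
proof -
  have o: "open {x::real. x \<noteq> 0}" by (simp add: open_Collect_neq)
  show ?thesis
    by (rule Ck_map_on_compose[OF assms(1) Ck_on_open_imp_map_on[OF o, of k _ "{x. x \<noteq> 0}"]])
      (use assms(2) o in \<open>auto intro: Ck_on_open_inverse Ck_on_open_id\<close>)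
qed

lemma Ck_map_on_sqrt:
  fixes f :: "'a::euclidean_space \<Rightarrow> real"
  assumes "Ck_map_on k A f" "\<And>x. x \<in> A \<Longrightarrow> f x > 0"
  shows "Ck_map_on k A (\<lambda>x. sqrt (f x))"
proof -
  have o: "open {x::real. x > 0}" by (simp add: open_Collect_less)
  show ?thesis
    by (rule Ck_map_on_compose[OF assms(1) Ck_on_open_imp_map_on[OF o, of k _ "{x. x > 0}"]])
      (use assms(2) o in \<open>auto intro: Ck_on_open_sqrt Ck_on_open_id\<close>)
qed

text \<open>Along segments from \<open>x\<close> into \<open>S\<close> the derivative is a one-sided
  derivative in one variable, hence unique; these directions span the space. In particular the
  derivative within the closed ball is determined at boundary points too.\<close>

lemma has_derivative_within_unique_convex:
  fixes f :: "'a::euclidean_space \<Rightarrow> 'b::real_normed_vector"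
  assumes S: "convex S" "interior S \<noteq> {}" "x \<in> S"
    and f': "(f has_derivative f') (at x within S)" and f'': "(f has_derivative f'') (at x within S)"
  shows "f' = f''"
proof -
  have lin: "linear f'" "linear f''"
    using f' f'' has_derivative_linear by auto
  have along: "f' (y - x) = f'' (y - x)" if "y \<in> S" for y
  proof -
    define c where "c t = x + t *\<^sub>R (y - x)" for t :: real
    have cS: "c t \<in> S" if "t \<in> {0..1}" for t
    proof -
      have "(1 - t) *\<^sub>R x + t *\<^sub>R y \<in> S"
        using S(1,3) \<open>y \<in> S\<close> that convexD_alt by fastforce
      then show ?thesis by (simp add: c_def algebra_simps)
    qed
    have c: "(c has_derivative (\<lambda>h. h *\<^sub>R (y - x))) (at 0 within {0..1})"
      unfolding c_def by (auto intro!: derivative_eq_intros)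
    have "((\<lambda>t. f (c t)) has_derivative (\<lambda>h. g (h *\<^sub>R (y - x)))) (at 0 within {0..1})"
      if "(f has_derivative g) (at x within S)" for g
    proof -
      have "(f has_derivative g) (at (c 0) within c ` {0..1})"
        using that cS by (auto simp: c_def[of 0] intro: has_derivative_subset)
      then show ?thesis
        using diff_chain_within[OF c, of f g] by (simp add: o_def)
    qed
    from this[OF f'] this[OF f'']
    have "((\<lambda>t. f (c t)) has_vector_derivative f' (y - x)) (at 0 within {0..1})"
      "((\<lambda>t. f (c t)) has_vector_derivative f'' (y - x)) (at 0 within {0..1})"
      using lin by (simp_all add: has_vector_derivative_def linear_scale)
    then show ?thesis
      by (rule vector_derivative_unique_within[rotated]) (simp add: at_within_Icc_at_right)
  qed
  \<comment> \<open>Since \<open>S\<close> contains a ball, every vector is a multiple of a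
    difference of two directions that point from \<open>x\<close> into \<open>S\<close>.\<close>
  obtain y e where e: "e > 0" "ball y e \<subseteq> S"
    using S(2) by (meson ex_in_conv mem_interior)
  show ?thesis
  proof
    fix v
    show "f' v = f'' v"
    proof (cases "v = 0")
      case True
      then show ?thesis using lin by (simp add: linear_0)
    next
      case False
      define t where "t = e / (2 * norm v)"
      have t: "t > 0" "y + t *\<^sub>R v \<in> S" "y \<in> S"
        using e False by (auto simp: t_def dist_norm intro!: subsetD[OF e(2)])
      have "f' (t *\<^sub>R v) = f' (y + t *\<^sub>R v - x) - f' (y - x)"
        "f'' (t *\<^sub>R v) = f'' (y + t *\<^sub>R v - x) - f'' (y - x)"
        using lin by (simp_all flip: linear_diff)
      then have "t *\<^sub>R f' v = t *\<^sub>R f'' v"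
        by (simp only: along[OF t(2)] along[OF t(3)] linear_scale[OF lin(1)] linear_scale[OF lin(2)])
      then show ?thesis using t(1) by simp
    qed
  qed
qed

text \<open>The derivative within \<open>S\<close> is that of any local extension, whichever is
  chosen. Hence the derivatives of the extensions are local extensions of the directional
  derivatives, and smoothness passes to these.\<close>

lemma Ck_map_on_convex_derivative:
  fixes f :: "'a::euclidean_space \<Rightarrow> 'b::euclidean_space"
  assumes S: "convex S" "interior S \<noteq> {}" and f: "Ck_map_on \<infinity> S f"
  shows "x \<in> S \<Longrightarrow> (f has_derivative frechet_derivative f (at x within S)) (at x within S)"
    and "Ck_map_on \<infinity> S (\<lambda>x. frechet_derivative f (at x within S) v)"
    and "open U \<Longrightarrow> Ck_on_open \<infinity> U F \<Longrightarrow> (\<And>x. x \<in> U \<inter> S \<Longrightarrow> F x = f x) \<Longrightarrow> x \<in> U \<inter> S \<Longrightarrow>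
      frechet_derivative f (at x within S) = frechet_derivative F (at x)"
proof -
  have D: "(f has_derivative frechet_derivative F (at x)) (at x within S)"
    if U: "open U" "Ck_on_open \<infinity> U F" "\<And>x. x \<in> U \<inter> S \<Longrightarrow> F x = f x" and x: "x \<in> U \<inter> S" for x U F
  proof -
    have "(F has_derivative frechet_derivative F (at x)) (at x within S)"
      using Ck_on_open_derivative(1)[OF U(2)] x has_derivative_at_withinI by blast
    moreover obtain e where "e > 0" "ball x e \<subseteq> U"
      using U(1) x openE by blast
    ultimately show ?thesis
      using x U(3) by (intro has_derivative_transform_within[of F _ x S e f]) (auto simp: dist_commute subset_eq)
  qed
  show 1: "(f has_derivative frechet_derivative f (at x within S)) (at x within S)" if x: "x \<in> S" for x
  proof -
    obtain U F where "open U" "x \<in> U" "Ck_on_open \<infinity> U F" "\<And>y. y \<in> U \<inter> S \<Longrightarrow> F y = f y"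
      using Ck_map_onE[OF f x] by metis
    then have "f differentiable at x within S"
      using D[of U F x] x by (auto simp: differentiable_def)
    then show ?thesis using frechet_derivative_works by blast
  qed
  show 3: "frechet_derivative f (at x within S) = frechet_derivative F (at x)"
    if U: "open U" "Ck_on_open \<infinity> U F" "\<And>x. x \<in> U \<inter> S \<Longrightarrow> F x = f x" and x: "x \<in> U \<inter> S" for x U F
    using x by (intro has_derivative_within_unique_convex[OF S _ 1 D[OF U]]) auto
  show "Ck_map_on \<infinity> S (\<lambda>x. frechet_derivative f (at x within S) v)"
    unfolding Ck_map_on_def
  proof
    fix p assume "p \<in> S"
    then obtain U F where U: "open U" "p \<in> U" "Ck_on_open \<infinity> U F" "\<And>y. y \<in> U \<inter> S \<Longrightarrow> F y = f y"
      using Ck_map_onE[OF f] by metis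
    show "\<exists>U F. open U \<and> p \<in> U \<and> Ck_on_open \<infinity> U F \<and> (\<forall>x\<in>U \<inter> S. F x = frechet_derivative f (at x within S) v)"
      using U 3[OF U(1,3,4)] Ck_on_open_derivative(2)[OF U(3), of v]
      by (intro exI[of _ U] exI[of _ "\<lambda>x. frechet_derivative F (at x) v"]) auto
  qed
qed

section \<open>The closed ball and submanifold charts\<close>

abbreviation unit_cball :: "'a::euclidean_space set" ("\<B>") where
  "\<B> \<equiv> cball 0 1"

abbreviation smooth_on_cball :: "('a::euclidean_space \<Rightarrow> 'b::euclidean_space) \<Rightarrow> bool" where
  "smooth_on_cball \<equiv> Ck_map_on \<infinity> \<B>"

abbreviation D_cball :: "('a::euclidean_space \<Rightarrow> 'b::euclidean_space) \<Rightarrow> 'a \<Rightarrow> 'a \<Rightarrow> 'b" where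
  "D_cball f x \<equiv> frechet_derivative f (at x within \<B>)"

text \<open>Inversion in the unit sphere. Since \<open>inverse 0 = 0\<close>, it fixes 0 and is an
  involution of the whole space, which spares the inverse laws a side condition.\<close>

definition inversion :: "'a::euclidean_space \<Rightarrow> 'a" where
  "inversion z = inverse (z \<bullet> z) *\<^sub>R z"

text \<open>
  Inversion centred at the antipode \<open>-p\<close> of a boundary point \<open>p\<close> of the unit ball takes the
  ball to a half-space.
\<close>

definition ball_chart :: "'a::euclidean_space \<Rightarrow> 'a \<Rightarrow> 'a" where
  "ball_chart p x = inversion (x + p) - (1/2) *\<^sub>R p"

definition ball_param :: "'a::euclidean_space \<Rightarrow> 'a \<Rightarrow> 'a" where
  "ball_param p w = inversion (w + (1/2) *\<^sub>R p) - p"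

section \<open>Inversion as a chart of the ball\<close>

lemma inversion_inversion: "inversion (inversion z) = z"
  by (cases "z = 0") (simp_all add: inversion_def)

lemma inversion_eq_0_iff: "inversion z = 0 \<longleftrightarrow> z = 0"
  by (simp add: inversion_def)

lemma Ck_on_open_inversion:
  assumes "open U" "0 \<notin> U" shows "Ck_on_open k U (inversion :: 'a::euclidean_space \<Rightarrow> 'a)"
  unfolding inversion_def
  by (intro Ck_on_open_bilinear[OF bounded_bilinear_scaleR] Ck_on_open_inverse
      Ck_on_open_bilinear[OF bounded_bilinear_inner] Ck_on_open_id assms)
    (use assms(2) in auto)

lemma open_delete_UNIV: "open (- {x::'a::t1_space})"
  by auto

lemma Ck_on_open_translation_inversion:
  fixes a b :: "'a::euclidean_space"
  shows "Ck_on_open k (- {- a}) (\<lambda>x. inversion (x + a) - b)"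
proof (intro Ck_on_open_diff open_delete_UNIV Ck_on_open_const)
  show "Ck_on_open k (- {- a}) (\<lambda>x. inversion (x + a))"
    by (rule Ck_on_open_compose[OF open_delete_UNIV open_delete_UNIV _ _ Ck_on_open_inversion, of "\<lambda>x. x + a" "-a" 0])
      (auto simp: eq_neg_iff_add_eq_0 intro!: Ck_on_open_add Ck_on_open_id Ck_on_open_const)
qed

lemma Ck_on_open_ball_chart: "Ck_on_open k (- {- p}) (ball_chart p)"
  unfolding ball_chart_def[abs_def] by (rule Ck_on_open_translation_inversion)

lemma Ck_on_open_ball_param: "Ck_on_open k (- {- (1/2) *\<^sub>R p}) (ball_param p)"
  using Ck_on_open_translation_inversion[of k "(1/2) *\<^sub>R p" p] unfolding ball_param_def[abs_def] by simp

lemma homeomorphism_ball_chart: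
  "homeomorphism (- {- p}) (- {- (1/2) *\<^sub>R p}) (ball_chart p) (ball_param p)"
proof (rule homeomorphismI)
  show "continuous_on (- {- p}) (ball_chart p)" "continuous_on (- {- (1/2) *\<^sub>R p}) (ball_param p)"
    using Ck_on_open_continuous[OF Ck_on_open_ball_chart] Ck_on_open_continuous[OF Ck_on_open_ball_param] by auto
  show "ball_param p (ball_chart p x) = x" "ball_chart p (ball_param p x) = x" for x
    by (simp_all add: ball_chart_def ball_param_def inversion_inversion)
  have "inversion z - c = - c \<longleftrightarrow> z = 0" for z c :: 'a
    using inversion_eq_0_iff[of z] by (simp add: diff_eq_eq)
  then have "ball_chart p x \<noteq> - (1/2) *\<^sub>R p" if "x \<noteq> - p" for x
    using that unfolding ball_chart_def scaleR_minus_left by (simp add: eq_neg_iff_add_eq_0)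
  moreover have "ball_param p w \<noteq> - p" if "w \<noteq> - (1/2) *\<^sub>R p" for w
    using that inversion_eq_0_iff[of "w + (1/2) *\<^sub>R p"] by (simp add: ball_param_def eq_neg_iff_add_eq_0)
  ultimately show "ball_chart p ` (- {- p}) \<subseteq> - {- (1/2) *\<^sub>R p}" "ball_param p ` (- {- (1/2) *\<^sub>R p}) \<subseteq> - {- p}"
    unfolding image_subset_iff Compl_iff singleton_iff by simp_all
qed

text \<open>In the coordinate \<open>w\<close> the function 1 - |x|^2 becomes the linear function
  \<open>p \<bullet> w\<close> times a positive smooth factor. This shows that the ball becomes a
  half-space, and it converts division by 1 - |x|^2 into division by a linear function.\<close>

lemma ball_param_norm:
  assumes p: "norm p = 1" and w: "w \<noteq> - (1/2) *\<^sub>R p"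
  shows "1 - (norm (ball_param p w))\<^sup>2 = 2 * (p \<bullet> w) * inverse ((norm (w + (1/2) *\<^sub>R p))\<^sup>2)"
proof -
  define z where "z = w + (1/2) *\<^sub>R p"
  have pp: "p \<bullet> p = 1" using p by (simp add: dot_square_norm)
  have z: "z \<bullet> z \<noteq> 0" using w by (simp add: z_def eq_neg_iff_add_eq_0)
  have "(norm (ball_param p w))\<^sup>2 = (inverse (z \<bullet> z) *\<^sub>R z - p) \<bullet> (inverse (z \<bullet> z) *\<^sub>R z - p)"
    by (simp add: ball_param_def z_def inversion_def dot_square_norm)
  also have "\<dots> = inverse (z \<bullet> z) - 2 * inverse (z \<bullet> z) * (p \<bullet> z) + 1"
    using z pp by (simp add: inner_diff inner_commute field_simps)
  finally have "1 - (norm (ball_param p w))\<^sup>2 = (2 * (p \<bullet> z) - 1) * inverse (z \<bullet> z)"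
    by (simp add: algebra_simps)
  also have "2 * (p \<bullet> z) - 1 = 2 * (p \<bullet> w)"
    using pp by (simp add: z_def inner_add)
  finally show ?thesis
    by (simp add: z_def dot_square_norm)
qed

lemma ball_chart_self: "norm p = 1 \<Longrightarrow> ball_chart p p = 0"
proof -
  assume "norm p = 1"
  then have "p \<bullet> p = 1" by (simp add: dot_square_norm)
  then show ?thesis
    by (simp add: ball_chart_def inversion_def inner_add flip: scaleR_2)
qed

lemma norm_ball_param_le_iff:
  assumes p: "norm p = 1" and w: "w \<noteq> - (1/2) *\<^sub>R p"
  shows "norm (ball_param p w) \<le> 1 \<longleftrightarrow> 0 \<le> p \<bullet> w" "norm (ball_param p w) = 1 \<longleftrightarrow> p \<bullet> w = 0"
proof -
  have pos: "(norm (w + (1/2) *\<^sub>R p))\<^sup>2 > 0"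
    using w by (simp add: eq_neg_iff_add_eq_0)
  have "norm (ball_param p w) \<le> 1 \<longleftrightarrow> 0 \<le> 1 - (norm (ball_param p w))\<^sup>2"
    by (simp add: power2_nonneg_ge_1_iff abs_square_le_1)
  then show "norm (ball_param p w) \<le> 1 \<longleftrightarrow> 0 \<le> p \<bullet> w"
    unfolding ball_param_norm[OF p w] using pos by (simp add: zero_le_mult_iff)
  have "norm (ball_param p w) = 1 \<longleftrightarrow> 1 - (norm (ball_param p w))\<^sup>2 = 0"
    by (simp add: power2_eq_1_iff) (use norm_ge_zero[of "ball_param p w"] in linarith)
  then show "norm (ball_param p w) = 1 \<longleftrightarrow> p \<bullet> w = 0"
    unfolding ball_param_norm[OF p w] using pos w by auto
qed

text \<open>The case \<open>e = 0\<close> is an interior point, with model the whole space.\<close>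

lemma cball_local_model:
  fixes q :: "'a::euclidean_space"
  assumes "q \<in> \<B>"
  obtains U V and \<phi> \<psi> :: "'a \<Rightarrow> 'a" and e where "open U" "open V" "q \<in> U" "homeomorphism U V \<phi> \<psi>"
    "Ck_on_open \<infinity> U \<phi>" "Ck_on_open \<infinity> V \<psi>" "\<phi> ` (\<B> \<inter> U) = {w. 0 \<le> e \<bullet> w} \<inter> V" "e \<bullet> \<phi> q = 0"
proof (cases "norm q = 1")
  case False
  then have "q \<in> ball 0 1" using assms by auto
  then show ?thesis
    by (intro that[of "ball 0 1" "ball 0 1" "\<lambda>x. x" "\<lambda>x. x" 0])
      (auto simp: Ck_on_open_id homeomorphism_ident)
next
  case True
  have q: "q \<noteq> - q"
  proof
    assume "q = - q"
    then have "2 *\<^sub>R q = 0" by (simp add: scaleR_2 eq_neg_iff_add_eq_0)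
    then show False using True by simp
  qed
  note h = homeomorphism_ball_chart[of q]
  have "ball_chart q ` (\<B> \<inter> - {- q}) = {w. 0 \<le> q \<bullet> w} \<inter> - {- (1/2) *\<^sub>R q}"
  proof (intro equalityI subsetI)
    fix w assume "w \<in> ball_chart q ` (\<B> \<inter> - {- q})"
    then obtain x where x: "x \<in> \<B>" "x \<in> - {- q}" "w = ball_chart q x" by blast
    then have "ball_param q w = x" "w \<in> - {- (1/2) *\<^sub>R q}"
      using homeomorphism_apply1[OF h, of x] homeomorphism_image1[OF h] by auto
    then show "w \<in> {w. 0 \<le> q \<bullet> w} \<inter> - {- (1/2) *\<^sub>R q}"
      using norm_ball_param_le_iff(1)[OF True, of w] x(1) by auto
  next
    fix w assume w: "w \<in> {w. 0 \<le> q \<bullet> w} \<inter> - {- (1/2) *\<^sub>R q}"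
    then have "ball_param q w \<in> \<B>"
      using norm_ball_param_le_iff(1)[OF True, of w] by auto
    moreover have "ball_param q w \<in> - {- q}" "ball_chart q (ball_param q w) = w"
      using homeomorphism_apply2[OF h, of w] homeomorphism_image2[OF h] w by auto
    ultimately show "w \<in> ball_chart q ` (\<B> \<inter> - {- q})"
      by (metis IntI imageI)
  qed
  then show ?thesis
    using q by (intro that[OF _ _ _ h Ck_on_open_ball_chart Ck_on_open_ball_param]) (auto simp: ball_chart_self[OF True])
qed

text \<open>Membership in a tangent space asks for one chart that sends the vector into the model
  subspace. The local model serves as a chart with the whole space as this subspace, so the
  condition is void and no derivative has to be computed.\<close>

lemma tangent_space_cball:
  fixes q :: "'a::euclidean_space"
  assumes "q \<in> \<B>" shows "tangent_space \<B> q = UNIV"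
proof -
  obtain U V and \<phi> \<psi> :: "'a \<Rightarrow> 'a" and e where m: "open U" "open V" "q \<in> U" "homeomorphism U V \<phi> \<psi>"
    "Ck_on_open \<infinity> U \<phi>" "Ck_on_open \<infinity> V \<psi>" "\<phi> ` (\<B> \<inter> U) = {w. 0 \<le> e \<bullet> w} \<inter> V" "e \<bullet> \<phi> q = 0"
    by (rule cball_local_model[OF assms])
  then have fl: "flattens \<B> {w. 0 \<le> e \<bullet> w} q \<phi>"
    unfolding flattens_def using Ck_on_open_le[of \<infinity> _ _ 1] by (intro exI conjI) auto
  have "interior_chart \<B> q UNIV \<phi> \<or> boundary_chart \<B> q UNIV \<phi>"
  proof (cases "e = 0")
    case True
    then show ?thesis using fl assms by (simp add: interior_chart_def)
  next
    case False
    then show ?thesis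
      using fl assms m(8) unfolding boundary_chart_def by (intro disjI2 conjI bexI[of _ e]) auto
  qed
  then show ?thesis
    unfolding tangent_space_def by blast
qed

lemma straightening:
  fixes F :: "'a::euclidean_space \<Rightarrow> real^'m"
  assumes "open U" "q \<in> U" and F: "Ck_on_open \<infinity> U F" and inj: "inj (frechet_derivative F (at q))"
  obtains A B Z V and \<Phi> \<Psi> :: "real^'m \<Rightarrow> real^'m" where "linear A" "linear B" "\<And>x. B (A x) = x" "open Z" "open V" "A q \<in> Z"
    "homeomorphism Z V \<Phi> \<Psi>" "Ck_on_open \<infinity> Z \<Phi>" "Ck_on_open \<infinity> V \<Psi>"
    "\<And>x. A x \<in> Z \<Longrightarrow> x \<in> U \<and> \<Phi> (A x) = F x"
proof -
  define A where "A = frechet_derivative F (at q)"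
  have linA: "linear A"
    using Ck_on_open_derivative(1)[OF F \<open>q \<in> U\<close>] has_derivative_linear A_def by blast
  obtain B where linB: "linear B" and "B \<circ> A = id"
    using linear_injective_left_inverse[OF linA] inj A_def by blast
  then have BA: "B (A x) = x" for x by (metis comp_apply id_apply)
  define Z0 where "Z0 = B -` U"
  have Z0: "open Z0"
    unfolding Z0_def using linB
    by (intro open_vimage[OF \<open>open U\<close>] linear_continuous_on) (simp add: linear_conv_bounded_linear)
  define \<Phi> where "\<Phi> z = F (B z) + (z - A (B z))" for z
  have linAB: "linear (\<lambda>z. A (B z))"
    using linear_compose[OF linB linA] by (simp add: o_def)
  have FB: "Ck_on_open \<infinity> Z0 (\<lambda>z. F (B z))"
    by (rule Ck_on_open_compose[OF Z0 \<open>open U\<close> _ Ck_on_open_linear[OF linB] F]) (auto simp: Z0_def)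
  have \<Phi>: "Ck_on_open \<infinity> Z0 \<Phi>"
    unfolding \<Phi>_def by (intro Ck_on_open_add Ck_on_open_diff Ck_on_open_id Ck_on_open_linear[OF linAB] FB Z0)
  define \<Phi>' where "\<Phi>' z = Blinfun (frechet_derivative \<Phi> (at z))" for z
  have \<Phi>': "blinfun_apply (\<Phi>' z) = frechet_derivative \<Phi> (at z)" if "z \<in> Z0" for z
    unfolding \<Phi>'_def using Ck_on_open_derivative(1)[OF \<Phi> that] has_derivative_bounded_linear
    by (intro bounded_linear_Blinfun_apply) blast
  have der: "(\<Phi> has_derivative blinfun_apply (\<Phi>' z)) (at z)" if "z \<in> Z0" for z
    unfolding \<Phi>'[OF that] by (rule Ck_on_open_derivative(1)[OF \<Phi> that])
  have "continuous_on Z0 (\<lambda>z. blinfun_apply (\<Phi>' z) i)" for i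
    using Ck_on_open_continuous[OF Ck_on_open_derivative(2)[OF \<Phi>]] by (simp add: \<Phi>' cong: continuous_on_cong)
  then have cont: "continuous_on Z0 \<Phi>'"
    by (intro continuous_on_blinfun_componentwise)
  have Aq: "A q \<in> Z0" using \<open>q \<in> U\<close> by (simp add: Z0_def BA)
  have "(\<Phi> has_derivative (\<lambda>h. A (B h) + (h - A (B h)))) (at (A q))"
    unfolding \<Phi>_def
  proof (intro has_derivative_add has_derivative_diff has_derivative_ident)
    have "(F has_derivative A) (at (B (A q)))"
      using Ck_on_open_derivative(1)[OF F \<open>q \<in> U\<close>] by (simp only: BA A_def[symmetric])
    moreover have "(B has_derivative B) (at (A q))"
      using linB by (simp add: linear_conv_bounded_linear bounded_linear_imp_has_derivative)
    ultimately show "((\<lambda>z. F (B z)) has_derivative (\<lambda>h. A (B h))) (at (A q))"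
      using diff_chain_at[of B B "A q" F A] by (simp add: o_def)
    show "((\<lambda>z. A (B z)) has_derivative (\<lambda>h. A (B h))) (at (A q))"
      using linAB by (simp add: linear_conv_bounded_linear bounded_linear_imp_has_derivative)
  qed
  from has_derivative_unique[OF der[OF Aq] this]
  have "blinfun_apply (\<Phi>' (A q)) = (\<lambda>h. h)"
    by simp
  then have id: "id_blinfun o\<^sub>L \<Phi>' (A q) = id_blinfun"
    by (intro blinfun_eqI) simp
  note ift = inverse_function_theorem[OF Z0 der cont Aq id]
  obtain Z V \<Psi> \<Psi>' where Z: "open Z" "Z \<subseteq> Z0" "A q \<in> Z" "open V" "\<Phi> (A q) \<in> V" "homeomorphism Z V \<Phi> \<Psi>"
    and \<Psi>': "\<And>y. y \<in> V \<Longrightarrow> (\<Psi> has_derivative \<Psi>' y) (at y)"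
      "\<And>y. y \<in> V \<Longrightarrow> \<Psi>' y = inv_into UNIV (blinfun_apply (\<Phi>' (\<Psi> y)))"
      "\<And>y. y \<in> V \<Longrightarrow> bij (blinfun_apply (\<Phi>' (\<Psi> y)))"
    by (rule ift, assumption) (rule that)
  have \<Phi>Z: "Ck_on_open \<infinity> Z \<Phi>"
    by (rule Ck_on_open_mono[OF \<Phi> Z(2)])
  have \<Phi>Zn: "Cn_on_open n Z \<Phi>" for n
    using \<Phi>Z unfolding Ck_on_open_infinity by blast
  have derZ: "(\<Phi> has_derivative blinfun_apply (\<Phi>' z)) (at z)" if "z \<in> Z" for z
    by (rule der[OF subsetD[OF Z(2) that]])
  have der\<Psi>: "(\<Psi> has_derivative inv_into UNIV (blinfun_apply (\<Phi>' (\<Psi> y)))) (at y)" if "y \<in> V" for y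
    using \<Psi>'(1)[OF that] unfolding \<Psi>'(2)[OF that] .
  \<comment> \<open>The inverse function theorem has identified the derivative of \<Psi> with the
    inverse of that of \<Phi>; bootstrapping gives every order.\<close>
  have "Cn_on_open n V \<Psi>" for n
    by (rule Cn_on_open_inverse_function[OF Z(1,4,6) \<Phi>Zn derZ der\<Psi> \<Psi>'(3)])
  then have "Ck_on_open \<infinity> V \<Psi>"
    unfolding Ck_on_open_infinity by blast
  moreover have "x \<in> U \<and> \<Phi> (A x) = F x" if "A x \<in> Z" for x
    using that Z(2) by (auto simp: Z0_def BA \<Phi>_def)
  ultimately show ?thesis
    by (intro that[OF linA linB BA Z(1,4,3,6) \<Phi>Z])
qed

text \<open>The left inverse is defined on an open set of the target, beyond the image of
  \<open>F\<close>; it serves as a smooth local extension of the inverse of an embedding.\<close>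

lemma smooth_left_inverse:
  fixes F :: "'a::euclidean_space \<Rightarrow> real^'m"
  assumes "open U" "q \<in> U" "Ck_on_open \<infinity> U F" "inj (frechet_derivative F (at q))"
  obtains N V \<Lambda> where "open N" "q \<in> N" "N \<subseteq> U" "open V" "F ` N \<subseteq> V" "Ck_on_open \<infinity> V \<Lambda>" "\<And>x. x \<in> N \<Longrightarrow> \<Lambda> (F x) = x"
proof -
  obtain A B Z V and \<Phi> \<Psi> :: "real^'m \<Rightarrow> real^'m" where s: "linear A" "linear B" "\<And>x. B (A x) = x" "open Z" "open V" "A q \<in> Z"
    "homeomorphism Z V \<Phi> \<Psi>" "Ck_on_open \<infinity> Z \<Phi>" "Ck_on_open \<infinity> V \<Psi>"
    "\<And>x. A x \<in> Z \<Longrightarrow> x \<in> U \<and> \<Phi> (A x) = F x"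
    by (rule straightening[OF assms]) (rule that)
  have "open (A -` Z)"
    using s(1,4) by (intro open_vimage linear_continuous_on) (auto simp: linear_conv_bounded_linear)
  moreover have "F ` (A -` Z) \<subseteq> V"
  proof
    fix y assume "y \<in> F ` (A -` Z)"
    then obtain x where "A x \<in> Z" "y = \<Phi> (A x)" using s(10) by force
    then show "y \<in> V" using homeomorphism_image1[OF s(7)] by blast
  qed
  moreover have "Ck_on_open \<infinity> V (\<lambda>y. B (\<Psi> y))"
    by (rule Ck_on_open_compose[OF s(5) open_UNIV _ s(9) Ck_on_open_linear[OF s(2)]]) simp
  moreover have "B (\<Psi> (F x)) = x" if "x \<in> A -` Z" for x
    using that s(3) s(10)[of x] homeomorphism_apply1[OF s(7), of "A x"] by simp
  ultimately show ?thesis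
    using that[of "A -` Z" V "\<lambda>y. B (\<Psi> y)"] s(5,6,10) by blast
qed

section \<open>Images of the ball as submanifolds with boundary\<close>

lemma frechet_derivative_compose_at:
  assumes "(f has_derivative f') (at x)" "(g has_derivative g') (at (f x))"
  shows "frechet_derivative (\<lambda>x. g (f x)) (at x) = (\<lambda>v. g' (f' v))"
  using frechet_derivative_at[OF diff_chain_at[OF assms]] by (simp add: o_def)

text \<open>Differentiating \<open>\<phi> (\<psi> y) = y\<close> gives a left inverse of the
  derivative of \<psi>.\<close>

lemma inj_frechet_derivative_homeomorphism:
  fixes \<phi> \<psi> :: "'a::euclidean_space \<Rightarrow> 'a"
  assumes "open V" and hom: "homeomorphism U V \<phi> \<psi>"
    and \<phi>: "Ck_on_open 1 U \<phi>" and \<psi>: "Ck_on_open 1 V \<psi>" and "y \<in> V"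
  shows "inj (frechet_derivative \<psi> (at y))"
proof -
  have \<psi>y: "\<psi> y \<in> U" using homeomorphism_image2[OF hom] \<open>y \<in> V\<close> by blast
  have "((\<lambda>y. \<phi> (\<psi> y)) has_derivative (\<lambda>v. frechet_derivative \<phi> (at (\<psi> y)) (frechet_derivative \<psi> (at y) v))) (at y)"
    using diff_chain_at[OF Ck_on_open_1_derivative(1)[OF \<psi> \<open>y \<in> V\<close>] Ck_on_open_1_derivative(1)[OF \<phi> \<psi>y]]
    by (simp add: o_def)
  then have "((\<lambda>y. y) has_derivative (\<lambda>v. frechet_derivative \<phi> (at (\<psi> y)) (frechet_derivative \<psi> (at y) v))) (at y)"
    by (rule has_derivative_transform_within_open[OF _ \<open>open V\<close> \<open>y \<in> V\<close>]) (rule homeomorphism_apply2[OF hom])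
  from has_derivative_unique[OF this has_derivative_ident]
  have "frechet_derivative \<phi> (at (\<psi> y)) (frechet_derivative \<psi> (at y) v) = v" for v
    by (rule fun_cong)
  then show ?thesis by (rule inj_on_inverseI)
qed

text \<open>A boundary chart takes its covector from the model subspace, so a half-space of the
  source has to be described inside \<open>range A\<close>. Projecting \<open>adjoint B e\<close>
  orthogonally onto the range changes no inner product with vectors of the range.\<close>

lemma linear_functional_on_range:
  fixes A :: "'a::euclidean_space \<Rightarrow> 'b::euclidean_space"
  assumes "linear A" "linear B" "\<And>x. B (A x) = x"
  obtains e' where "e' \<in> range A" "\<And>x. e' \<bullet> A x = e \<bullet> x"
proof -
  have S: "subspace (range A)"
    using assms(1) linear_subspace_image subspace_UNIV by blast
  obtain y z where yz: "y \<in> span (range A)" "\<And>w. w \<in> span (range A) \<Longrightarrow> orthogonal z w" "adjoint B e = y + z"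
    using orthogonal_subspace_decomp_exists[of "range A" "adjoint B e"] by metis
  have "y \<bullet> A x = e \<bullet> x" for x
  proof -
    have "adjoint B e \<bullet> A x = e \<bullet> x"
      using adjoint_works[OF assms(2), of "A x" e] assms(3) by (simp add: inner_commute)
    moreover have "z \<bullet> A x = 0"
      using yz(2)[of "A x"] by (simp add: orthogonal_def span_base)
    ultimately show ?thesis using yz(3) by (simp add: inner_add_left)
  qed
  moreover have "span (range A) = range A"
    using S by (simp only: span_eq_iff)
  ultimately show ?thesis
    using that[of y] yz(1) by metis
qed

text \<open>Composed with the inverse of the local model of the ball, \<open>G\<close> extends to an
  immersion of an open set. The inverse of its straightening is a chart of the image, with a
  half-space of \<open>range A\<close> or all of \<open>range A\<close> as model.\<close>

lemma C1_submanifold_image_cball: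
  fixes G :: "'a::euclidean_space \<Rightarrow> real^'m"
  assumes G: "smooth_on_cball G" and inj: "inj_on G \<B>"
    and injD: "\<And>x. x \<in> \<B> \<Longrightarrow> inj (D_cball G x)"
  shows "C1_submanifold DIM('a) (G ` \<B>)"
  unfolding C1_submanifold_def
proof
  fix p assume "p \<in> G ` \<B>"
  then obtain q where q: "q \<in> \<B>" and p: "p = G q" by blast
  obtain U1 V1 and \<phi> \<psi> :: "'a \<Rightarrow> 'a" and e where m: "open U1" "open V1" "q \<in> U1" "homeomorphism U1 V1 \<phi> \<psi>"
    "Ck_on_open \<infinity> U1 \<phi>" "Ck_on_open \<infinity> V1 \<psi>" "\<phi> ` (\<B> \<inter> U1) = {w. 0 \<le> e \<bullet> w} \<inter> V1" "e \<bullet> \<phi> q = 0"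
    by (rule cball_local_model[OF q])
  obtain U0 G0 where G0: "open U0" "q \<in> U0" "Ck_on_open \<infinity> U0 G0" "\<And>x. x \<in> U0 \<inter> \<B> \<Longrightarrow> G0 x = G x"
    by (rule Ck_map_onE[OF G q]) blast
  define O1 where "O1 = V1 \<inter> \<psi> -` U0"
  have O1: "open O1"
    unfolding O1_def using continuous_open_preimage[OF Ck_on_open_continuous[OF m(6)] m(2) G0(1)] .
  have \<phi>q: "\<phi> q \<in> V1" "\<psi> (\<phi> q) = q" "\<phi> q \<in> O1"
    using homeomorphism_image1[OF m(4)] homeomorphism_apply1[OF m(4) m(3)] m(3) G0(2) by (auto simp: O1_def)
  define F where "F w = G0 (\<psi> w)" for w
  have F: "Ck_on_open \<infinity> O1 F"
    unfolding F_def
    by (rule Ck_on_open_compose[OF O1 G0(1) _ Ck_on_open_mono[OF m(6)] G0(3)]) (auto simp: O1_def)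
  have "D_cball G q = frechet_derivative G0 (at q)"
    using q G0 by (intro Ck_map_on_convex_derivative(3)[OF _ _ G]) auto
  then have "inj (frechet_derivative G0 (at q))"
    using injD[OF q] by simp
  moreover have "inj (frechet_derivative \<psi> (at (\<phi> q)))"
    by (rule inj_frechet_derivative_homeomorphism[OF m(2,4) Ck_on_open_le[OF m(5)] Ck_on_open_le[OF m(6)] \<phi>q(1)]) simp_all
  moreover have "frechet_derivative F (at (\<phi> q)) = (\<lambda>v. frechet_derivative G0 (at q) (frechet_derivative \<psi> (at (\<phi> q)) v))"
    unfolding F_def using Ck_on_open_derivative(1)[OF G0(3,2)]
    by (intro frechet_derivative_compose_at Ck_on_open_derivative(1)[OF m(6) \<phi>q(1)]) (simp add: \<phi>q)
  ultimately have "inj (frechet_derivative F (at (\<phi> q)))"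
    by (simp add: inj_on_def)
  then obtain A B Z V and \<Phi> \<Psi> :: "real^'m \<Rightarrow> real^'m" where s: "linear A" "linear B" "\<And>x. B (A x) = x" "open Z" "open V" "A (\<phi> q) \<in> Z"
    "homeomorphism Z V \<Phi> \<Psi>" "Ck_on_open \<infinity> Z \<Phi>" "Ck_on_open \<infinity> V \<Psi>"
    "\<And>x. A x \<in> Z \<Longrightarrow> x \<in> O1 \<and> \<Phi> (A x) = F x"
    by (rule straightening[OF O1 \<phi>q(3) F]) (rule that)
  define N where "N = U1 \<inter> \<phi> -` (A -` Z)"
  have AZ: "open (A -` Z)"
    using s(1,4) by (intro open_vimage linear_continuous_on) (auto simp: linear_conv_bounded_linear)
  have N: "open N"
    unfolding N_def using continuous_open_preimage[OF Ck_on_open_continuous[OF m(5)] m(1) AZ] .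
  have GN: "\<phi> x \<in> O1 \<and> G x = \<Phi> (A (\<phi> x)) \<and> A (\<phi> x) \<in> Z" if "x \<in> \<B>" "x \<in> N" for x
  proof -
    have "A (\<phi> x) \<in> Z" "x \<in> U1" using that by (auto simp: N_def)
    moreover have "\<psi> (\<phi> x) = x" using homeomorphism_apply1[OF m(4)] \<open>x \<in> U1\<close> by blast
    ultimately show ?thesis
      using s(10)[of "\<phi> x"] that(1) G0(4)[of x] by (auto simp: O1_def F_def)
  qed
  \<comment> \<open>Points of the ball outside \<open>N\<close> might be mapped close to
    \<open>p\<close>. Their image is compact and misses \<open>p\<close> by injectivity; once it is
    removed, only the part of the ball in \<open>N\<close> contributes near
    \<open>p\<close>.\<close>
  define U where "U = V - G ` (\<B> - N)"
  have "compact (G ` (\<B> - N))"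
    using N by (intro compact_continuous_image compact_diff continuous_on_subset[OF Ck_map_on_continuous[OF G]]) auto
  then have U: "open U" using s(5) by (simp add: U_def open_Diff compact_imp_closed)
  have qN: "q \<in> N" using m(3) s(6) by (simp add: N_def)
  have pV: "p \<in> V"
    using GN[OF q qN] homeomorphism_image1[OF s(7)] p by blast
  have pU: "p \<in> U"
    using pV qN inj_onD[OF inj _ q] by (auto simp: U_def p)
  have hU: "homeomorphism (\<Psi> ` U) U \<Phi> \<Psi>"
  proof (rule homeomorphism_of_subsets[OF s(7)])
    show "\<Psi> ` U \<subseteq> Z" using homeomorphism_image2[OF s(7)] by (auto simp: U_def)
    show "U \<subseteq> V" by (auto simp: U_def)
    show "\<Phi> ` \<Psi> ` U = U"
      using homeomorphism_apply2[OF s(7)] by (force simp: U_def image_image)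
  qed
  have \<Psi>U: "open (\<Psi> ` U)" "\<Psi> ` U \<subseteq> Z"
  proof -
    show "\<Psi> ` U \<subseteq> Z" using homeomorphism_image2[OF s(7)] by (auto simp: U_def)
    have "\<Psi> ` U = Z \<inter> \<Phi> -` U"
    proof (intro equalityI subsetI)
      fix z assume "z \<in> Z \<inter> \<Phi> -` U"
      then show "z \<in> \<Psi> ` U" using homeomorphism_apply1[OF s(7), of z] by (metis IntD1 IntD2 imageI vimageD)
    next
      fix z assume "z \<in> \<Psi> ` U"
      then show "z \<in> Z \<inter> \<Phi> -` U"
        using homeomorphism_image1[OF hU] \<open>\<Psi> ` U \<subseteq> Z\<close> by blast
    qed
    then show "open (\<Psi> ` U)"
      using continuous_open_preimage[OF Ck_on_open_continuous[OF s(8)] s(4) U] by simp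
  qed
  obtain e' where e': "e' \<in> range A" "\<And>x. e' \<bullet> A x = e \<bullet> x"
    by (rule linear_functional_on_range[OF s(1,2,3), of e]) (rule that)
  have img: "\<Psi> ` (G ` \<B> \<inter> U) = {x \<in> range A. 0 \<le> e' \<bullet> x} \<inter> \<Psi> ` U"
  proof (intro equalityI subsetI)
    fix z assume "z \<in> \<Psi> ` (G ` \<B> \<inter> U)"
    then obtain x where x: "x \<in> \<B>" "G x \<in> U" "z = \<Psi> (G x)" by blast
    then have xN: "x \<in> N" by (auto simp: U_def)
    have "z = A (\<phi> x)"
      using GN[OF x(1) xN] x(3) homeomorphism_apply1[OF s(7)] by simp
    moreover have "\<phi> x \<in> {w. 0 \<le> e \<bullet> w} \<inter> V1"
      using m(7) x(1) xN by (auto simp: N_def)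
    moreover have "z \<in> \<Psi> ` U" using x(2,3) by blast
    ultimately show "z \<in> {x \<in> range A. 0 \<le> e' \<bullet> x} \<inter> \<Psi> ` U"
      using e'(2) by auto
  next
    fix z assume z: "z \<in> {x \<in> range A. 0 \<le> e' \<bullet> x} \<inter> \<Psi> ` U"
    then obtain w where "z = A w" by blast
    then have w: "z = A w" "0 \<le> e \<bullet> w" using e'(2)[of w] z by simp_all
    have "A w \<in> Z" using z \<Psi>U(2) w by auto
    then have wO: "w \<in> O1" "\<Phi> z = F w" using s(10) w by auto
    then have "w \<in> \<phi> ` (\<B> \<inter> U1)" using m(7) w by (auto simp: O1_def)
    then obtain x where x: "x \<in> \<B>" "x \<in> U1" "w = \<phi> x" by blast
    have "\<psi> w = x" using homeomorphism_apply1[OF m(4)] x by simp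
    then have "\<Phi> z = G x" using wO G0(4)[of x] x(1) by (auto simp: F_def O1_def)
    moreover have "\<Phi> z \<in> U" using z homeomorphism_image1[OF hU] by blast
    moreover have "z = \<Psi> (\<Phi> z)" using z homeomorphism_apply1[OF hU] by simp
    ultimately show "z \<in> \<Psi> ` (G ` \<B> \<inter> U)" using x(1) by (metis IntI imageI)
  qed
  have fl: "flattens (G ` \<B>) {x \<in> range A. 0 \<le> e' \<bullet> x} p \<Psi>"
    unfolding flattens_def
  proof (intro exI conjI)
    show "homeomorphism U (\<Psi> ` U) \<Psi> \<Phi>" using hU by (rule homeomorphism_symD)
    show "Ck_on_open 1 U \<Psi>"
      by (rule Ck_on_open_mono[OF Ck_on_open_le[OF s(9)]]) (auto simp: U_def)
    show "Ck_on_open 1 (\<Psi> ` U) \<Phi>"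
      by (rule Ck_on_open_mono[OF Ck_on_open_le[OF s(8)] \<Psi>U(2)]) simp
  qed (use U \<Psi>U pU img in auto)
  have S: "subspace (range A)" "dim (range A) = DIM('a)"
  proof -
    show "subspace (range A)" using s(1) linear_subspace_image subspace_UNIV by blast
    have "inj A" by (rule inj_on_inverseI[where g=B, OF s(3)])
    then show "dim (range A) = DIM('a)"
      using dim_image_eq[OF s(1), of UNIV] by (simp add: dim_UNIV)
  qed
  have p': "p \<in> G ` \<B>" using p q by simp
  have "\<Psi> p = A (\<phi> q)"
    using GN[OF q qN] p homeomorphism_apply1[OF s(7)] by simp
  then have e'p: "e' \<bullet> \<Psi> p = 0" using e'(2) m(8) by simp
  \<comment> \<open>A zero covector is the interior case: the half-space is then the whole
    subspace.\<close>
  have "interior_chart (G ` \<B>) p (range A) \<Psi> \<or> boundary_chart (G ` \<B>) p (range A) \<Psi>"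
  proof (cases "e' = 0")
    case True
    then have "{x \<in> range A. 0 \<le> e' \<bullet> x} = range A" by auto
    then show ?thesis using fl p' S(1) by (simp add: interior_chart_def)
  next
    case False
    then show ?thesis
      unfolding boundary_chart_def using fl p' S(1) e'(1) e'p by blast
  qed
  then show "\<exists>S \<phi>. dim S = DIM('a) \<and> (interior_chart (G ` \<B>) p S \<phi> \<or> boundary_chart (G ` \<B>) p S \<phi>)"
    using S(2) by blast
qed

section \<open>Standard disks and invariance of dimension\<close>

lemma standard_disk_eq:
  "standard_disk j = top_of_set {y. (\<forall>i\<ge>j. y i = 0) \<and> (\<Sum>i<j. (y i)\<^sup>2) \<le> 1}"
  unfolding standard_disk_def Euclidean_space_def euclidean_product_topology subtopology_subtopology
  by (simp add: Int_def)

text \<open>The standard disk consists of sequences; \<open>E\<close> reads off the first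
  \<open>CARD('n)\<close> entries and so leads to a space where invariance of domain applies. The
  coordinate \<open>k\<close> belongs to the last of these entries, so disks of smaller dimension
  land in the hyperplane where it vanishes.\<close>

lemma standard_disk_coordinates:
  obtains E :: "(nat \<Rightarrow> real) \<Rightarrow> real^'n" and k where
    "continuous_on UNIV E" "inj_on E {y. \<forall>i\<ge>CARD('n). y i = 0}"
    "\<And>y. (\<forall>i\<ge>CARD('n) - 1. y i = 0) \<Longrightarrow> E y $ k = 0"
    "standard_disk CARD('n) homeomorphic_space top_of_set (cball (0 :: real^'n) 1)"
proof -
  obtain h :: "nat \<Rightarrow> 'n" where h: "bij_betw h {..<CARD('n)} UNIV"
    using ex_bij_betw_nat_finite[of "UNIV :: 'n set"] by (auto simp: atLeast0LessThan)
  define h' where "h' = inv_into {..<CARD('n)} h"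
  have hh': "h (h' k) = k" "h' k < CARD('n)" for k
    using bij_betw_inv_into_right[OF h, of k] bij_betw_apply[OF bij_betw_inv_into[OF h], of k] by (simp_all add: h'_def)
  have h'h: "h' (h i) = i" if "i < CARD('n)" for i
    using bij_betw_inv_into_left[OF h, of i] that by (simp add: h'_def)
  define E :: "(nat \<Rightarrow> real) \<Rightarrow> real^'n" where "E y = (\<chi> k. y (h' k))" for y
  define E' :: "real^'n \<Rightarrow> nat \<Rightarrow> real" where "E' x i = (if i < CARD('n) then x $ h i else 0)" for x i
  have E: "continuous_on UNIV E"
    unfolding E_def by (intro continuous_on_vec_lambda continuous_on_product_coordinates)
  have E': "continuous_on UNIV E'"
  proof (rule continuous_on_coordinatewise_then_product)
    show "continuous_on UNIV (\<lambda>x. E' x i)" for i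
      by (cases "i < CARD('n)") (auto simp: E'_def intro: continuous_intros)
  qed
  have E'E: "E' (E y) = y" if "\<forall>i\<ge>CARD('n). y i = 0" for y
    using that h'h by (auto simp: fun_eq_iff E_def E'_def)
  have EE': "E (E' x) = x" for x
    by (simp add: vec_eq_iff E_def E'_def hh')
  have norm: "(\<Sum>i<CARD('n). (y i)\<^sup>2) = (norm (E y))\<^sup>2" for y
  proof -
    have "(norm (E y))\<^sup>2 = (\<Sum>k\<in>UNIV. (y (h' k))\<^sup>2)"
      by (simp add: norm_vec_def L2_set_def E_def sum_nonneg)
    also have "\<dots> = (\<Sum>i<CARD('n). (y i)\<^sup>2)"
      using sum.reindex_bij_betw[OF h, of "\<lambda>k. (y (h' k))\<^sup>2"] by (simp add: h'h)
    finally show ?thesis by simp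
  qed
  have "homeomorphic_maps (standard_disk CARD('n)) (top_of_set \<B>) E E'"
    unfolding standard_disk_eq homeomorphic_maps_def
  proof (intro conjI ballI)
    show "continuous_map (top_of_set {y. (\<forall>i\<ge>CARD('n). y i = 0) \<and> (\<Sum>i<CARD('n). (y i)\<^sup>2) \<le> 1})
        (top_of_set \<B>) E"
      using continuous_on_subset[OF E] by (auto simp: norm abs_square_le_1)
    show "continuous_map (top_of_set \<B>)
        (top_of_set {y. (\<forall>i\<ge>CARD('n). y i = 0) \<and> (\<Sum>i<CARD('n). (y i)\<^sup>2) \<le> 1}) E'"
      using continuous_on_subset[OF E'] by (auto simp: norm EE' abs_square_le_1) (simp add: E'_def)
  qed (use E'E EE' in auto)
  then have "standard_disk CARD('n) homeomorphic_space top_of_set (cball (0 :: real^'n) 1)"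
    unfolding homeomorphic_space_def by blast
  moreover have "inj_on E {y. \<forall>i\<ge>CARD('n). y i = 0}"
    by (rule inj_on_inverseI[where g=E']) (simp add: E'E)
  moreover have "E y $ h (CARD('n) - 1) = 0" if "\<forall>i\<ge>CARD('n) - 1. y i = 0" for y
    using that by (simp add: E_def h'h)
  ultimately show ?thesis using that E by blast
qed

text \<open>Composed with \<open>E\<close>, a homeomorphism onto a smaller disk would map the open
  ball injectively into a hyperplane. By invariance of domain the image would be open, but a
  hyperplane has empty interior.\<close>

lemma cball_not_homeomorphic_standard_disk:
  assumes "j < CARD('n)"
  shows "\<not> top_of_set (cball (0 :: real^'n) 1) homeomorphic_space standard_disk j"
proof
  assume "top_of_set (cball (0 :: real^'n) 1) homeomorphic_space standard_disk j"
  then obtain f g where fg: "homeomorphic_maps (top_of_set (cball (0 :: real^'n) 1)) (standard_disk j) f g"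
    unfolding homeomorphic_space_def by blast
  obtain E :: "(nat \<Rightarrow> real) \<Rightarrow> real^'n" and k where E: "continuous_on UNIV E"
      "inj_on E {y. \<forall>i\<ge>CARD('n). y i = 0}" "\<And>y. (\<forall>i\<ge>CARD('n) - 1. y i = 0) \<Longrightarrow> E y $ k = 0"
    by (rule standard_disk_coordinates) (rule that)
  have f: "continuous_on \<B> f" "\<And>x i. x \<in> \<B> \<Longrightarrow> i \<ge> j \<Longrightarrow> f x i = 0" and "inj_on f \<B>"
    using fg unfolding homeomorphic_maps_def standard_disk_eq by (auto intro!: inj_on_inverseI[where g=g])
  have inj: "inj_on (\<lambda>x. E (f x)) (ball 0 1)"
  proof (rule inj_onI)
    fix x y assume xy: "x \<in> ball (0 :: real^'n) 1" "y \<in> ball 0 1" "E (f x) = E (f y)"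
    then have "f x = f y"
      using f(2) assms by (intro inj_onD[where f=E, OF E(2)] xy(3)) auto
    then show "x = y"
      using inj_onD[OF \<open>inj_on f \<B>\<close>] xy by auto
  qed
  have "continuous_on (ball 0 1) (\<lambda>x. E (f x))"
    by (rule continuous_on_compose2[OF E(1) continuous_on_subset[OF f(1)]]) auto
  then have "open ((\<lambda>x. E (f x)) ` ball 0 1)"
    using invariance_of_domain inj by blast
  moreover have "(\<lambda>x. E (f x)) ` ball 0 1 \<subseteq> {v. axis k 1 \<bullet> v = 0}"
    using f(2) assms E(3) by (auto simp: inner_axis')
  ultimately have "(\<lambda>x. E (f x)) ` ball 0 1 \<subseteq> interior {v. axis k 1 \<bullet> v = 0}"
    by (intro interior_maximal)
  moreover have "interior {v :: real^'n. axis k 1 \<bullet> v = 0} = {}"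
    by (intro interior_hyperplane) (simp add: axis_eq_0_iff)
  ultimately show False by simp
qed

text \<open>The difference of the two sets asks for a disk that is not at the same time homeomorphic
  to one of smaller dimension; this is where invariance of dimension enters.\<close>

lemma image_cball_in_disk_submanifolds:
  fixes G :: "real^'n \<Rightarrow> real^'m"
  assumes G: "smooth_on_cball G" and inj: "inj_on G \<B>"
    and injD: "\<And>x. x \<in> \<B> \<Longrightarrow> inj (D_cball G x)"
  shows "G ` \<B> \<in> disk_submanifolds (int CARD('n)) - disk_submanifolds (int CARD('n) - 1)"
proof -
  have cont: "continuous_on \<B> G" by (rule Ck_map_on_continuous[OF G])
  have "G ` \<B> \<in> submanifolds"
    unfolding submanifolds_def using C1_submanifold_image_cball[OF G inj injD] cont
    by (auto intro!: compact_continuous_image connected_continuous_image)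
  moreover have hom: "top_of_set (cball (0 :: real^'n) 1) homeomorphic_space top_of_set (G ` \<B>)"
  proof -
    obtain g where "homeomorphism \<B> (G ` \<B>) G g"
      using homeomorphism_compact[OF compact_cball cont refl inj] by blast
    then have "homeomorphic_maps (top_of_set \<B>) (top_of_set (G ` \<B>)) G g"
      unfolding homeomorphism_def homeomorphic_maps_def by auto
    then show ?thesis
      unfolding homeomorphic_space_def by blast
  qed
  moreover have "top_of_set (G ` \<B>) homeomorphic_space standard_disk CARD('n)"
  proof -
    have "standard_disk CARD('n) homeomorphic_space top_of_set (cball (0 :: real^'n) 1)"
      by (rule standard_disk_coordinates)
    then show ?thesis
      using hom homeomorphic_space_sym homeomorphic_space_trans by metis
  qed
  ultimately have "G ` \<B> \<in> disk_submanifolds (int CARD('n))"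
    unfolding disk_submanifolds_def by blast
  moreover have "G ` \<B> \<notin> disk_submanifolds (int CARD('n) - 1)"
  proof
    assume "G ` \<B> \<in> disk_submanifolds (int CARD('n) - 1)"
    then obtain j where "j < CARD('n)" "top_of_set (G ` \<B>) homeomorphic_space standard_disk j"
      unfolding disk_submanifolds_def by auto
    then show False
      using cball_not_homeomorphic_standard_disk homeomorphic_space_trans[OF hom] by blast
  qed
  ultimately show ?thesis by blast
qed

section \<open>Division by a defining function of the ball\<close>

text \<open>For a unit vector \<open>e\<close> this multiplies the component along \<open>e\<close>
  by \<open>t\<close>. It joins the orthogonal projection onto the hyperplane, at
  \<open>t = 0\<close>, to the identity, at \<open>t = 1\<close>.\<close>

definition squeeze :: "'a::euclidean_space \<Rightarrow> real \<Rightarrow> 'a \<Rightarrow> 'a" where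
  "squeeze e t w = w - ((1 - t) * (e \<bullet> w)) *\<^sub>R e"

lemma linear_squeeze: "linear (squeeze e t)"
  by (rule linearI) (simp_all add: squeeze_def inner_add algebra_simps)

lemma squeeze_in_ball:
  assumes "norm e = 1" "w \<in> ball 0 r" "t \<in> {0..1}"
  shows "squeeze e t w \<in> ball 0 r"
proof -
  have ee: "e \<bullet> e = 1" using assms(1) by (simp add: dot_square_norm)
  have "squeeze e t w \<bullet> squeeze e t w = w \<bullet> w - (1 - t) * (1 + t) * (e \<bullet> w)\<^sup>2"
    using ee by (simp add: squeeze_def inner_diff inner_commute power2_eq_square algebra_simps)
  also have "\<dots> \<le> w \<bullet> w"
    using assms(3) by simp
  finally have "norm (squeeze e t w) \<le> norm w"
    by (simp add: norm_le)
  then show ?thesis using assms(2) by simp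
qed

lemma continuous_on_squeeze:
  "continuous_on S (\<lambda>p. squeeze e (snd p) (fst p))"
  unfolding squeeze_def by (intro continuous_intros)

lemma continuous_on_slice:
  assumes "continuous_on (S \<times> cbox 0 (1::real)) (\<lambda>(w, t). g w t)" "w \<in> S"
  shows "continuous_on {0..1} (g w)"
proof -
  have "continuous_on {0..1} (\<lambda>t. (w, t))"
    by (intro continuous_intros)
  then show ?thesis
    using continuous_on_compose2[OF assms(1), of "{0..1}" "\<lambda>t. (w, t)"] assms(2) by auto
qed

text \<open>Differentiation under the integral sign. The weight \<open>a\<close> is arbitrary
  because the dependence of \<open>squeeze\<close> on \<open>w\<close> contributes a factor 1 - t to
  each derivative; the induction passes from \<open>a t\<close> to
  \<open>a t * (1 - t)\<close>.\<close>

lemma Cn_on_open_integral_squeeze: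
  fixes G :: "'a::euclidean_space \<Rightarrow> real"
  assumes e: "norm e = 1" and a: "continuous_on {0..1} a" and G: "Cn_on_open n (ball 0 r) G"
  shows "Cn_on_open n (ball 0 r) (\<lambda>w. integral {0..1} (\<lambda>t. a t * G (squeeze e t w)))"
  using a G
proof (induction n arbitrary: a G)
  have cont: "continuous_on (ball 0 r \<times> cbox 0 1) (\<lambda>(w, t). a t * G (squeeze e t w))"
    if "continuous_on {0..1} a" "continuous_on (ball 0 r) G" for a :: "real \<Rightarrow> real" and G :: "'a \<Rightarrow> real"
    unfolding case_prod_beta using that squeeze_in_ball[OF e]
    by (intro continuous_intros continuous_on_compose2[OF that(1)] continuous_on_compose2[OF that(2) continuous_on_squeeze])
      auto
  {
    case 0
    then show ?case
      using integral_continuous_on_param[OF cont[of a G]] by simp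
  next
    case (Suc n)
    let ?D = "\<lambda>x. frechet_derivative G (at x)"
    have GD: "(G has_derivative ?D x) (at x)" if "x \<in> ball 0 r" for x
      by (rule Cn_on_open_SucD(1)[OF Suc.prems(2) that])
    have Gv: "Cn_on_open n (ball 0 r) (\<lambda>x. ?D x v)" for v
      by (rule Cn_on_open_SucD(2)[OF Suc.prems(2)])
    define f' where "f' w t v = a t * ?D (squeeze e t w) (squeeze e t v)" for w t v
    have der: "((\<lambda>w. a t * G (squeeze e t w)) has_derivative f' w t) (at w)" if "w \<in> ball 0 r" "t \<in> {0..1}" for w t
    proof -
      have "(squeeze e t has_derivative squeeze e t) (at w)"
        using linear_squeeze linear_conv_bounded_linear bounded_linear_imp_has_derivative by blast
      from diff_chain_at[OF this GD[OF squeeze_in_ball[OF e that]]]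
      show ?thesis
        unfolding f'_def o_def by (rule has_derivative_mult_right)
    qed
    \<comment> \<open>The direction \<open>squeeze e t v\<close> moves with \<open>t\<close>.
      Splitting it into the fixed directions \<open>v\<close> and \<open>e\<close> leaves two
      integrals of the form that the induction hypothesis covers.\<close>
    have split: "f' w t v = a t * ?D (squeeze e t w) v - (e \<bullet> v) * ((a t * (1 - t)) * ?D (squeeze e t w) e)"
      if "w \<in> ball 0 r" "t \<in> {0..1}" for w t v
    proof -
      have "linear (?D (squeeze e t w))"
        using GD[OF squeeze_in_ball[OF e that]] has_derivative_linear by blast
      then have "?D (squeeze e t w) (squeeze e t v) = ?D (squeeze e t w) v - ((1 - t) * (e \<bullet> v)) * ?D (squeeze e t w) e"
        by (simp add: squeeze_def linear_diff linear_scale)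
      then show ?thesis unfolding f'_def by (simp only:) (simp add: algebra_simps)
    qed
    have a1: "continuous_on {0..1} (\<lambda>t. a t * (1 - t))"
      using Suc.prems(1) by (intro continuous_intros)
    have c1: "continuous_on (ball 0 r \<times> cbox 0 1) (\<lambda>(w, t). a t * ?D (squeeze e t w) v)" for v
      by (rule cont[OF Suc.prems(1) Cn_on_open_continuous[OF Gv]])
    have c2: "continuous_on (ball 0 r \<times> cbox 0 1) (\<lambda>(w, t). (a t * (1 - t)) * ?D (squeeze e t w) e)"
      by (rule cont[OF a1 Cn_on_open_continuous[OF Gv]])
    have cf': "continuous_on (ball 0 r \<times> cbox 0 1) (\<lambda>(w, t). f' w t v)" for v
    proof -
      have "continuous_on (ball 0 r \<times> cbox 0 1)
          (\<lambda>p. (\<lambda>(w, t). a t * ?D (squeeze e t w) v) p - (e \<bullet> v) * (\<lambda>(w, t). (a t * (1 - t)) * ?D (squeeze e t w) e) p)"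
        by (intro continuous_on_diff continuous_on_mult continuous_on_const c1 c2)
      then show ?thesis
        by (rule iffD1[OF continuous_on_cong[OF refl], rotated]) (auto simp: split)
    qed
    \<comment> \<open>The Leibniz rule takes the derivative as a bounded linear function; its
      continuity is checked on vectors.\<close>
    define fx where "fx w t = Blinfun (f' w t)" for w t
    have fx: "blinfun_apply (fx w t) = f' w t" if "w \<in> ball 0 r" "t \<in> {0..1}" for w t
      unfolding fx_def using der[OF that] by (intro bounded_linear_Blinfun_apply has_derivative_bounded_linear)
    have cfx: "continuous_on (ball 0 r \<times> cbox 0 1) (\<lambda>(w, t). fx w t)"
    proof (rule continuous_on_blinfun_componentwise)
      fix i :: 'a
      show "continuous_on (ball 0 r \<times> cbox 0 1) (\<lambda>p. blinfun_apply (case p of (w, t) \<Rightarrow> fx w t) i)"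
        using cf'[of i] by (rule iffD1[OF continuous_on_cong[OF refl], rotated]) (auto simp: fx)
    qed
    define R where "R w v = integral {0..1} (\<lambda>t. a t * ?D (squeeze e t w) v)
        + (- (e \<bullet> v)) * integral {0..1} (\<lambda>t. (a t * (1 - t)) * ?D (squeeze e t w) e)" for w v
    have leib: "((\<lambda>w. integral (cbox 0 1) (\<lambda>t. a t * G (squeeze e t w))) has_derivative integral (cbox 0 1) (fx w)) (at w within ball 0 r)"
      if "w \<in> ball 0 r" for w
    proof (rule leibniz_rule[OF _ _ cfx that convex_ball])
      show "((\<lambda>w. a t * G (squeeze e t w)) has_derivative blinfun_apply (fx x t)) (at x within ball 0 r)"
        if "x \<in> ball 0 r" "t \<in> cbox 0 1" for x t
        using der that by (simp add: fx has_derivative_at_withinI)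
      show "(\<lambda>t. a t * G (squeeze e t x)) integrable_on cbox 0 1" if "x \<in> ball 0 r" for x
        using continuous_on_slice[OF cont[OF Suc.prems(1) Cn_on_open_continuous[OF Suc.prems(2)]] that]
        by (simp add: integrable_continuous_interval)
    qed
    have R: "blinfun_apply (integral (cbox 0 1) (fx w)) v = R w v"
      if "w \<in> ball 0 r" for w v
    proof -
      have "blinfun_apply (integral (cbox 0 1) (fx w)) v = integral {0..1} (\<lambda>t. blinfun_apply (fx w t) v)"
        using continuous_on_slice[OF cfx that] by (simp add: blinfun_apply_integral integrable_continuous_interval)
      also have "\<dots> = integral {0..1} (\<lambda>t. a t * ?D (squeeze e t w) v - (e \<bullet> v) * ((a t * (1 - t)) * ?D (squeeze e t w) e))"
        using that by (intro integral_cong) (simp add: fx split)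
      also have "\<dots> = integral {0..1} (\<lambda>t. a t * ?D (squeeze e t w) v)
          - integral {0..1} (\<lambda>t. (e \<bullet> v) * ((a t * (1 - t)) * ?D (squeeze e t w) e))"
        by (intro integral_diff integrable_continuous_interval continuous_on_slice[OF c1 that]
            continuous_on_mult[OF continuous_on_const continuous_on_slice[OF c2 that]])
      finally show ?thesis by (simp add: R_def)
    qed
    have "((\<lambda>w. integral {0..1} (\<lambda>t. a t * G (squeeze e t w))) has_derivative R w) (at w)" if "w \<in> ball 0 r" for w
    proof -
      have "blinfun_apply (integral (cbox 0 1) (fx w)) = R w"
        using R[OF that] by (rule ext)
      then show ?thesis
        using leib[OF that] that by (simp add: at_within_open[OF _ open_ball])
    qed
    moreover have "Cn_on_open n (ball 0 r) (\<lambda>w. R w v)" for v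
      unfolding R_def
      by (intro Cn_on_open_add Cn_on_open_mult Cn_on_open_const Suc.IH open_ball Suc.prems(1) a1 Gv)
    ultimately show ?case
      by (intro Cn_on_open_SucI open_ball)
  }
qed

text \<open>Hadamard's lemma: \<open>G\<close> vanishes at the projection of \<open>w\<close> to the
  hyperplane, so \<open>G w\<close> is the integral over \<open>t\<close> of the derivative of
  \<open>G (squeeze e t w)\<close>, from which the factor \<open>e \<bullet> w\<close> can be taken
  out.\<close>

lemma smooth_division_hyperplane:
  fixes G :: "'a::euclidean_space \<Rightarrow> real"
  assumes e: "norm e = 1" and G: "Ck_on_open \<infinity> (ball 0 r) G"
    and zero: "\<And>w. w \<in> ball 0 r \<Longrightarrow> e \<bullet> w = 0 \<Longrightarrow> G w = 0"
  obtains K where "Ck_on_open \<infinity> (ball 0 r) K" "\<And>w. w \<in> ball 0 r \<Longrightarrow> G w = (e \<bullet> w) * K w"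
proof -
  define D where "D x = frechet_derivative G (at x) e" for x
  \<comment> \<open>The weight 1 is kept to match the form of the lemma on integrals.\<close>
  define K where "K w = integral {0..1} (\<lambda>t. 1 * D (squeeze e t w))" for w
  have "Ck_on_open \<infinity> (ball 0 r) D"
    unfolding D_def by (rule Ck_on_open_derivative(2)[OF G])
  then have "Ck_on_open \<infinity> (ball 0 r) K"
    unfolding Ck_on_open_infinity K_def using Cn_on_open_integral_squeeze[OF e continuous_on_const] by blast
  moreover have "G w = (e \<bullet> w) * K w" if w: "w \<in> ball 0 r" for w
  proof -
    have der: "((\<lambda>t. G (squeeze e t w)) has_vector_derivative (e \<bullet> w) * D (squeeze e t w)) (at t within {0..1})" if "t \<in> {0..1}" for t
    proof -
      have "((\<lambda>t. squeeze e t w) has_derivative (\<lambda>h. h *\<^sub>R ((e \<bullet> w) *\<^sub>R e))) (at t within {0..1})"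
        unfolding squeeze_def by (auto intro!: derivative_eq_intros simp: algebra_simps)
      moreover have GD: "(G has_derivative frechet_derivative G (at (squeeze e t w))) (at (squeeze e t w))"
        by (rule Ck_on_open_derivative(1)[OF G squeeze_in_ball[OF e w that]])
      ultimately have "((\<lambda>t. G (squeeze e t w)) has_derivative
          (\<lambda>h. frechet_derivative G (at (squeeze e t w)) (h *\<^sub>R ((e \<bullet> w) *\<^sub>R e)))) (at t within {0..1})"
        by (rule has_derivative_in_compose[OF _ has_derivative_at_withinI])
      then show ?thesis
        using has_derivative_linear[OF GD] unfolding has_vector_derivative_def D_def
        by (simp add: linear_scale mult.assoc)
    qed
    have "((\<lambda>t. (e \<bullet> w) * D (squeeze e t w)) has_integral (G (squeeze e 1 w) - G (squeeze e 0 w))) {0..1}"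
      by (rule fundamental_theorem_of_calculus[OF zero_le_one der])
    moreover have "squeeze e 0 w \<in> ball 0 r" "e \<bullet> squeeze e 0 w = 0"
      using squeeze_in_ball[OF e w, of 0] e by (simp_all add: squeeze_def inner_diff dot_square_norm)
    ultimately have "((\<lambda>t. (e \<bullet> w) * D (squeeze e t w)) has_integral G w) {0..1}"
      using zero by (simp add: squeeze_def[of e 1])
    then show ?thesis
      using integral_unique[of "\<lambda>t. (e \<bullet> w) * D (squeeze e t w)" "G w"] unfolding K_def by simp
  qed
  ultimately show ?thesis by (rule that)
qed

text \<open>Inside the ball 1 - |u|^2 is invertible. At a boundary point inversion turns the sphere
  into a hyperplane, where Hadamard's lemma applies to a local extension of \<open>E\<close>; the
  factor between the two defining functions is then put back.\<close>

lemma smooth_division_cball_local: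
  fixes E :: "'a::euclidean_space \<Rightarrow> real"
  assumes E: "smooth_on_cball E" and zero: "\<And>x. norm x = 1 \<Longrightarrow> E x = 0" and p: "p \<in> \<B>"
  obtains U K where "open U" "p \<in> U" "Ck_on_open \<infinity> U K"
    "\<And>u. u \<in> U \<inter> \<B> \<Longrightarrow> E u = (1 - (norm u)\<^sup>2) * K u"
proof -
  obtain U0 E0 where E0: "open U0" "p \<in> U0" "Ck_on_open \<infinity> U0 E0" "\<And>x. x \<in> U0 \<inter> \<B> \<Longrightarrow> E0 x = E x"
    by (rule Ck_map_onE[OF E p]) (rule that)
  show ?thesis
  proof (cases "norm p = 1")
    case False
    define U where "U = U0 \<inter> ball 0 1"
    have nz: "1 - u \<bullet> u \<noteq> 0" if "u \<in> U" for u
    proof -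
      have "(norm u)\<^sup>2 < 1" using that by (simp add: U_def abs_square_less_1)
      then show ?thesis by (simp add: dot_square_norm)
    qed
    have U: "open U" using E0(1) by (simp add: U_def open_Int)
    have "Ck_on_open \<infinity> U (\<lambda>u. E0 u * inverse (1 - u \<bullet> u))"
      by (intro Ck_on_open_bilinear[OF bounded_bilinear_mult] Ck_on_open_inverse Ck_on_open_diff Ck_on_open_const
          Ck_on_open_bilinear[OF bounded_bilinear_inner] Ck_on_open_id U nz Ck_on_open_mono[OF E0(3)]) (auto simp: U_def)
    moreover have "E u = (1 - (norm u)\<^sup>2) * (E0 u * inverse (1 - u \<bullet> u))" if "u \<in> U \<inter> \<B>" for u
      using that nz[of u] E0(4)[of u] by (simp add: U_def dot_square_norm)
    ultimately show ?thesis
      using that[OF U] False p E0(2) by (simp add: U_def)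
  next
    case True
    note hom = homeomorphism_ball_chart[of p]
    have "p \<noteq> 0" using True by auto
    have o: "open (- {- (1/2) *\<^sub>R p} \<inter> ball_param p -` U0)"
      using continuous_open_preimage[OF Ck_on_open_continuous[OF Ck_on_open_ball_param] _ E0(1)] by blast
    have pp: "p \<noteq> - p"
    proof
      assume "p = - p"
      then have "2 *\<^sub>R p = 0" by (simp add: scaleR_2 eq_neg_iff_add_eq_0)
      then show False using \<open>p \<noteq> 0\<close> by simp
    qed
    have "ball_param p 0 = p"
      using homeomorphism_apply1[OF hom, of p] ball_chart_self[OF True] pp by simp
    then have "0 \<in> - {- (1/2) *\<^sub>R p} \<inter> ball_param p -` U0"
      using E0(2) \<open>p \<noteq> 0\<close> by simp
    then obtain r where r: "r > 0" "ball 0 r \<subseteq> - {- (1/2) *\<^sub>R p} \<inter> ball_param p -` U0"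
      using o openE by blast
    define G where "G w = E0 (ball_param p w)" for w
    have G: "Ck_on_open \<infinity> (ball 0 r) G"
      unfolding G_def
      by (rule Ck_on_open_compose[OF open_ball E0(1) _ Ck_on_open_mono[OF Ck_on_open_ball_param] E0(3)]) (use r(2) in auto)
    have zero': "G w = 0" if "w \<in> ball 0 r" "p \<bullet> w = 0" for w
    proof -
      have "norm (ball_param p w) = 1"
        using that r(2) by (subst norm_ball_param_le_iff(2)[OF True]) auto
      then show ?thesis
        using that(1) r(2) E0(4)[of "ball_param p w"] zero by (auto simp: G_def)
    qed
    obtain K where K: "Ck_on_open \<infinity> (ball 0 r) K" "\<And>w. w \<in> ball 0 r \<Longrightarrow> G w = (p \<bullet> w) * K w"
      by (rule smooth_division_hyperplane[OF True G zero'], assumption, assumption) (rule that)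
    define U where "U = - {- p} \<inter> ball_chart p -` ball 0 r"
    have U: "open U"
      unfolding U_def by (rule continuous_open_preimage[OF Ck_on_open_continuous[OF Ck_on_open_ball_chart] open_delete_UNIV open_ball])
    define c where "c = ball_chart p"
    have c: "Ck_on_open \<infinity> U c"
      unfolding c_def by (rule Ck_on_open_mono[OF Ck_on_open_ball_chart]) (auto simp: U_def)
    define d where "d u = c u + (1/2) *\<^sub>R p" for u
    have d: "Ck_on_open \<infinity> U d"
      unfolding d_def by (intro Ck_on_open_add c U Ck_on_open_const)
    have Kc: "Ck_on_open \<infinity> U (\<lambda>u. K (c u))"
      by (rule Ck_on_open_compose[OF U open_ball _ c K(1)]) (auto simp: U_def c_def)
    \<comment> \<open>The factor \<open>1/2 * (d u \<bullet> d u)\<close> is the reciprocal of the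
      one by which 1 - |u|^2 differs from the linear function in
      \<open>ball_param_norm\<close>.\<close>
    have "Ck_on_open \<infinity> U (\<lambda>u. (1/2 * (d u \<bullet> d u)) * K (c u))"
      by (intro Ck_on_open_bilinear[OF bounded_bilinear_mult] Ck_on_open_bilinear[OF bounded_bilinear_inner]
          U d Kc Ck_on_open_const)
    moreover have "E u = (1 - (norm u)\<^sup>2) * ((1/2 * (d u \<bullet> d u)) * K (c u))" if u: "u \<in> U \<inter> \<B>" for u
    proof -
      have cu: "c u \<in> ball 0 r" "ball_param p (c u) = u"
        using u homeomorphism_apply1[OF hom, of u] by (auto simp: U_def c_def)
      then have ne: "c u \<noteq> - (1/2) *\<^sub>R p" and uU0: "u \<in> U0"
        using r(2) by auto
      have "d u \<noteq> 0" using ne by (simp add: d_def eq_neg_iff_add_eq_0)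
      then have "p \<bullet> c u = (1 - (norm u)\<^sup>2) * (1/2 * (d u \<bullet> d u))"
        using ball_param_norm[OF True ne] cu(2) by (simp add: d_def dot_square_norm)
      moreover have "E u = (p \<bullet> c u) * K (c u)"
        using K(2)[OF cu(1)] E0(4)[of u] u uU0 cu(2) by (simp add: G_def)
      ultimately show ?thesis by simp
    qed
    ultimately show ?thesis
      using that[OF U] pp r(1) ball_chart_self[OF True] by (simp add: U_def)
  qed
qed

text \<open>The local quotients have to agree also on the sphere, where the equation says nothing
  about them. There each of them is the limit of the honest quotient from the open ball, so
  \<open>q\<close> is defined as this limit.\<close>

lemma smooth_division_cball:
  fixes E :: "'a::euclidean_space \<Rightarrow> real"
  assumes E: "smooth_on_cball E" and zero: "\<And>x. norm x = 1 \<Longrightarrow> E x = 0"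
  obtains q where "smooth_on_cball q" "\<And>u. u \<in> \<B> \<Longrightarrow> E u = (1 - (norm u)\<^sup>2) * q u"
proof -
  define q where "q u = Lim (at u within ball 0 1) (\<lambda>w. E w / (1 - (norm w)\<^sup>2))" for u
  have qK: "q u = K u" if "open U" "Ck_on_open \<infinity> U K" "\<And>u. u \<in> U \<inter> \<B> \<Longrightarrow> E u = (1 - (norm u)\<^sup>2) * K u"
    "u \<in> U \<inter> \<B>" for U K u
  proof -
    have "isCont K u"
      using Ck_on_open_continuous[OF that(2)] that(1,4) by (simp add: continuous_on_eq_continuous_at)
    then have "(K \<longlongrightarrow> K u) (at u within ball 0 1)"
      unfolding isCont_def by (rule tendsto_within_subset) simp
    moreover have "\<forall>\<^sub>F w in at u within ball 0 1. K w = E w / (1 - (norm w)\<^sup>2)"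
    proof -
      have "\<forall>\<^sub>F w in at u within ball 0 1. w \<in> U \<and> w \<in> ball 0 1"
        unfolding eventually_at_topological using that(1,4) by (intro exI[of _ U]) auto
      then show ?thesis
      proof (rule eventually_mono)
        fix w assume w: "w \<in> U \<and> w \<in> ball 0 1"
        then have "(norm w)\<^sup>2 < 1" by (simp add: abs_square_less_1)
        then show "K w = E w / (1 - (norm w)\<^sup>2)" using that(3)[of w] w by simp
      qed
    qed
    ultimately have "((\<lambda>w. E w / (1 - (norm w)\<^sup>2)) \<longlongrightarrow> K u) (at u within ball 0 1)"
      by (rule Lim_transform_eventually)
    moreover have "at u within ball 0 1 \<noteq> bot"
      using that(4) by (simp add: trivial_limit_within islimpt_ball)
    ultimately show ?thesis
      unfolding q_def by (simp add: tendsto_Lim)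
  qed
  have "smooth_on_cball q"
  proof (rule Ck_map_onI)
    fix p :: 'a assume p: "p \<in> \<B>"
    obtain U K where U: "open U" "p \<in> U" "Ck_on_open \<infinity> U K" "\<And>u. u \<in> U \<inter> \<B> \<Longrightarrow> E u = (1 - (norm u)\<^sup>2) * K u"
      by (rule smooth_division_cball_local[OF E zero p], assumption) (rule that)
    then show "\<exists>U F. open U \<and> p \<in> U \<and> Ck_on_open \<infinity> U F \<and> (\<forall>x\<in>U \<inter> \<B>. F x = q x)"
      using qK[OF U(1,3,4)] by (intro exI[of _ U] exI[of _ K]) auto
  qed
  moreover have "E u = (1 - (norm u)\<^sup>2) * q u" if u: "u \<in> \<B>" for u
  proof -
    obtain U K where U: "open U" "u \<in> U" "Ck_on_open \<infinity> U K" "\<And>u. u \<in> U \<inter> \<B> \<Longrightarrow> E u = (1 - (norm u)\<^sup>2) * K u"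
      by (rule smooth_division_cball_local[OF E zero u], assumption) (rule that)
    then show ?thesis using qK[OF U(1,3,4)] u by simp
  qed
  ultimately show ?thesis by (rule that)
qed

section \<open>Smooth frames of the normal bundle\<close>

text \<open>Near a point, a smooth left inverse of an extension of \<open>f\<close> agrees with the
  inverse of \<open>f\<close> on the whole image, once the compact image of the points outside
  \<open>N\<close> has been removed.\<close>

lemma Ck_map_on_inv_into_cball:
  fixes f :: "'a::euclidean_space \<Rightarrow> real^'m"
  assumes f: "smooth_on_cball f" and inj: "inj_on f \<B>"
    and injD: "\<And>x. x \<in> \<B> \<Longrightarrow> inj (D_cball f x)"
  shows "Ck_map_on \<infinity> (f ` \<B>) (inv_into \<B> f)"
proof (rule Ck_map_onI)
  fix p assume "p \<in> f ` \<B>"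
  then obtain q where q: "q \<in> \<B>" and p: "p = f q" by blast
  obtain U F where F: "open U" "q \<in> U" "Ck_on_open \<infinity> U F" "\<And>x. x \<in> U \<inter> \<B> \<Longrightarrow> F x = f x"
    by (rule Ck_map_onE[OF f q]) (rule that)
  have "D_cball f q = frechet_derivative F (at q)"
    using q F by (intro Ck_map_on_convex_derivative(3)[OF _ _ f]) auto
  then have "inj (frechet_derivative F (at q))"
    using injD[OF q] by simp
  then obtain N V \<Lambda> where N: "open N" "q \<in> N" "N \<subseteq> U" "open V" "F ` N \<subseteq> V" "Ck_on_open \<infinity> V \<Lambda>"
      "\<And>x. x \<in> N \<Longrightarrow> \<Lambda> (F x) = x"
    by (rule smooth_left_inverse[OF F(1,2,3)]) (rule that)
  define V' where "V' = V - f ` (\<B> - N)"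
  have "compact (f ` (\<B> - N))"
    using N(1) by (intro compact_continuous_image compact_diff continuous_on_subset[OF Ck_map_on_continuous[OF f]]) auto
  then have "open V'" using N(4) by (simp add: V'_def open_Diff compact_imp_closed)
  moreover have "p \<in> V'"
  proof -
    have "f q \<in> V" using N(2,3,5) F(4)[of q] q by force
    then show ?thesis
      using N(2) p inj_onD[OF inj _ q] by (auto simp: V'_def)
  qed
  moreover have "Ck_on_open \<infinity> V' \<Lambda>"
    by (rule Ck_on_open_mono[OF N(6)]) (auto simp: V'_def)
  moreover have "\<Lambda> y = inv_into \<B> f y" if "y \<in> V' \<inter> f ` \<B>" for y
  proof -
    have "y \<in> f ` \<B>" using that by blast
    then obtain x where x: "x \<in> \<B>" "y = f x" by blast
    then have "x \<in> N" using that by (auto simp: V'_def)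
    then have "\<Lambda> (F x) = x" "F x = y" using x N(3) N(7)[of x] F(4)[of x] by auto
    then have "\<Lambda> y = x" by simp
    then show ?thesis using x inj by simp
  qed
  ultimately show "\<exists>U F. open U \<and> p \<in> U \<and> Ck_on_open \<infinity> U F \<and> (\<forall>x\<in>U \<inter> f ` \<B>. F x = inv_into \<B> f x)"
    by (intro exI[of _ V'] exI[of _ \<Lambda>]) auto
qed

section \<open>Indexed orthonormal and independent families\<close>

lemma span_image_lessThan:
  fixes g :: "nat \<Rightarrow> 'b::real_vector"
  shows "span (g ` {..<k}) = range (\<lambda>c. \<Sum>j<k. c j *\<^sub>R g j)"
proof
  have "subspace (range (\<lambda>c. \<Sum>j<k. c j *\<^sub>R g j))"
  proof (rule subspaceI)
    show "0 \<in> range (\<lambda>c. \<Sum>j<k. c j *\<^sub>R g j)"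
      by (rule image_eqI[of _ _ "\<lambda>_. 0"]) auto
    fix x y assume "x \<in> range (\<lambda>c. \<Sum>j<k. c j *\<^sub>R g j)" "y \<in> range (\<lambda>c. \<Sum>j<k. c j *\<^sub>R g j)"
    then obtain c d where "x = (\<Sum>j<k. c j *\<^sub>R g j)" "y = (\<Sum>j<k. d j *\<^sub>R g j)" by blast
    then show "x + y \<in> range (\<lambda>c. \<Sum>j<k. c j *\<^sub>R g j)"
      by (intro image_eqI[of _ _ "\<lambda>j. c j + d j"]) (auto simp: scaleR_add_left sum.distrib)
  next
    fix a x assume "x \<in> range (\<lambda>c. \<Sum>j<k. c j *\<^sub>R g j)"
    then obtain c where "x = (\<Sum>j<k. c j *\<^sub>R g j)" by blast
    then show "a *\<^sub>R x \<in> range (\<lambda>c. \<Sum>j<k. c j *\<^sub>R g j)"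
      by (intro image_eqI[of _ _ "\<lambda>j. a * c j"]) (auto simp: scaleR_sum_right)
  qed
  moreover have "g ` {..<k} \<subseteq> range (\<lambda>c. \<Sum>j<k. c j *\<^sub>R g j)"
  proof
    fix y assume "y \<in> g ` {..<k}"
    then obtain i where i: "i < k" "y = g i" by blast
    have "(\<Sum>j<k. (if j = i then 1 else 0) *\<^sub>R g j) = (\<Sum>j<k. if j = i then g j else 0)"
      by (intro sum.cong) auto
    then have "y = (\<Sum>j<k. (if j = i then 1 else 0) *\<^sub>R g j)"
      using i by simp
    then show "y \<in> range (\<lambda>c. \<Sum>j<k. c j *\<^sub>R g j)"
      by (rule range_eqI[where x="\<lambda>j. if j = i then 1 else 0"])
  qed
  ultimately show "span (g ` {..<k}) \<subseteq> range (\<lambda>c. \<Sum>j<k. c j *\<^sub>R g j)"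
    by (rule span_minimal[rotated])
  show "range (\<lambda>c. \<Sum>j<k. c j *\<^sub>R g j) \<subseteq> span (g ` {..<k})"
    by (intro image_subsetI span_sum span_scale span_base) auto
qed

text \<open>Frames are indexed families rather than sets, so that they can vary with a point while
  the coefficients stay attached to indices.\<close>

definition orthonormal_family :: "nat \<Rightarrow> (nat \<Rightarrow> 'b::euclidean_space) \<Rightarrow> bool" where
  "orthonormal_family k w \<longleftrightarrow> (\<forall>i<k. \<forall>j<k. w i \<bullet> w j = (if i = j then 1 else 0))"

text \<open>In terms of coefficients, so that injectivity of the family is a consequence instead of
  a separate condition.\<close>

definition linearly_independent :: "nat \<Rightarrow> (nat \<Rightarrow> 'b::euclidean_space) \<Rightarrow> bool" where
  "linearly_independent k v \<longleftrightarrow> (\<forall>c. (\<Sum>j<k. c j *\<^sub>R v j) = 0 \<longrightarrow> (\<forall>j<k. c j = 0))"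

lemma linearly_independentD:
  assumes "linearly_independent k v" "(\<Sum>j<k. c j *\<^sub>R v j) = 0" "i < k"
  shows "c i = 0"
  using assms unfolding linearly_independent_def by (elim allE[of _ c]) simp

lemma orthonormal_family_coeff:
  assumes "orthonormal_family k w" "i < k"
  shows "(\<Sum>j<k. c j *\<^sub>R w j) \<bullet> w i = c i"
proof -
  have "(\<Sum>j<k. c j *\<^sub>R w j) \<bullet> w i = (\<Sum>j<k. if j = i then c j else 0)"
    unfolding inner_sum_left using assms by (intro sum.cong) (auto simp: orthonormal_family_def)
  then show ?thesis using assms(2) by simp
qed

lemma orthonormal_family_independent:
  assumes "orthonormal_family k w" shows "linearly_independent k w"
  unfolding linearly_independent_def
proof (intro allI impI)
  fix c :: "nat \<Rightarrow> real" and j assume "(\<Sum>j<k. c j *\<^sub>R w j) = 0" "j < k"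
  then show "c j = 0"
    using orthonormal_family_coeff[OF assms \<open>j < k\<close>, of c] by simp
qed

lemma orthonormal_family_norm:
  assumes "orthonormal_family k w"
  shows "(norm (\<Sum>j<k. c j *\<^sub>R w j))\<^sup>2 = (\<Sum>j<k. (c j)\<^sup>2)"
proof -
  have "X \<bullet> (\<Sum>j<k. c j *\<^sub>R w j) = (\<Sum>i<k. c i * (X \<bullet> w i))" for X
    by (simp add: inner_sum_right)
  then have "(\<Sum>j<k. c j *\<^sub>R w j) \<bullet> (\<Sum>j<k. c j *\<^sub>R w j) = (\<Sum>i<k. c i * ((\<Sum>j<k. c j *\<^sub>R w j) \<bullet> w i))"
    .
  also have "\<dots> = (\<Sum>j<k. (c j)\<^sup>2)"
    by (intro sum.cong) (auto simp: orthonormal_family_coeff[OF assms] power2_eq_square)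
  finally show ?thesis by (simp add: dot_square_norm)
qed

lemma orthonormal_family_subspace:
  assumes "subspace S"
  obtains z where "orthonormal_family (dim S) z" "\<And>i. i < dim S \<Longrightarrow> z i \<in> S"
proof -
  obtain B where B: "B \<subseteq> S" "pairwise orthogonal B" "\<And>x. x \<in> B \<Longrightarrow> norm x = 1" "independent B"
    "card B = dim S" "span B = S"
    by (rule orthonormal_basis_subspace[OF assms]) (rule that)
  obtain z where z: "bij_betw z {..<dim S} B"
    using ex_bij_betw_nat_finite[OF independent_imp_finite[OF B(4)]] B(5) by (auto simp: atLeast0LessThan)
  have "orthonormal_family (dim S) z"
    unfolding orthonormal_family_def
  proof (intro allI impI)
    fix i j assume "i < dim S" "j < dim S"
    then have "z i \<in> B" "z j \<in> B" "z i = z j \<longleftrightarrow> i = j"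
      using bij_betw_apply[OF z] inj_on_eq_iff[OF bij_betw_imp_inj_on[OF z]] by auto
    then show "z i \<bullet> z j = (if i = j then 1 else 0)"
      using B(2,3) by (auto simp: norm_eq_1 pairwise_def orthogonal_def)
  qed
  then show ?thesis
    using that B(1) bij_betw_apply[OF z] by blast
qed

text \<open>Two equal members would satisfy a relation with coefficients 1 and -1, so the family is
  injective and its members form an independent set of \<open>k\<close> vectors.\<close>

lemma dim_span_independent_family:
  assumes "linearly_independent k v"
  shows "dim (span (v ` {..<k})) = k"
proof -
  have inj: "inj_on v {..<k}"
  proof (rule inj_onI, rule ccontr)
    fix i j assume ij: "i \<in> {..<k}" "j \<in> {..<k}" "v i = v j" "i \<noteq> j"
    define c where "c l = (if l = i then 1 else 0) - (if l = j then 1 else (0::real))" for l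
    have "(\<Sum>l<k. c l *\<^sub>R v l) = (\<Sum>l<k. (if l = i then v l else 0) - (if l = j then v l else 0))"
      by (intro sum.cong) (auto simp: c_def)
    also have "\<dots> = 0" using ij by (simp add: sum_subtractf)
    finally have "c i = 0" using linearly_independentD[OF assms] ij(1) by blast
    then show False using ij(4) by (simp add: c_def)
  qed
  have "independent (v ` {..<k})"
  proof (rule independent_if_scalars_zero)
    fix f x assume 0: "(\<Sum>x\<in>v ` {..<k}. f x *\<^sub>R x) = 0" and x: "x \<in> v ` {..<k}"
    have "(\<Sum>j<k. f (v j) *\<^sub>R v j) = 0"
      using 0 by (simp add: sum.reindex[OF inj])
    then have "f (v j) = 0" if "j < k" for j
      using linearly_independentD[OF assms, of "\<lambda>j. f (v j)"] that by blast
    then show "f x = 0" using x by auto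
  qed simp
  then show ?thesis
    using inj by (simp add: dim_span dim_eq_card_independent card_image)
qed

text \<open>By independence each new vector minus its projection is nonzero at every point, so
  dividing by the norm stays smooth. The equality of spans is carried along because this
  nonvanishing depends on it.\<close>

lemma smooth_Gram_Schmidt:
  fixes v :: "nat \<Rightarrow> 'a::euclidean_space \<Rightarrow> 'b::euclidean_space"
  assumes "\<And>i. i < k \<Longrightarrow> Ck_map_on \<infinity> S (v i)"
    and "\<And>x. x \<in> S \<Longrightarrow> linearly_independent k (\<lambda>i. v i x)"
  shows "\<exists>w. (\<forall>i<k. Ck_map_on \<infinity> S (w i)) \<and> (\<forall>x\<in>S. orthonormal_family k (\<lambda>i. w i x)) \<and>
    (\<forall>x\<in>S. span ((\<lambda>i. w i x) ` {..<k}) = span ((\<lambda>i. v i x) ` {..<k}))"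
  using assms
proof (induction k)
  case 0
  show ?case by (simp add: orthonormal_family_def)
next
  case (Suc k)
  have ind: "linearly_independent k (\<lambda>i. v i x)" if "x \<in> S" for x
    unfolding linearly_independent_def
  proof (intro allI impI)
    fix c :: "nat \<Rightarrow> real" and j assume c: "(\<Sum>j<k. c j *\<^sub>R v j x) = 0" and "j < k"
    have "(\<Sum>j<Suc k. (if j < k then c j else 0) *\<^sub>R v j x) = 0"
      using c by simp
    from linearly_independentD[OF Suc.prems(2)[OF that] this, of j]
    show "c j = 0"
      using \<open>j < k\<close> by simp
  qed
  obtain w where w: "\<And>i. i < k \<Longrightarrow> Ck_map_on \<infinity> S (w i)"
    "\<And>x. x \<in> S \<Longrightarrow> orthonormal_family k (\<lambda>i. w i x)"
    "\<And>x. x \<in> S \<Longrightarrow> span ((\<lambda>i. w i x) ` {..<k}) = span ((\<lambda>i. v i x) ` {..<k})"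
    using Suc.IH[OF Suc.prems(1)[OF less_SucI] ind] by blast
  define u where "u x = v k x - (\<Sum>j<k. (v k x \<bullet> w j x) *\<^sub>R w j x)" for x
  have vk: "Ck_map_on \<infinity> S (v k)"
    using Suc.prems(1) by blast
  have "Ck_map_on \<infinity> S (\<lambda>x. \<Sum>j<k. (v k x \<bullet> w j x) *\<^sub>R w j x)"
    by (rule Ck_map_on_sum) (simp add: Ck_map_on_scaleR Ck_map_on_inner vk w(1))
  then have u: "Ck_map_on \<infinity> S u"
    unfolding u_def by (rule Ck_map_on_diff[OF vk])
  have sum_in: "(\<Sum>j<k. (v k x \<bullet> w j x) *\<^sub>R w j x) \<in> span ((\<lambda>i. v i x) ` {..<k})" if "x \<in> S" for x
    unfolding w(3)[OF that, symmetric] by (intro span_sum span_scale span_base) auto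
  have u0: "u x \<noteq> 0" if x: "x \<in> S" for x
  proof
    assume "u x = 0"
    then have "v k x \<in> range (\<lambda>c. \<Sum>j<k. c j *\<^sub>R v j x)"
      using sum_in[OF x] unfolding span_image_lessThan by (simp add: u_def)
    then obtain c where "v k x = (\<Sum>j<k. c j *\<^sub>R v j x)" by blast
    then have "(\<Sum>j<Suc k. (if j < k then c j else - 1) *\<^sub>R v j x) = 0" by simp
    from linearly_independentD[OF Suc.prems(2)[OF x] this, of k]
    show False by simp
  qed
  have uw: "u x \<bullet> w i x = 0" if "x \<in> S" "i < k" for x i
    using orthonormal_family_coeff[OF w(2)[OF that(1)] that(2), of "\<lambda>j. v k x \<bullet> w j x"]
    by (simp add: u_def inner_diff_left)
  define w' where "w' i x = (if i = k then inverse (sqrt (u x \<bullet> u x)) *\<^sub>R u x else w i x)" for i x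
  have "Ck_map_on \<infinity> S (\<lambda>x. inverse (sqrt (u x \<bullet> u x)) *\<^sub>R u x)"
    by (intro Ck_map_on_scaleR Ck_map_on_inverse Ck_map_on_sqrt Ck_map_on_inner u) (use u0 in auto)
  then have "Ck_map_on \<infinity> S (w' i)" if "i < Suc k" for i
    using w(1) that by (cases "i = k") (simp_all add: w'_def[abs_def])
  moreover have "orthonormal_family (Suc k) (\<lambda>i. w' i x)" if x: "x \<in> S" for x
  proof -
    have kk: "w' k x \<bullet> w' k x = 1"
      using u0[OF x] by (simp add: w'_def power2_eq_square flip: power2_norm_eq_inner)
    have kj: "w' k x \<bullet> w' j x = 0" "w' j x \<bullet> w' k x = 0" if "j < k" for j
      using uw[OF x that] that by (simp_all add: w'_def inner_commute)
    have ij: "w' i x \<bullet> w' j x = (if i = j then 1 else 0)" if "i < k" "j < k" for i j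
      using w(2)[OF x] that by (simp add: w'_def orthonormal_family_def)
    show ?thesis
      unfolding orthonormal_family_def
    proof (intro allI impI)
      fix i j assume "i < Suc k" "j < Suc k"
      then consider "i < k" "j < k" | "i = k" "j < k" | "i < k" "j = k" | "i = k" "j = k" by linarith
      then show "w' i x \<bullet> w' j x = (if i = j then 1 else 0)"
        by cases (simp_all add: kk kj ij)
    qed
  qed
  moreover have "span ((\<lambda>i. w' i x) ` {..<Suc k}) = span ((\<lambda>i. v i x) ` {..<Suc k})" if x: "x \<in> S" for x
  proof -
    have w'im: "(\<lambda>i. w' i x) ` {..<Suc k} = insert (w' k x) ((\<lambda>i. w i x) ` {..<k})"
      by (auto simp: w'_def less_Suc_eq lessThan_Suc)
    have "sqrt (u x \<bullet> u x) \<noteq> 0" using u0[OF x] by simp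
    then have uw': "u x = sqrt (u x \<bullet> u x) *\<^sub>R w' k x"
      by (simp add: w'_def)
    then have vkx: "v k x = sqrt (u x \<bullet> u x) *\<^sub>R w' k x + (\<Sum>j<k. (v k x \<bullet> w j x) *\<^sub>R w j x)"
      unfolding u_def[of x] by (simp only: diff_eq_eq)
    have le: "span ((\<lambda>i. v i x) ` {..<k}) \<subseteq> span ((\<lambda>i. v i x) ` {..<Suc k})"
      by (intro span_mono) auto
    have le': "span ((\<lambda>i. w i x) ` {..<k}) \<subseteq> span ((\<lambda>i. w' i x) ` {..<Suc k})"
      unfolding w'im by (intro span_mono) auto
    have "w' k x \<in> span ((\<lambda>i. w' i x) ` {..<Suc k})"
      by (intro span_base) simp
    moreover have "(\<Sum>j<k. (v k x \<bullet> w j x) *\<^sub>R w j x) \<in> span ((\<lambda>i. w' i x) ` {..<Suc k})"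
      using sum_in[OF x] le' w(3)[OF x] by blast
    ultimately have 1: "v k x \<in> span ((\<lambda>i. w' i x) ` {..<Suc k})"
      by (subst vkx) (intro span_add span_scale)
    have "v k x \<in> span ((\<lambda>i. v i x) ` {..<Suc k})"
      by (intro span_base) simp
    moreover have "(\<Sum>j<k. (v k x \<bullet> w j x) *\<^sub>R w j x) \<in> span ((\<lambda>i. v i x) ` {..<Suc k})"
      using sum_in[OF x] le by blast
    ultimately have "u x \<in> span ((\<lambda>i. v i x) ` {..<Suc k})"
      unfolding u_def by (intro span_diff)
    then have 2: "w' k x \<in> span ((\<lambda>i. v i x) ` {..<Suc k})"
      by (simp add: w'_def span_scale)
    have vim: "(\<lambda>i. v i x) ` {..<Suc k} = insert (v k x) ((\<lambda>i. v i x) ` {..<k})"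
      by (simp add: lessThan_Suc)
    have 3: "(\<lambda>i. v i x) ` {..<k} \<subseteq> span ((\<lambda>i. w' i x) ` {..<Suc k})"
      using span_superset[of "(\<lambda>i. v i x) ` {..<k}"] w(3)[OF x] le' by blast
    have 4: "(\<lambda>i. w i x) ` {..<k} \<subseteq> span ((\<lambda>i. v i x) ` {..<Suc k})"
      using span_superset[of "(\<lambda>i. w i x) ` {..<k}"] w(3)[OF x] le by blast
    have "(\<lambda>i. w' i x) ` {..<Suc k} \<subseteq> span ((\<lambda>i. v i x) ` {..<Suc k})"
      using 2 4 by (subst w'im) blast
    moreover have "(\<lambda>i. v i x) ` {..<Suc k} \<subseteq> span ((\<lambda>i. w' i x) ` {..<Suc k})"
      using 1 3 by (subst vim) blast
    ultimately show ?thesis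
      by (intro equalityI span_minimal subspace_span)
  qed
  ultimately show ?case by blast
qed


text \<open>
  The frame at the centre is transported along each radius by projecting it onto the normal spaces
  at the points \<open>(i / N) *\<^sub>R x\<close>; for large \<open>N\<close> every such projection is injective.
\<close>

lemma smooth_normal_frame:
  fixes f :: "'a::euclidean_space \<Rightarrow> 'b::euclidean_space"
  assumes f: "smooth_on_cball f"
    and injD: "\<And>x. x \<in> \<B> \<Longrightarrow> inj (D_cball f x)"
  obtains l w where "DIM('a) + l = DIM('b)" "\<And>i. i < l \<Longrightarrow> smooth_on_cball (w i)"
    "\<And>x. x \<in> \<B> \<Longrightarrow> orthonormal_family l (\<lambda>i. w i x)"
    "\<And>x. x \<in> \<B> \<Longrightarrow>
      span ((\<lambda>i. w i x) ` {..<l}) = {v. \<forall>a. D_cball f x a \<bullet> v = 0}"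
proof -
  define d where "d = DIM('a)"
  define D where "D x = D_cball f x" for x
  have int: "interior (cball (0::'a) 1) \<noteq> {}" by simp
  have linD: "linear (D x)" if "x \<in> \<B>" for x
    using Ck_map_on_convex_derivative(1)[OF convex_cball int f that] has_derivative_linear D_def by metis
  obtain b where b: "bij_betw b {..<d} (Basis :: 'a set)"
    using ex_bij_betw_nat_finite[of "Basis :: 'a set"] by (auto simp: d_def atLeast0LessThan)
  have ob: "orthonormal_family d b"
    unfolding orthonormal_family_def
    using bij_betw_apply[OF b] bij_betw_imp_inj_on[OF b] by (auto simp: inner_Basis inj_on_def)
  have sT: "smooth_on_cball (\<lambda>x. D x (b i))" for i
    unfolding D_def by (rule Ck_map_on_convex_derivative(2)[OF convex_cball int f])
  have iT: "linearly_independent d (\<lambda>i. D x (b i))" if x: "x \<in> \<B>" for x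
    unfolding linearly_independent_def
  proof (intro allI impI)
    fix c :: "nat \<Rightarrow> real" and j assume "(\<Sum>j<d. c j *\<^sub>R D x (b j)) = 0" "j < d"
    then have "D x (\<Sum>j<d. c j *\<^sub>R b j) = D x 0"
      using linD[OF x] by (simp add: linear_sum linear_scale linear_0)
    then have "(\<Sum>j<d. c j *\<^sub>R b j) = 0"
      using injD[OF x, folded D_def] by (simp only: inj_eq)
    then show "c j = 0"
      using linearly_independentD[OF orthonormal_family_independent[OF ob]] \<open>j < d\<close> by blast
  qed
  have spT: "span ((\<lambda>i. D x (b i)) ` {..<d}) = range (D x)" if x: "x \<in> \<B>" for x
  proof -
    have "(\<lambda>i. D x (b i)) ` {..<d} = D x ` Basis"
      using bij_betw_imp_surj_on[OF b] by (metis image_image)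
    then show ?thesis
      using span_linear_image[OF linD[OF x], of Basis] by simp
  qed
  obtain t where t: "\<And>i. i < d \<Longrightarrow> smooth_on_cball (t i)"
    "\<And>x. x \<in> \<B> \<Longrightarrow> orthonormal_family d (\<lambda>i. t i x)"
    "\<And>x. x \<in> \<B> \<Longrightarrow> span ((\<lambda>i. t i x) ` {..<d}) = range (D x)"
    using smooth_Gram_Schmidt[of d "\<B>" "\<lambda>i x. D x (b i)", OF sT iT] spT by metis
  define nrm where "nrm x v \<longleftrightarrow> (\<forall>i<d. v \<bullet> t i x = 0)" for x v
  have nrm_iff: "nrm x v \<longleftrightarrow> (\<forall>a. D x a \<bullet> v = 0)" if x: "x \<in> \<B>" for x v
  proof
    assume "nrm x v"
    have "D x a \<bullet> v = 0" for a
    proof -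
      have "D x a \<in> span ((\<lambda>i. t i x) ` {..<d})" using t(3)[OF x] by simp
      then obtain c where "D x a = (\<Sum>j<d. c j *\<^sub>R t j x)"
        unfolding span_image_lessThan by blast
      then show ?thesis
        using \<open>nrm x v\<close> by (auto simp: nrm_def inner_commute[of _ v] inner_sum_right intro!: sum.neutral)
    qed
    then show "\<forall>a. D x a \<bullet> v = 0" ..
  next
    assume r: "\<forall>a. D x a \<bullet> v = 0"
    have "v \<bullet> t i x = 0" if "i < d" for i
    proof -
      have "t i x \<in> range (D x)"
        using that unfolding t(3)[OF x, symmetric] by (intro span_base) blast
      then show ?thesis using r by (auto simp: inner_commute)
    qed
    then show "nrm x v" by (simp add: nrm_def)
  qed
  \<comment> \<open>Orthogonal projection onto the normal space at \<open>x\<close>.\<close>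
  define P where "P x v = v - (\<Sum>i<d. (v \<bullet> t i x) *\<^sub>R t i x)" for x v
  have nrmP: "nrm x (P x v)" if "x \<in> \<B>" for x v
    unfolding nrm_def P_def
    using orthonormal_family_coeff[OF t(2)[OF that]] by (simp add: inner_diff_left)
  have linP: "P x (\<Sum>j<l. c j *\<^sub>R B j) = (\<Sum>j<l. c j *\<^sub>R P x (B j))" for x c B and l :: nat
  proof -
    have "linear (P x)"
      by (rule linearI) (simp_all add: P_def inner_add_left scaleR_add_left sum.distrib scaleR_sum_right algebra_simps)
    then show ?thesis by (simp add: linear_sum linear_scale)
  qed
  \<comment> \<open>The tolerance is chosen so that \<open>d\<close> terms of this size add up to
    less than 1.\<close>
  have "\<exists>\<delta>>0. \<forall>x\<in>\<B>. \<forall>y\<in>\<B>. dist y x < \<delta> \<longrightarrow> dist (t i y) (t i x) < 1 / (real d + 1)" if "i < d" for i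
    using compact_uniformly_continuous[OF Ck_map_on_continuous[OF t(1)[OF that]] compact_cball]
    unfolding uniformly_continuous_on_def by (auto elim: allE[of _ "1 / (real d + 1)"])
  then obtain \<delta> where \<delta>: "\<And>i. i < d \<Longrightarrow> \<delta> i > 0"
    "\<And>i x y. i < d \<Longrightarrow> x \<in> \<B> \<Longrightarrow> y \<in> \<B> \<Longrightarrow> dist y x < \<delta> i \<Longrightarrow> dist (t i y) (t i x) < 1 / (real d + 1)"
    by metis
  define \<delta>0 where "\<delta>0 = Min (insert 1 (\<delta> ` {..<d}))"
  have \<delta>0: "\<delta>0 > 0" "\<And>i. i < d \<Longrightarrow> \<delta>0 \<le> \<delta> i"
    using \<delta>(1) by (auto simp: \<delta>0_def)
  \<comment> \<open>A vector normal at \<open>x\<close> that the projection at a nearby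
    \<open>y\<close> kills is tangent at \<open>y\<close>. Its coefficient against
    \<open>t i y\<close> is its product with the small vector \<open>t i y - t i x\<close>, so a
    nonzero \<open>v\<close> would be shorter than itself.\<close>
  have Pinj: "v = 0" if xy: "x \<in> \<B>" "y \<in> \<B>" "dist y x < \<delta>0" and "nrm x v" "P y v = 0" for x y v
  proof (rule ccontr)
    assume "v \<noteq> 0"
    have "norm v = norm (\<Sum>i<d. (v \<bullet> t i y) *\<^sub>R t i y)"
      using that(5) by (simp add: P_def)
    also have "\<dots> \<le> (\<Sum>i<d. norm ((v \<bullet> t i y) *\<^sub>R t i y))"
      by (rule norm_sum)
    also have "\<dots> \<le> (\<Sum>i<d. norm v * (1 / (real d + 1)))"
    proof (rule sum_mono)
      fix i assume "i \<in> {..<d}"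
      then have i: "i < d" by simp
      have "t i y \<bullet> t i y = 1"
        using t(2)[OF xy(2)] i by (simp add: orthonormal_family_def)
      then have "norm (t i y) = 1" by (simp add: norm_eq_1)
      moreover have "v \<bullet> t i y = v \<bullet> (t i y - t i x)"
        using that(4) i by (simp add: nrm_def inner_diff_right)
      moreover have "\<bar>v \<bullet> (t i y - t i x)\<bar> \<le> norm v * norm (t i y - t i x)"
        by (rule Cauchy_Schwarz_ineq2)
      moreover have "norm (t i y - t i x) \<le> 1 / (real d + 1)"
        using \<delta>(2)[OF i xy(1,2)] xy(3) \<delta>0(2)[OF i] by (simp add: dist_norm)
      moreover from this have "norm v * norm (t i y - t i x) \<le> norm v * (1 / (real d + 1))"
        by (intro mult_left_mono) simp_all
      ultimately show "norm ((v \<bullet> t i y) *\<^sub>R t i y) \<le> norm v * (1 / (real d + 1))"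
        by simp
    qed
    also have "\<dots> = norm v * (real d / (real d + 1))" by simp
    also have "\<dots> < norm v * 1"
      using \<open>v \<noteq> 0\<close> by (intro mult_strict_left_mono) auto
    finally show False by simp
  qed
  obtain N where N: "inverse (real (Suc N)) < \<delta>0"
    using reals_Archimedean[OF \<delta>0(1)] by blast
  \<comment> \<open>The fractions run from \<open>\<sigma> 0 = 0\<close> to
    \<open>\<sigma> (Suc N) = 1\<close>, and successive points on a radius are less than \<delta>0
    apart.\<close>
  define \<sigma> where "\<sigma> i = real i / real (Suc N)" for i
  have \<sigma>: "\<sigma> i *\<^sub>R x \<in> \<B>" if "i \<le> Suc N" "x \<in> \<B>" for i and x :: 'a
  proof -
    have "0 \<le> \<sigma> i" "\<sigma> i \<le> 1" using that(1) by (simp_all add: \<sigma>_def)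
    then show ?thesis using that(2) by (simp add: mult_le_one)
  qed
  have \<sigma>step: "dist (\<sigma> (Suc i) *\<^sub>R x) (\<sigma> i *\<^sub>R x) < \<delta>0" if "x \<in> \<B>" for i and x :: 'a
  proof -
    have eq: "\<sigma> (Suc i) - \<sigma> i = inverse (real (Suc N))"
      by (simp add: \<sigma>_def field_simps)
    have "dist (\<sigma> (Suc i) *\<^sub>R x) (\<sigma> i *\<^sub>R x) = inverse (real (Suc N)) * norm x"
      unfolding dist_norm scaleR_diff_left[symmetric] eq by simp
    also have "\<dots> \<le> inverse (real (Suc N)) * 1"
      using that by (intro mult_left_mono) auto
    finally show ?thesis using N by simp
  qed
  have dimN: "dim {v. \<forall>a. D x a \<bullet> v = 0} + d = DIM('b)" if x: "x \<in> \<B>" for x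
  proof -
    have sub: "subspace (range (D x))"
      using linD[OF x] linear_subspace_image subspace_UNIV by blast
    have "dim (range (D x)) = d"
      using dim_image_eq[OF linD[OF x], of UNIV] injD[OF x] by (simp add: dim_UNIV D_def d_def)
    moreover have "{y \<in> UNIV. \<forall>x'\<in>range (D x). orthogonal x' y} = {v. \<forall>a. D x a \<bullet> v = 0}"
      by (auto simp: orthogonal_def)
    ultimately show ?thesis
      using dim_subspace_orthogonal_to_vectors[OF sub subspace_UNIV subset_UNIV] by (simp add: dim_UNIV)
  qed
  define l where "l = DIM('b) - d"
  have diml: "dim {v. \<forall>a. D x a \<bullet> v = 0} = l" if "x \<in> \<B>" for x
    using dimN[OF that] by (simp add: l_def)
  have "(0::'a) \<in> \<B>" by simp
  from dimN[OF this] have dl: "d + l = DIM('b)"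
    unfolding l_def by linarith
  have subN: "subspace {v. \<forall>a. D x a \<bullet> v = 0}" for x
    by (rule subspaceI) (simp_all add: inner_add_right)
  \<comment> \<open>At stage \<open>i\<close> the vectors with parameter \<open>x\<close> are normal
    at \<open>\<sigma> i *\<^sub>R x\<close>: the family starts as a constant basis of the normal
    space at the centre and ends as a frame at \<open>x\<close> itself.\<close>
  have "\<exists>B. (\<forall>j<l. smooth_on_cball (B j)) \<and>
      (\<forall>x\<in>\<B>. linearly_independent l (\<lambda>j. B j x) \<and> (\<forall>j<l. nrm (\<sigma> i *\<^sub>R x) (B j x)))"
    if "i \<le> Suc N" for i
    using that
  proof (induction i)
    case 0
    obtain h where h: "orthonormal_family l h" "\<And>i. i < l \<Longrightarrow> h i \<in> {v. \<forall>a. D 0 a \<bullet> v = 0}"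
      using orthonormal_family_subspace[OF subN[of 0]] diml[of 0] by auto
    have "linearly_independent l h" by (rule orthonormal_family_independent[OF h(1)])
    moreover have "nrm (\<sigma> 0 *\<^sub>R x) (h j)" if "j < l" for x j
      using h(2)[OF that] by (simp add: \<sigma>_def nrm_iff)
    ultimately show ?case
      by (intro exI[of _ "\<lambda>j x. h j"]) (auto intro: Ck_map_on_const)
  next
    case (Suc i)
    obtain B where B: "\<And>j. j < l \<Longrightarrow> smooth_on_cball (B j)"
      "\<And>x. x \<in> \<B> \<Longrightarrow> linearly_independent l (\<lambda>j. B j x)"
      "\<And>x j. x \<in> \<B> \<Longrightarrow> j < l \<Longrightarrow> nrm (\<sigma> i *\<^sub>R x) (B j x)"
      using Suc.IH[OF Suc_leD[OF Suc.prems]] by blast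
    have t\<sigma>: "smooth_on_cball (\<lambda>x. t k (\<sigma> (Suc i) *\<^sub>R x))" if "k < d" for k
      by (rule Ck_map_on_compose[OF Ck_map_on_linear t(1)[OF that]]) (use \<sigma>[OF Suc.prems] in \<open>auto simp: linear_scaleR\<close>)
    have "smooth_on_cball (\<lambda>x. P (\<sigma> (Suc i) *\<^sub>R x) (B j x))" if "j < l" for j
      unfolding P_def
      by (rule Ck_map_on_diff[OF B(1)[OF that] Ck_map_on_sum])
        (simp add: Ck_map_on_scaleR Ck_map_on_inner B(1)[OF that] t\<sigma>)
    moreover have "linearly_independent l (\<lambda>j. P (\<sigma> (Suc i) *\<^sub>R x) (B j x))" if x: "x \<in> \<B>" for x
      unfolding linearly_independent_def
    proof (intro allI impI)
      fix c :: "nat \<Rightarrow> real" and j assume c: "(\<Sum>j<l. c j *\<^sub>R P (\<sigma> (Suc i) *\<^sub>R x) (B j x)) = 0" and j: "j < l"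
      have "nrm (\<sigma> i *\<^sub>R x) (\<Sum>j<l. c j *\<^sub>R B j x)"
        using B(3)[OF x] by (simp add: nrm_def inner_sum_left)
      moreover have "P (\<sigma> (Suc i) *\<^sub>R x) (\<Sum>j<l. c j *\<^sub>R B j x) = 0"
        unfolding linP by (rule c)
      ultimately have "(\<Sum>j<l. c j *\<^sub>R B j x) = 0"
        by (rule Pinj[OF \<sigma>[OF Suc_leD[OF Suc.prems] x] \<sigma>[OF Suc.prems x] \<sigma>step[OF x]])
      then show "c j = 0"
        using linearly_independentD[OF B(2)[OF x]] j by blast
    qed
    ultimately show ?case
      using nrmP \<sigma>[OF Suc.prems] by (intro exI[of _ "\<lambda>j x. P (\<sigma> (Suc i) *\<^sub>R x) (B j x)"]) blast
  qed
  from this[OF order_refl] obtain B where B: "\<And>j. j < l \<Longrightarrow> smooth_on_cball (B j)"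
      "\<And>x. x \<in> \<B> \<Longrightarrow> linearly_independent l (\<lambda>j. B j x)"
      "\<And>x j. x \<in> \<B> \<Longrightarrow> j < l \<Longrightarrow> nrm (\<sigma> (Suc N) *\<^sub>R x) (B j x)"
    by blast
  have nB: "nrm x (B j x)" if "x \<in> \<B>" "j < l" for x j
    using B(3)[OF that] by (simp add: \<sigma>_def)
  obtain w where w: "\<And>i. i < l \<Longrightarrow> smooth_on_cball (w i)"
    "\<And>x. x \<in> \<B> \<Longrightarrow> orthonormal_family l (\<lambda>i. w i x)"
    "\<And>x. x \<in> \<B> \<Longrightarrow> span ((\<lambda>i. w i x) ` {..<l}) = span ((\<lambda>i. B i x) ` {..<l})"
    using smooth_Gram_Schmidt[of l "\<B>" B, OF B(1,2)] by blast
  \<comment> \<open>An orthonormal family of \<open>l\<close> normal vectors fills the normal space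
    by dimension.\<close>
  have "span ((\<lambda>i. w i x) ` {..<l}) = {v. \<forall>a. D x a \<bullet> v = 0}" if x: "x \<in> \<B>" for x
  proof (rule subspace_dim_equal[OF subspace_span subN])
    show "span ((\<lambda>i. w i x) ` {..<l}) \<subseteq> {v. \<forall>a. D x a \<bullet> v = 0}"
      unfolding w(3)[OF x] using nB[OF x] nrm_iff[OF x] by (intro span_minimal subN) auto
    show "dim (span ((\<lambda>i. w i x) ` {..<l})) \<ge> dim {v. \<forall>a. D x a \<bullet> v = 0}"
      using dim_span_independent_family[OF orthonormal_family_independent[OF w(2)[OF x]]] diml[OF x] by simp
  qed
  then show ?thesis
    using that[of l w] dl w(1,2) unfolding d_def D_def by blast
qed

section \<open>Disk bundles over an embedded disk\<close>

lemma Ck_map_on_cball_derivative: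
  fixes f :: "'a::euclidean_space \<Rightarrow> 'b::euclidean_space"
  assumes "smooth_on_cball f"
  shows "x \<in> \<B> \<Longrightarrow> (f has_derivative D_cball f x) (at x within \<B>)"
    and "smooth_on_cball (\<lambda>x. D_cball f x v)"
    and "x \<in> \<B> \<Longrightarrow> linear (D_cball f x)"
proof -
  have int: "interior (cball (0::'a) 1) \<noteq> {}" by simp
  note D = Ck_map_on_convex_derivative[OF convex_cball int assms]
  show "x \<in> \<B> \<Longrightarrow> (f has_derivative D_cball f x) (at x within \<B>)"
    by (rule D(1))
  then show "x \<in> \<B> \<Longrightarrow> linear (D_cball f x)"
    using has_derivative_linear by blast
  show "smooth_on_cball (\<lambda>x. D_cball f x v)"
    by (rule D(2))
qed

lemma frechet_derivative_cball_eq: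
  fixes f :: "'a::euclidean_space \<Rightarrow> 'b::euclidean_space"
  assumes "x \<in> \<B>" "(f has_derivative f') (at x within \<B>)"
  shows "D_cball f x = f'"
proof -
  have "interior (cball (0::'a) 1) \<noteq> {}" by simp
  moreover have "(f has_derivative D_cball f x) (at x within \<B>)"
    using assms(2) by (metis differentiableI frechet_derivative_works)
  ultimately show ?thesis
    using has_derivative_within_unique_convex[OF convex_cball _ assms(1)] assms(2) by blast
qed

lemma linear_norm_le_sum_Basis:
  fixes L :: "'a::euclidean_space \<Rightarrow> 'b::real_normed_vector"
  assumes "linear L"
  shows "norm (L a) \<le> norm a * (\<Sum>b\<in>Basis. norm (L b))"
proof -
  have "L a = (\<Sum>b\<in>Basis. (a \<bullet> b) *\<^sub>R L b)"
    by (subst euclidean_representation[of a, symmetric]) (simp only: linear_sum[OF assms] linear_scale[OF assms])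
  also have "norm \<dots> \<le> (\<Sum>b\<in>Basis. norm ((a \<bullet> b) *\<^sub>R L b))"
    by (rule norm_sum)
  also have "\<dots> \<le> (\<Sum>b\<in>Basis. norm a * norm (L b))"
    by (intro sum_mono) (simp add: mult_right_mono Basis_le_norm)
  finally show ?thesis by (simp add: sum_distrib_left)
qed

text \<open>The partial derivatives are continuous on a compact set, hence bounded; convexity of the
  ball admits the mean value inequality.\<close>

lemma smooth_on_cball_lipschitz:
  fixes g :: "'a::euclidean_space \<Rightarrow> 'b::euclidean_space"
  assumes g: "smooth_on_cball g"
  obtains L where "L > 0"
    "\<And>x a. x \<in> \<B> \<Longrightarrow> norm (D_cball g x a) \<le> L * norm a"
    "\<And>x y. x \<in> \<B> \<Longrightarrow> y \<in> \<B> \<Longrightarrow> norm (g x - g y) \<le> L * norm (x - y)"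
proof -
  let ?D = "\<lambda>x. D_cball g x"
  have "continuous_on \<B> (\<lambda>x. \<Sum>b\<in>Basis. norm (?D x b))"
    by (intro continuous_on_sum continuous_on_norm Ck_map_on_continuous[OF Ck_map_on_cball_derivative(2)[OF g]])
  then have "bounded ((\<lambda>x. \<Sum>b\<in>Basis. norm (?D x b)) ` \<B>)"
    by (intro compact_imp_bounded compact_continuous_image) auto
  then obtain L where L: "L > 0" "\<And>x. x \<in> \<B> \<Longrightarrow> norm (\<Sum>b\<in>Basis. norm (?D x b)) \<le> L"
    unfolding bounded_pos by blast
  have le: "norm (?D x a) \<le> L * norm a" if x: "x \<in> \<B>" for x a
  proof -
    have "norm (?D x a) \<le> norm a * (\<Sum>b\<in>Basis. norm (?D x b))"
      by (rule linear_norm_le_sum_Basis[OF Ck_map_on_cball_derivative(3)[OF g x]])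
    also have "\<dots> \<le> norm a * L"
      using L(2)[OF x] by (intro mult_left_mono) auto
    finally show ?thesis by (simp add: mult.commute)
  qed
  have "norm (g x - g y) \<le> L * norm (x - y)" if "x \<in> \<B>" "y \<in> \<B>" for x y
    by (rule differentiable_bound[OF convex_cball Ck_map_on_cball_derivative(1)[OF g] onorm_le[OF le] that])
  then show ?thesis using that L(1) le by blast
qed

text \<open>The mean value inequality is applied to f - Df(x). Its derivative is small near
  \<open>x\<close>, because each directional derivative of \<open>f\<close> is smooth and therefore
  Lipschitz.\<close>

lemma smooth_on_cball_quadratic_remainder:
  fixes f :: "'a::euclidean_space \<Rightarrow> 'b::euclidean_space"
  assumes f: "smooth_on_cball f"
  obtains K where "K > 0" "\<And>x y. x \<in> \<B> \<Longrightarrow> y \<in> \<B> \<Longrightarrow>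
    norm (f x - f y - D_cball f x (x - y)) \<le> K * norm (x - y) * norm (x - y)"
proof -
  let ?D = "\<lambda>x. D_cball f x"
  have "\<forall>b. \<exists>L>0. \<forall>x\<in>\<B>. \<forall>y\<in>\<B>. norm (?D x b - ?D y b) \<le> L * norm (x - y)"
  proof
    fix b
    obtain L where "L > 0" "\<And>x y. x \<in> \<B> \<Longrightarrow> y \<in> \<B> \<Longrightarrow> norm (?D x b - ?D y b) \<le> L * norm (x - y)"
      by (rule smooth_on_cball_lipschitz[OF Ck_map_on_cball_derivative(2)[OF f, of b]]) (rule that)
    then show "\<exists>L>0. \<forall>x\<in>\<B>. \<forall>y\<in>\<B>. norm (?D x b - ?D y b) \<le> L * norm (x - y)"
      by blast
  qed
  then obtain L where L: "\<And>b. L b > 0"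
    "\<And>b x y. x \<in> \<B> \<Longrightarrow> y \<in> \<B> \<Longrightarrow> norm (?D x b - ?D y b) \<le> L b * norm (x - y)"
    by metis
  define K where "K = (\<Sum>b\<in>Basis. L b)"
  have K: "K > 0" unfolding K_def by (intro sum_pos L) auto
  have DD: "norm (?D x a - ?D y a) \<le> K * norm (x - y) * norm a" if xy: "x \<in> \<B>" "y \<in> \<B>" for x y a
  proof -
    have "linear (\<lambda>a. ?D x a - ?D y a)"
      by (intro linear_compose_sub Ck_map_on_cball_derivative(3)[OF f] xy)
    then have "norm (?D x a - ?D y a) \<le> norm a * (\<Sum>b\<in>Basis. norm (?D x b - ?D y b))"
      by (rule linear_norm_le_sum_Basis)
    also have "\<dots> \<le> norm a * (\<Sum>b\<in>Basis. L b * norm (x - y))"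
      using L(2)[OF xy] by (intro mult_left_mono sum_mono) auto
    finally show ?thesis by (simp add: K_def sum_distrib_right mult.commute)
  qed
  have "norm (f x - f y - ?D x (x - y)) \<le> K * norm (x - y) * norm (x - y)" if xy: "x \<in> \<B>" "y \<in> \<B>" for x y
  proof -
    \<comment> \<open>Every point of this convex set is within |x - y| of \<open>x\<close>, which
      makes the bound on the derivative uniform.\<close>
    define S where "S = \<B> \<inter> cball x (norm (x - y))"
    have linx: "linear (?D x)" by (rule Ck_map_on_cball_derivative(3)[OF f xy(1)])
    have "norm ((f x - ?D x x) - (f y - ?D x y)) \<le> (K * norm (x - y)) * norm (x - y)"
    proof (rule differentiable_bound[of S])
      show "convex S" unfolding S_def by (intro convex_Int convex_cball)
      show "((\<lambda>z. f z - ?D x z) has_derivative (\<lambda>a. ?D z a - ?D x a)) (at z within S)" if "z \<in> S" for z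
      proof (intro has_derivative_diff)
        show "(f has_derivative ?D z) (at z within S)"
          using that by (intro has_derivative_subset[OF Ck_map_on_cball_derivative(1)[OF f]]) (auto simp: S_def)
        show "(?D x has_derivative ?D x) (at z within S)"
          using linx by (simp add: linear_conv_bounded_linear bounded_linear_imp_has_derivative)
      qed
      show "onorm (\<lambda>a. ?D z a - ?D x a) \<le> K * norm (x - y)" if z: "z \<in> S" for z
      proof (rule onorm_le)
        fix a
        have "norm (?D z a - ?D x a) \<le> K * norm (z - x) * norm a"
          using z xy(1) by (intro DD) (auto simp: S_def)
        also have "\<dots> \<le> K * norm (x - y) * norm a"
          using z K by (intro mult_right_mono mult_left_mono) (auto simp: S_def dist_norm norm_minus_commute)
        finally show "norm (?D z a - ?D x a) \<le> K * norm (x - y) * norm a" .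
      qed
    qed (use xy in \<open>auto simp: S_def dist_norm\<close>)
    then show ?thesis
      by (simp add: linear_diff[OF linx] algebra_simps)
  qed
  then show ?thesis using that K by blast
qed

text \<open>Injectivity makes |Df(x) a| positive on the compact product of the ball and the unit
  sphere; \<open>c\<close> is its minimum, and homogeneity covers all \<open>a\<close>.\<close>

lemma smooth_on_cball_derivative_lower_bound:
  fixes f :: "'a::euclidean_space \<Rightarrow> 'b::euclidean_space"
  assumes f: "smooth_on_cball f"
    and injD: "\<And>x. x \<in> \<B> \<Longrightarrow> inj (D_cball f x)"
  obtains c where "c > 0"
    "\<And>x a. x \<in> \<B> \<Longrightarrow> c * norm a \<le> norm (D_cball f x a)"
proof -
  let ?D = "\<lambda>x. D_cball f x"
  let ?S = "cball (0::'a) 1 \<times> sphere (0::'a) 1"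
  have eq: "?D (fst p) (snd p) = (\<Sum>b\<in>Basis. (snd p \<bullet> b) *\<^sub>R ?D (fst p) b)" if "p \<in> ?S" for p
  proof -
    have lin: "linear (?D (fst p))" using that by (intro Ck_map_on_cball_derivative(3)[OF f]) auto
    show ?thesis
      by (subst euclidean_representation[of "snd p", symmetric]) (simp only: linear_sum[OF lin] linear_scale[OF lin])
  qed
  have "continuous_on ?S (\<lambda>p. ?D (fst p) b)" for b
    by (rule continuous_on_compose2[OF Ck_map_on_continuous[OF Ck_map_on_cball_derivative(2)[OF f]]]) (auto intro: continuous_intros)
  then have "continuous_on ?S (\<lambda>p. norm (\<Sum>b\<in>Basis. (snd p \<bullet> b) *\<^sub>R ?D (fst p) b))"
    by (intro continuous_intros)
  then have cont: "continuous_on ?S (\<lambda>p. norm (?D (fst p) (snd p)))"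
    by (rule iffD1[OF continuous_on_cong[OF refl], rotated]) (simp add: eq)
  obtain e :: 'a where e: "e \<in> Basis" using nonempty_Basis by blast
  then have "(0, e) \<in> ?S" by simp
  then obtain p where p: "p \<in> ?S" "\<And>q. q \<in> ?S \<Longrightarrow> norm (?D (fst p) (snd p)) \<le> norm (?D (fst q) (snd q))"
    using continuous_attains_inf[OF _ _ cont] compact_Times[OF compact_cball compact_sphere] by blast
  define c where "c = norm (?D (fst p) (snd p))"
  have lin: "linear (?D x)" if "x \<in> \<B>" for x
    by (rule Ck_map_on_cball_derivative(3)[OF f that])
  have "c > 0"
  proof -
    have "fst p \<in> \<B>" "snd p \<noteq> 0" using p(1) by auto
    then have "?D (fst p) (snd p) \<noteq> 0"
      using injD[of "fst p"] lin[of "fst p"] by (auto simp: linear_injective_0)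
    then show ?thesis by (simp add: c_def)
  qed
  moreover have "c * norm a \<le> norm (?D x a)" if x: "x \<in> \<B>" for x a
  proof (cases "a = 0")
    case False
    then have "(x, a /\<^sub>R norm a) \<in> ?S" using x by simp
    then have "c \<le> norm (?D x (a /\<^sub>R norm a))"
      using p(2) by (fastforce simp: c_def)
    also have "\<dots> = norm (?D x a) / norm a"
      by (simp add: linear_scale[OF lin[OF x]] divide_inverse mult.commute)
    finally show ?thesis using False by (simp add: pos_le_divide_eq)
  qed simp
  ultimately show ?thesis using that by blast
qed

text \<open>The distance of the images attains a positive minimum on the compact set of pairs at
  least \<delta> apart. If there are no such pairs, any positive constant serves.\<close>

lemma injective_on_cball_separation:
  fixes f :: "'a::euclidean_space \<Rightarrow> 'b::euclidean_space"
  assumes f: "continuous_on \<B> f" and inj: "inj_on f \<B>" and "\<delta> > 0"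
  obtains \<kappa> where "\<kappa> > 0"
    "\<And>x y. x \<in> \<B> \<Longrightarrow> y \<in> \<B> \<Longrightarrow> norm (x - y) \<ge> \<delta> \<Longrightarrow> \<kappa> \<le> norm (f x - f y)"
proof -
  define S where "S = (cball (0::'a) 1 \<times> cball (0::'a) 1) \<inter> {p. \<delta> \<le> norm (fst p - snd p)}"
  have "closed {p :: 'a \<times> 'a. \<delta> \<le> norm (fst p - snd p)}"
    by (intro closed_Collect_le continuous_intros)
  then have S: "compact S"
    unfolding S_def by (intro compact_Int_closed compact_Times compact_cball)
  show ?thesis
  proof (cases "S = {}")
    case True
    then have "\<not> norm (x - y) \<ge> \<delta>" if "x \<in> \<B>" "y \<in> \<B>" for x y :: 'a
    proof -
      have "(x, y) \<notin> S" using True by simp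
      then show ?thesis using that by (simp add: S_def)
    qed
    then show ?thesis using that[of 1] zero_less_one by blast
  next
    case False
    have "continuous_on S (\<lambda>p. norm (f (fst p) - f (snd p)))"
      by (intro continuous_intros continuous_on_compose2[OF f]) (auto simp: S_def)
    from continuous_attains_inf[OF S False this]
    obtain p where p: "p \<in> S" "\<And>q. q \<in> S \<Longrightarrow> norm (f (fst p) - f (snd p)) \<le> norm (f (fst q) - f (snd q))"
      by blast
    have "fst p \<noteq> snd p" using p(1) \<open>\<delta> > 0\<close> by (auto simp: S_def)
    then have "f (fst p) \<noteq> f (snd p)"
      using p(1) inj_onD[OF inj] by (auto simp: S_def)
    then show ?thesis
      using that[of "norm (f (fst p) - f (snd p))"] p(2) by (force simp: S_def)
  qed
qed

text \<open>A bijection of index sets distributes the coordinates of \<open>real^'n\<close> over the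
  base and the \<open>l\<close> fibre directions. The norm identity turns the unit ball into the set
  |u|^2 + |y|^2 <= 1.\<close>

lemma split_coordinates:
  assumes "DIM('a::euclidean_space) + l = CARD('n::finite)"
  obtains p :: "real^'n::finite \<Rightarrow> 'a::euclidean_space" and y :: "nat \<Rightarrow> real^'n \<Rightarrow> real" where "linear p" "\<And>i. linear (y i)"
    "\<And>x. (norm x)\<^sup>2 = (norm (p x))\<^sup>2 + (\<Sum>i<l. (y i x)\<^sup>2)"
    "\<And>u c. \<exists>x. p x = u \<and> (\<forall>i<l. y i x = c i)"
proof -
  define d where "d = DIM('a)"
  have dl: "CARD('n) = d + l" using assms by (simp add: d_def)
  obtain h :: "nat \<Rightarrow> 'n" where h: "bij_betw h {..<d + l} UNIV"
    using ex_bij_betw_nat_finite[of "UNIV :: 'n set"] by (auto simp: atLeast0LessThan dl)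
  define h' where "h' = inv_into {..<d + l} h"
  have h'h: "h' (h i) = i" if "i < d + l" for i
    using bij_betw_inv_into_left[OF h, of i] that by (simp add: h'_def)
  obtain b where b: "bij_betw b {..<d} (Basis :: 'a set)"
    using ex_bij_betw_nat_finite[of "Basis :: 'a set"] by (auto simp: d_def atLeast0LessThan)
  have ob: "orthonormal_family d b"
    unfolding orthonormal_family_def
    using bij_betw_apply[OF b] bij_betw_imp_inj_on[OF b] by (auto simp: inner_Basis inj_on_def)
  define p :: "real^'n \<Rightarrow> 'a" where "p x = (\<Sum>i<d. (x $ h i) *\<^sub>R b i)" for x
  define y :: "nat \<Rightarrow> real^'n \<Rightarrow> real" where "y i x = x $ h (d + i)" for i x
  have "linear p"
    by (rule linearI) (simp_all add: p_def scaleR_add_left sum.distrib scaleR_sum_right)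
  moreover have "linear (y i)" for i
    by (rule linearI) (simp_all add: y_def)
  moreover have "(norm x)\<^sup>2 = (norm (p x))\<^sup>2 + (\<Sum>i<l. (y i x)\<^sup>2)" for x
  proof -
    have "(norm x)\<^sup>2 = (\<Sum>k\<in>UNIV. (x $ k)\<^sup>2)"
      by (simp add: norm_vec_def L2_set_def sum_nonneg)
    also have "\<dots> = (\<Sum>i<d + l. (x $ h i)\<^sup>2)"
      by (rule sum.reindex_bij_betw[OF h, symmetric])
    also have "\<dots> = (\<Sum>i<d. (x $ h i)\<^sup>2) + (\<Sum>i<l. (x $ h (d + i))\<^sup>2)"
      by (induction l) simp_all
    also have "(\<Sum>i<d. (x $ h i)\<^sup>2) = (norm (p x))\<^sup>2"
      unfolding p_def by (rule orthonormal_family_norm[OF ob, symmetric])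
    finally show ?thesis by (simp add: y_def)
  qed
  moreover have "\<exists>x. p x = u \<and> (\<forall>i<l. y i x = c i)" for u c
  proof -
    define x :: "real^'n" where "x = (\<chi> k. if h' k < d then u \<bullet> b (h' k) else c (h' k - d))"
    have "p x = (\<Sum>i<d. (u \<bullet> b i) *\<^sub>R b i)"
      unfolding p_def x_def by (intro sum.cong) (simp_all add: h'h)
    also have "\<dots> = (\<Sum>e\<in>Basis. (u \<bullet> e) *\<^sub>R e)"
      by (rule sum.reindex_bij_betw[OF b])
    finally have "p x = u" by (simp add: euclidean_representation)
    moreover have "y i x = c i" if "i < l" for i
      using that by (simp add: y_def x_def h'h)
    ultimately show ?thesis by blast
  qed
  ultimately show ?thesis by (rule that)
qed

text \<open>
  Pairing \<open>f u - f u'\<close> with the tangent vector \<open>D_cball f u (u - u')\<close> kills the normal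
  components, so a short fibre displacement cannot compensate a displacement of the base.
\<close>

lemma tubular_uniqueness:
  fixes f :: "'a::euclidean_space \<Rightarrow> 'b::euclidean_space" and M :: "nat \<Rightarrow> 'a \<Rightarrow> 'b"
  assumes f: "smooth_on_cball f" and inj: "inj_on f \<B>"
    and injD: "\<And>x. x \<in> \<B> \<Longrightarrow> inj (D_cball f x)"
    and M: "\<And>i. i < l \<Longrightarrow> smooth_on_cball (M i)"
    and normal: "\<And>x a i. x \<in> \<B> \<Longrightarrow> i < l \<Longrightarrow> D_cball f x a \<bullet> M i x = 0"
  obtains \<epsilon> where "\<epsilon> > 0"
    "\<And>u u' y y'. u \<in> \<B> \<Longrightarrow> u' \<in> \<B> \<Longrightarrow> \<forall>i<l. \<bar>y i\<bar> \<le> 1 \<Longrightarrow> \<forall>i<l. \<bar>y' i\<bar> \<le> 1 \<Longrightarrow>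
      f u + \<epsilon> *\<^sub>R (\<Sum>i<l. y i *\<^sub>R M i u) = f u' + \<epsilon> *\<^sub>R (\<Sum>i<l. y' i *\<^sub>R M i u') \<Longrightarrow> u = u'"
    "\<And>u a y z. u \<in> \<B> \<Longrightarrow> \<forall>i<l. \<bar>y i\<bar> \<le> 1 \<Longrightarrow>
      D_cball f u a
        + \<epsilon> *\<^sub>R (\<Sum>i<l. z i *\<^sub>R M i u + y i *\<^sub>R D_cball (M i) u a) = 0 \<Longrightarrow> a = 0"
proof -
  let ?D = "\<lambda>x. D_cball f x"
  let ?DM = "\<lambda>i x. D_cball (M i) x"
  have linD: "linear (?D x)" if "x \<in> \<B>" for x
    by (rule Ck_map_on_cball_derivative(3)[OF f that])
  obtain c where c: "c > 0" "\<And>x a. x \<in> \<B> \<Longrightarrow> c * norm a \<le> norm (?D x a)"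
    by (rule smooth_on_cball_derivative_lower_bound[OF f injD], assumption) (rule that)
  obtain K where K: "K > 0" "\<And>x y. x \<in> \<B> \<Longrightarrow> y \<in> \<B> \<Longrightarrow>
      norm (f x - f y - ?D x (x - y)) \<le> K * norm (x - y) * norm (x - y)"
    by (rule smooth_on_cball_quadratic_remainder[OF f]) (rule that)
  \<comment> \<open>For |u - u'| < \<delta> the quadratic remainder is less than (c / 2) |u -
    u'|.\<close>
  define \<delta> where "\<delta> = c / (2 * K)"
  have \<delta>: "\<delta> > 0" using c(1) K(1) by (simp add: \<delta>_def)
  obtain \<kappa> where \<kappa>: "\<kappa> > 0" "\<And>x y. x \<in> \<B> \<Longrightarrow> y \<in> \<B> \<Longrightarrow> norm (x - y) \<ge> \<delta> \<Longrightarrow> \<kappa> \<le> norm (f x - f y)"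
    by (rule injective_on_cball_separation[OF Ck_map_on_continuous[OF f] inj \<delta>]) (rule that)
  define bd where "bd i L \<longleftrightarrow> L > 0 \<and> (\<forall>x\<in>\<B>. \<forall>a. norm (?DM i x a) \<le> L * norm a) \<and>
      (\<forall>x\<in>\<B>. \<forall>y\<in>\<B>. norm (M i x - M i y) \<le> L * norm (x - y)) \<and>
      (\<forall>x\<in>\<B>. norm (M i x) \<le> L)" for i L
  have "\<exists>L. bd i L" if i: "i < l" for i
  proof -
    obtain L where L: "L > 0" "\<And>x a. x \<in> \<B> \<Longrightarrow> norm (?DM i x a) \<le> L * norm a"
      "\<And>x y. x \<in> \<B> \<Longrightarrow> y \<in> \<B> \<Longrightarrow> norm (M i x - M i y) \<le> L * norm (x - y)"
      by (rule smooth_on_cball_lipschitz[OF M[OF i]]) (rule that)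
    have "bounded (M i ` \<B>)"
      by (intro compact_imp_bounded compact_continuous_image Ck_map_on_continuous[OF M[OF i]] compact_cball)
    then obtain B where B: "B > 0" "\<And>x. x \<in> \<B> \<Longrightarrow> norm (M i x) \<le> B"
      unfolding bounded_pos by blast
    have "norm (?DM i x a) \<le> (L + B) * norm a" if "x \<in> \<B>" for x a
      by (rule order_trans[OF L(2)[OF that]]) (use B(1) in \<open>simp add: mult_right_mono\<close>)
    moreover have "norm (M i x - M i y) \<le> (L + B) * norm (x - y)" if "x \<in> \<B>" "y \<in> \<B>" for x y
      by (rule order_trans[OF L(3)[OF that]]) (use B(1) in \<open>simp add: mult_right_mono\<close>)
    moreover have "norm (M i x) \<le> L + B" if "x \<in> \<B>" for x
      using B(2)[OF that] L(1) by simp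
    ultimately show ?thesis using L(1) B(1) unfolding bd_def by (intro exI[of _ "L + B"]) simp
  qed
  then obtain L where "\<And>i. i < l \<Longrightarrow> bd i (L i)"
    by metis
  then have L: "\<And>i. i < l \<Longrightarrow> L i > 0"
    "\<And>i x a. i < l \<Longrightarrow> x \<in> \<B> \<Longrightarrow> norm (?DM i x a) \<le> L i * norm a"
    "\<And>i x y. i < l \<Longrightarrow> x \<in> \<B> \<Longrightarrow> y \<in> \<B> \<Longrightarrow> norm (M i x - M i y) \<le> L i * norm (x - y)"
    "\<And>i x. i < l \<Longrightarrow> x \<in> \<B> \<Longrightarrow> norm (M i x) \<le> L i"
    unfolding bd_def by blast+
  \<comment> \<open>The summand 1 keeps \<open>T\<close> positive when \<open>l = 0\<close>.\<close>
  define T where "T = 1 + (\<Sum>i<l. L i)"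
  have T: "T > 0" "(\<Sum>i<l. L i) < T"
    using sum_nonneg[of "{..<l}" L] L(1) by (auto simp: T_def less_imp_le intro: add_pos_nonneg)
  \<comment> \<open>The first bound serves nearby points and derivatives. The second serves points
    at least \<delta> apart: two fibre vectors of length at most \<epsilon> T cannot bridge the gap
    \<kappa>.\<close>
  define \<epsilon> where "\<epsilon> = min (c / (2 * T)) (\<kappa> / (4 * T))"
  have \<epsilon>: "\<epsilon> > 0" using c(1) \<kappa>(1) T(1) by (simp add: \<epsilon>_def)
  have \<epsilon>T: "\<epsilon> * T \<le> c / 2" "\<epsilon> * T \<le> \<kappa> / 4"
  proof -
    have "\<epsilon> * T \<le> c / (2 * T) * T" "\<epsilon> * T \<le> \<kappa> / (4 * T) * T"
      using T(1) by (intro mult_right_mono; simp add: \<epsilon>_def)+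
    then show "\<epsilon> * T \<le> c / 2" "\<epsilon> * T \<le> \<kappa> / 4" using T(1) by simp_all
  qed
  have sum_bound: "norm (\<Sum>i<l. y i *\<^sub>R v i) \<le> T * r"
    if "\<And>i. i < l \<Longrightarrow> \<bar>y i\<bar> \<le> 1" "\<And>i. i < l \<Longrightarrow> norm (v i) \<le> L i * r" "r \<ge> 0" for y and v :: "nat \<Rightarrow> 'b" and r
  proof -
    have "norm (\<Sum>i<l. y i *\<^sub>R v i) \<le> (\<Sum>i<l. norm (y i *\<^sub>R v i))" by (rule norm_sum)
    also have "\<dots> \<le> (\<Sum>i<l. L i * r)"
    proof (rule sum_mono)
      fix i assume "i \<in> {..<l}"
      then have "\<bar>y i\<bar> * norm (v i) \<le> 1 * (L i * r)"
        using that by (intro mult_mono) auto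
      then show "norm (y i *\<^sub>R v i) \<le> L i * r" by simp
    qed
    also have "\<dots> \<le> T * r"
      unfolding sum_distrib_right[symmetric] using T(2) that(3) by (intro mult_right_mono) auto
    finally show ?thesis .
  qed
  have "u = u'" if u: "u \<in> \<B>" "u' \<in> \<B>" and y: "\<forall>i<l. \<bar>y i\<bar> \<le> 1" "\<forall>i<l. \<bar>y' i\<bar> \<le> 1"
    and eq: "f u + \<epsilon> *\<^sub>R (\<Sum>i<l. y i *\<^sub>R M i u) = f u' + \<epsilon> *\<^sub>R (\<Sum>i<l. y' i *\<^sub>R M i u')" for u u' y y'
  proof (rule ccontr)
    assume ne: "u \<noteq> u'"
    show False
    proof (cases "norm (u - u') \<ge> \<delta>")
      case True
      have "norm (\<Sum>i<l. y i *\<^sub>R M i u) \<le> T * 1" "norm (\<Sum>i<l. y' i *\<^sub>R M i u') \<le> T * 1"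
        using L(4) u y by (intro sum_bound; simp)+
      then have "norm ((\<Sum>i<l. y' i *\<^sub>R M i u') - (\<Sum>i<l. y i *\<^sub>R M i u)) \<le> 2 * T"
        using norm_triangle_ineq4[of "\<Sum>i<l. y' i *\<^sub>R M i u'" "\<Sum>i<l. y i *\<^sub>R M i u"] by linarith
      then have "\<epsilon> * norm ((\<Sum>i<l. y' i *\<^sub>R M i u') - (\<Sum>i<l. y i *\<^sub>R M i u)) \<le> \<epsilon> * (2 * T)"
        using \<epsilon> by (intro mult_left_mono) auto
      moreover have "f u - f u' = \<epsilon> *\<^sub>R ((\<Sum>i<l. y' i *\<^sub>R M i u') - (\<Sum>i<l. y i *\<^sub>R M i u))"
        using eq by (simp add: algebra_simps)
      ultimately have "norm (f u - f u') \<le> 2 * (\<epsilon> * T)"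
        using \<epsilon> by simp
      then show False
        using \<kappa>(2)[OF u True] \<epsilon>T(2) \<kappa>(1) by linarith
    next
      case False
      define \<tau> where "\<tau> = ?D u (u - u')"
      have \<tau>n: "c * norm (u - u') \<le> norm \<tau>" unfolding \<tau>_def by (rule c(2)[OF u(1)])
      have pos: "norm (u - u') > 0" using ne by simp
      then have \<tau>pos: "norm \<tau> > 0" using \<tau>n c(1) by (smt (verit) mult_pos_pos)
      \<comment> \<open>The difference of the fibre vectors is split into the change of the frame
        between \<open>u\<close> and \<open>u'\<close>, which is of order |u - u'|, and a
        combination of the \<open>M i u\<close>, which is orthogonal to \<tau>.\<close>
      define s where "s = (\<Sum>i<l. y' i *\<^sub>R (M i u' - M i u))"
      have "f u - f u' = \<epsilon> *\<^sub>R (\<Sum>i<l. y' i *\<^sub>R M i u') - \<epsilon> *\<^sub>R (\<Sum>i<l. y i *\<^sub>R M i u)"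
        using eq by (simp add: algebra_simps)
      also have "\<dots> = \<epsilon> *\<^sub>R s + \<epsilon> *\<^sub>R (\<Sum>i<l. (y' i - y i) *\<^sub>R M i u)"
        by (simp add: s_def algebra_simps sum_subtractf flip: scaleR_add_right)
      finally have "\<tau> \<bullet> (f u - f u') = \<epsilon> * (\<tau> \<bullet> s) + \<epsilon> * (\<Sum>i<l. (y' i - y i) * (\<tau> \<bullet> M i u))"
        by (simp add: inner_add_right inner_sum_right)
      also have "(\<Sum>i<l. (y' i - y i) * (\<tau> \<bullet> M i u)) = 0"
        using normal[OF u(1)] by (simp add: \<tau>_def)
      finally have 1: "\<tau> \<bullet> (f u - f u') = \<epsilon> * (\<tau> \<bullet> s)" by simp
      have "norm s \<le> T * norm (u - u')"
        unfolding s_def using L(3)[OF _ u(2,1)] y(2) by (intro sum_bound) (auto simp: norm_minus_commute)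
      then have "\<tau> \<bullet> s \<le> norm \<tau> * (T * norm (u - u'))"
        using norm_cauchy_schwarz[of \<tau> s] by (meson mult_left_mono norm_ge_zero order_trans)
      then have "\<epsilon> * (\<tau> \<bullet> s) \<le> \<epsilon> * (norm \<tau> * (T * norm (u - u')))"
        using \<epsilon> by (intro mult_left_mono) auto
      also have "\<dots> = (\<epsilon> * T) * (norm \<tau> * norm (u - u'))" by simp
      also have "\<dots> \<le> (c / 2) * (norm \<tau> * norm (u - u'))"
        using \<epsilon>T(1) by (intro mult_right_mono) auto
      finally have 2: "\<tau> \<bullet> (f u - f u') \<le> (c / 2) * (norm \<tau> * norm (u - u'))" using 1 by simp
      define r where "r = f u - f u' - \<tau>"
      have "norm r \<le> K * norm (u - u') * norm (u - u')"
        unfolding r_def \<tau>_def by (rule K(2)[OF u])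
      also have "\<dots> < (c / 2) * norm (u - u')"
        using False pos K(1) by (intro mult_strict_right_mono) (simp_all add: \<delta>_def field_simps)
      finally have "norm \<tau> * norm r < norm \<tau> * ((c / 2) * norm (u - u'))"
        using \<tau>pos by (intro mult_strict_left_mono)
      moreover have "\<tau> \<bullet> (f u - f u') = \<tau> \<bullet> \<tau> + \<tau> \<bullet> r"
        by (simp add: r_def inner_diff_right)
      moreover have "- (norm \<tau> * norm r) \<le> \<tau> \<bullet> r"
        using Cauchy_Schwarz_ineq2[of \<tau> r] by linarith
      \<comment> \<open>The square of \<tau> is at least c |\<tau>| |u - u'|, yet it is bounded by
        two contributions of at most half this size, of which the remainder is strictly
        smaller.\<close>
      moreover have "norm \<tau> * (c * norm (u - u')) \<le> \<tau> \<bullet> \<tau>"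
        using mult_left_mono[OF \<tau>n, of "norm \<tau>"] by (simp add: dot_square_norm power2_eq_square)
      ultimately show False using 2 by (simp add: algebra_simps)
    qed
  qed
  moreover have "a = 0" if u: "u \<in> \<B>" and y: "\<forall>i<l. \<bar>y i\<bar> \<le> 1"
    and eq: "?D u a + \<epsilon> *\<^sub>R (\<Sum>i<l. z i *\<^sub>R M i u + y i *\<^sub>R ?DM i u a) = 0" for u a y z
  proof (rule ccontr)
    assume "a \<noteq> 0"
    then have pos: "norm a > 0" by simp
    define \<tau> where "\<tau> = ?D u a"
    have \<tau>n: "c * norm a \<le> norm \<tau>" unfolding \<tau>_def by (rule c(2)[OF u])
    then have \<tau>pos: "norm \<tau> > 0" using pos c(1) by (smt (verit) mult_pos_pos)
    \<comment> \<open>As before the components along the frame are orthogonal to \<tau>; what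
      remains is the derivative of the frame, too small to cancel \<tau>.\<close>
    define s where "s = (\<Sum>i<l. y i *\<^sub>R ?DM i u a)"
    have "\<tau> \<bullet> (\<Sum>i<l. z i *\<^sub>R M i u) = 0"
      unfolding inner_sum_right using normal[OF u] by (intro sum.neutral) (simp add: \<tau>_def)
    moreover have "\<tau> \<bullet> (\<tau> + \<epsilon> *\<^sub>R ((\<Sum>i<l. z i *\<^sub>R M i u) + s)) = 0"
      using eq by (simp add: \<tau>_def s_def sum.distrib)
    ultimately have 1: "\<tau> \<bullet> \<tau> = - (\<epsilon> * (\<tau> \<bullet> s))"
      by (simp add: inner_add_right)
    have "norm s \<le> T * norm a"
      unfolding s_def using L(2)[OF _ u] y by (intro sum_bound) auto
    then have "- (\<tau> \<bullet> s) \<le> norm \<tau> * (T * norm a)"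
      using Cauchy_Schwarz_ineq2[of \<tau> s] mult_left_mono[of "norm s" "T * norm a" "norm \<tau>"] by auto
    then have "\<epsilon> * (- (\<tau> \<bullet> s)) \<le> \<epsilon> * (norm \<tau> * (T * norm a))"
      using \<epsilon> by (intro mult_left_mono) auto
    also have "\<dots> = (\<epsilon> * T) * (norm \<tau> * norm a)" by simp
    also have "\<dots> \<le> (c / 2) * (norm \<tau> * norm a)"
      using \<epsilon>T(1) by (intro mult_right_mono) auto
    finally have "\<tau> \<bullet> \<tau> \<le> norm \<tau> * (c / 2 * norm a)" using 1 by (simp add: algebra_simps)
    then have "norm \<tau> \<le> c / 2 * norm a"
      using \<tau>pos by (simp add: dot_square_norm power2_eq_square)
    moreover have "c * norm a > 0" using c(1) pos by simp
    ultimately show False using \<tau>n by linarith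
  qed
  ultimately show ?thesis by (rule that[OF \<epsilon>])
qed

text \<open>The factor sqrt k is absorbed into the vector fields \<open>M\<close>, so that
  \<epsilon> is chosen after \<open>k\<close>. Image and uniqueness are stated through pairs (u, v),
  because the group acts on such pairs and the fibre coordinates depend on the frame.\<close>

lemma disk_bundle_embedding:
  fixes f :: "'a::euclidean_space \<Rightarrow> real^'m" and w :: "nat \<Rightarrow> 'a \<Rightarrow> real^'m" and k :: "'a \<Rightarrow> real"
  assumes f: "smooth_on_cball f" and inj: "inj_on f \<B>"
    and injD: "\<And>x. x \<in> \<B> \<Longrightarrow> inj (D_cball f x)"
    and w: "\<And>i. i < l \<Longrightarrow> smooth_on_cball (w i)"
    and on: "\<And>x. x \<in> \<B> \<Longrightarrow> orthonormal_family l (\<lambda>i. w i x)"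
    and normal: "\<And>x a i. x \<in> \<B> \<Longrightarrow> i < l \<Longrightarrow> D_cball f x a \<bullet> w i x = 0"
    and k: "smooth_on_cball k" and kpos: "\<And>x. x \<in> \<B> \<Longrightarrow> k x > 0"
    and card: "DIM('a) + l = CARD('n)"
  obtains G :: "real^'n::finite \<Rightarrow> real^'m" and \<epsilon> where "\<epsilon> > 0"
    "smooth_on_cball G" "inj_on G \<B>"
    "\<And>x. x \<in> \<B> \<Longrightarrow> inj (D_cball G x)"
    "G ` \<B> = {f u + v | u v. u \<in> \<B> \<and> v \<in> span ((\<lambda>i. w i u) ` {..<l}) \<and>
      (norm v)\<^sup>2 \<le> \<epsilon>\<^sup>2 * ((1 - (norm u)\<^sup>2) * k u)}"
    "\<And>u v u' v'. u \<in> \<B> \<Longrightarrow> v \<in> span ((\<lambda>i. w i u) ` {..<l}) \<Longrightarrow>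
      (norm v)\<^sup>2 \<le> \<epsilon>\<^sup>2 * ((1 - (norm u)\<^sup>2) * k u) \<Longrightarrow>
      u' \<in> \<B> \<Longrightarrow> v' \<in> span ((\<lambda>i. w i u') ` {..<l}) \<Longrightarrow>
      (norm v')\<^sup>2 \<le> \<epsilon>\<^sup>2 * ((1 - (norm u')\<^sup>2) * k u') \<Longrightarrow> f u + v = f u' + v' \<Longrightarrow> u = u'"
proof -
  define M where "M i u = sqrt (k u) *\<^sub>R w i u" for i u
  have M: "smooth_on_cball (M i)" if "i < l" for i
    unfolding M_def by (rule Ck_map_on_scaleR[OF Ck_map_on_sqrt[OF k kpos] w[OF that]])
  have normalM: "D_cball f x a \<bullet> M i x = 0" if "x \<in> \<B>" "i < l" for x a i
    using normal[OF that] by (simp add: M_def)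
  obtain \<epsilon> where \<epsilon>: "\<epsilon> > 0"
    and uniq: "\<And>u u' y y'. u \<in> \<B> \<Longrightarrow> u' \<in> \<B> \<Longrightarrow> \<forall>i<l. \<bar>y i\<bar> \<le> 1 \<Longrightarrow> \<forall>i<l. \<bar>y' i\<bar> \<le> 1 \<Longrightarrow>
      f u + \<epsilon> *\<^sub>R (\<Sum>i<l. y i *\<^sub>R M i u) = f u' + \<epsilon> *\<^sub>R (\<Sum>i<l. y' i *\<^sub>R M i u') \<Longrightarrow> u = u'"
    and uniqD: "\<And>u a y z. u \<in> \<B> \<Longrightarrow> \<forall>i<l. \<bar>y i\<bar> \<le> 1 \<Longrightarrow>
      D_cball f u a
        + \<epsilon> *\<^sub>R (\<Sum>i<l. z i *\<^sub>R M i u + y i *\<^sub>R D_cball (M i) u a) = 0 \<Longrightarrow> a = 0"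
    by (rule tubular_uniqueness[OF f inj injD M normalM], assumption+) (rule that)
  obtain p :: "real^'n \<Rightarrow> 'a" and y :: "nat \<Rightarrow> real^'n \<Rightarrow> real" where p: "linear p" and y: "\<And>i. linear (y i)"
    and norm: "\<And>x. (norm x)\<^sup>2 = (norm (p x))\<^sup>2 + (\<Sum>i<l. (y i x)\<^sup>2)"
    and surj: "\<And>u c. \<exists>x. p x = u \<and> (\<forall>i<l. y i x = c i)"
    by (rule split_coordinates[OF card]) (rule that)
  define G where "G x = f (p x) + \<epsilon> *\<^sub>R (\<Sum>i<l. y i x *\<^sub>R M i (p x))" for x
  have pball: "p x \<in> \<B>" if "x \<in> \<B>" for x
  proof -
    have "(norm (p x))\<^sup>2 \<le> (norm x)\<^sup>2" unfolding norm[of x] by (simp add: sum_nonneg)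
    then have "norm (p x) \<le> norm x" by (rule power2_le_imp_le) simp
    then show ?thesis using that by simp
  qed
  have yball: "\<forall>i<l. \<bar>y i x\<bar> \<le> 1" if "x \<in> \<B>" for x
  proof (intro allI impI)
    fix i assume "i < l"
    then have "(y i x)\<^sup>2 \<le> (\<Sum>i<l. (y i x)\<^sup>2)" by (intro member_le_sum) auto
    also have "\<dots> \<le> (norm x)\<^sup>2" unfolding norm[of x] by simp
    also have "\<dots> \<le> 1" using that by (simp add: abs_square_le_1)
    finally show "\<bar>y i x\<bar> \<le> 1" by (simp add: abs_square_le_1)
  qed
  have py0: "x = 0" if "p x = 0" "\<And>i. i < l \<Longrightarrow> y i x = 0" for x
    using norm[of x] that by simp
  have ind: "(\<Sum>i<l. c i *\<^sub>R M i u) = 0 \<Longrightarrow> i < l \<Longrightarrow> c i = 0" if u: "u \<in> \<B>" for u c i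
  proof -
    assume 0: "(\<Sum>i<l. c i *\<^sub>R M i u) = 0" and i: "i < l"
    have "(\<Sum>i<l. (c i * sqrt (k u)) *\<^sub>R w i u) = 0"
      using 0 by (simp add: M_def)
    then have "c i * sqrt (k u) = 0"
      using linearly_independentD[OF orthonormal_family_independent[OF on[OF u]] _ i, of "\<lambda>i. c i * sqrt (k u)"] by blast
    then show "c i = 0" using kpos[OF u] by simp
  qed
  have G: "smooth_on_cball G"
  proof -
    have Mp: "smooth_on_cball (\<lambda>x. M i (p x))" if "i < l" for i
      by (rule Ck_map_on_compose[OF Ck_map_on_linear[OF p] M[OF that]]) (use pball in blast)
    have fp: "smooth_on_cball (\<lambda>x. f (p x))"
      by (rule Ck_map_on_compose[OF Ck_map_on_linear[OF p] f]) (use pball in blast)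
    have "smooth_on_cball (\<lambda>x. \<Sum>i<l. y i x *\<^sub>R M i (p x))"
      by (rule Ck_map_on_sum) (simp add: Ck_map_on_scaleR Ck_map_on_linear[OF y] Mp)
    then show ?thesis
      unfolding G_def by (intro Ck_map_on_add fp Ck_map_on_scaleR[OF Ck_map_on_const])
  qed
  have injG: "inj_on G \<B>"
  proof (rule inj_onI)
    fix x x' assume x: "x \<in> \<B>" "x' \<in> \<B>" and eq: "G x = G x'"
    have pp: "p x = p x'"
      by (rule uniq[OF pball[OF x(1)] pball[OF x(2)] yball[OF x(1)] yball[OF x(2)] eq[unfolded G_def]])
    then have "(\<Sum>i<l. y i x *\<^sub>R M i (p x)) = (\<Sum>i<l. y i x' *\<^sub>R M i (p x))"
      using eq \<epsilon> by (simp add: G_def)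
    then have "(\<Sum>i<l. (y i x - y i x') *\<^sub>R M i (p x)) = 0"
      by (simp add: scaleR_diff_left sum_subtractf)
    from ind[OF pball[OF x(1)] this] have "y i x - y i x' = 0" if "i < l" for i
      using that .
    then have "x - x' = 0"
      using pp by (intro py0) (simp_all add: linear_diff[OF p] linear_diff[OF y])
    then show "x = x'" by simp
  qed
  have injDG: "inj (D_cball G x)" if x: "x \<in> \<B>" for x
  proof -
    define f' where "f' = D_cball f (p x)"
    define M' where "M' i = D_cball (M i) (p x)" for i
    have pD: "(p has_derivative p) (at x within \<B>)"
      using p by (simp add: linear_conv_bounded_linear bounded_linear_imp_has_derivative)
    have yD: "(y i has_derivative y i) (at x within \<B>)" for i
      using y by (simp add: linear_conv_bounded_linear bounded_linear_imp_has_derivative)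
    have pim: "p ` \<B> \<subseteq> \<B>" using pball by blast
    have "((\<lambda>x. f (p x)) has_derivative (\<lambda>h. f' (p h))) (at x within \<B>)"
      unfolding f'_def
      by (rule has_derivative_in_compose[OF pD has_derivative_subset[OF Ck_map_on_cball_derivative(1)[OF f pball[OF x]] pim]])
    moreover have "((\<lambda>x. M i (p x)) has_derivative (\<lambda>h. M' i (p h))) (at x within \<B>)" if "i < l" for i
      unfolding M'_def
      by (rule has_derivative_in_compose[OF pD has_derivative_subset[OF Ck_map_on_cball_derivative(1)[OF M[OF that] pball[OF x]] pim]])
    ultimately have "(G has_derivative (\<lambda>h. f' (p h) + \<epsilon> *\<^sub>R (\<Sum>i<l. y i x *\<^sub>R M' i (p h) + y i h *\<^sub>R M i (p x)))) (at x within \<B>)"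
      unfolding G_def
      by (intro has_derivative_add has_derivative_scaleR_right has_derivative_sum has_derivative_scaleR yD) auto
    from frechet_derivative_cball_eq[OF x this]
    have eq: "D_cball G x =
        (\<lambda>h. f' (p h) + \<epsilon> *\<^sub>R (\<Sum>i<l. y i h *\<^sub>R M i (p x) + y i x *\<^sub>R M' i (p h)))"
      by (simp add: add.commute)
    have lin: "linear (D_cball G x)"
      by (rule Ck_map_on_cball_derivative(3)[OF G x])
    show ?thesis
      unfolding linear_injective_0[OF lin]
    proof (intro allI impI)
      fix h assume 0: "D_cball G x h = 0"
      \<comment> \<open>The base component vanishes first, by the infinitesimal uniqueness;
        independence of the fields \<open>M\<close> then disposes of the fibre component.\<close>
      have ph: "p h = 0"
        by (rule uniqD[OF pball[OF x] yball[OF x] 0[unfolded eq f'_def M'_def]])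
      have "linear f'" "\<And>i. i < l \<Longrightarrow> linear (M' i)"
        unfolding f'_def M'_def using Ck_map_on_cball_derivative(3)[OF _ pball[OF x]] f M by blast+
      then have "(\<Sum>i<l. y i h *\<^sub>R M i (p x)) = 0"
        using 0 \<epsilon> unfolding eq ph by (simp add: linear_0)
      from ind[OF pball[OF x] this] show "h = 0"
        using ph by (intro py0)
    qed
  qed
  have rep: "\<exists>c. v = \<epsilon> *\<^sub>R (\<Sum>i<l. c i *\<^sub>R M i u) \<and> (\<Sum>i<l. (c i)\<^sup>2) \<le> 1 - (norm u)\<^sup>2"
    if u: "u \<in> \<B>" and v: "v \<in> span ((\<lambda>i. w i u) ` {..<l})" "(norm v)\<^sup>2 \<le> \<epsilon>\<^sup>2 * ((1 - (norm u)\<^sup>2) * k u)" for u v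
  proof -
    obtain d where d: "v = (\<Sum>i<l. d i *\<^sub>R w i u)"
      using v(1) unfolding span_image_lessThan by blast
    \<comment> \<open>The length of \<open>\<epsilon> *\<^sub>R M i u\<close>. Dividing the frame
      coefficients by it turns the bound on |v| into the bound 1 - |u|^2 for the sum of their
      squares.\<close>
    define e where "e = \<epsilon> * sqrt (k u)"
    have e: "e > 0" "e\<^sup>2 = \<epsilon>\<^sup>2 * k u"
      using \<epsilon> kpos[OF u] by (simp_all add: e_def power_mult_distrib)
    have "\<epsilon> * (x * sqrt (k u)) = e * x" for x
      by (simp add: e_def mult_ac)
    then have "\<epsilon> *\<^sub>R (\<Sum>i<l. (d i / e) *\<^sub>R M i u) = (\<Sum>i<l. (e * (d i / e)) *\<^sub>R w i u)"
      by (simp only: M_def scaleR_sum_right scaleR_scaleR)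
    also have "\<dots> = v" using e(1) by (simp add: d)
    finally have "v = \<epsilon> *\<^sub>R (\<Sum>i<l. (d i / e) *\<^sub>R M i u)" by simp
    moreover have "(\<Sum>i<l. (d i / e)\<^sup>2) \<le> 1 - (norm u)\<^sup>2"
    proof -
      have "(\<Sum>i<l. (d i / e)\<^sup>2) = (norm v)\<^sup>2 / e\<^sup>2"
        unfolding d orthonormal_family_norm[OF on[OF u]] by (simp add: power_divide sum_divide_distrib)
      also have "\<dots> \<le> (\<epsilon>\<^sup>2 * ((1 - (norm u)\<^sup>2) * k u)) / e\<^sup>2"
        using v(2) by (intro divide_right_mono) auto
      also have "\<dots> = ((1 - (norm u)\<^sup>2) * e\<^sup>2) / e\<^sup>2" by (simp add: e(2) mult_ac)
      also have "\<dots> = 1 - (norm u)\<^sup>2" using e(1) by simp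
      finally show ?thesis .
    qed
    ultimately show ?thesis by (intro exI[of _ "\<lambda>i. d i / e"] conjI)
  qed
  have "G ` \<B> = {f u + v | u v. u \<in> \<B> \<and> v \<in> span ((\<lambda>i. w i u) ` {..<l}) \<and>
      (norm v)\<^sup>2 \<le> \<epsilon>\<^sup>2 * ((1 - (norm u)\<^sup>2) * k u)}" (is "_ = ?W")
  proof (intro equalityI subsetI)
    fix z assume "z \<in> G ` \<B>"
    then obtain x where x: "x \<in> \<B>" "z = G x" by blast
    define u where "u = p x"
    have u: "u \<in> \<B>" unfolding u_def by (rule pball[OF x(1)])
    define v where "v = \<epsilon> *\<^sub>R (\<Sum>i<l. y i x *\<^sub>R M i u)"
    have v: "v = (\<Sum>i<l. (\<epsilon> * sqrt (k u) * y i x) *\<^sub>R w i u)"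
      by (simp add: v_def M_def scaleR_sum_right mult_ac)
    have "(norm v)\<^sup>2 = (\<epsilon> * sqrt (k u))\<^sup>2 * (\<Sum>i<l. (y i x)\<^sup>2)"
      unfolding v orthonormal_family_norm[OF on[OF u]] by (simp add: power_mult_distrib sum_distrib_left)
    also have "(\<epsilon> * sqrt (k u))\<^sup>2 = \<epsilon>\<^sup>2 * k u"
      using kpos[OF u] by (simp add: power_mult_distrib)
    also have "\<dots> * (\<Sum>i<l. (y i x)\<^sup>2) \<le> \<epsilon>\<^sup>2 * k u * (1 - (norm u)\<^sup>2)"
    proof (rule mult_left_mono)
      have "(norm x)\<^sup>2 \<le> 1" using x(1) by (simp add: abs_square_le_1)
      then show "(\<Sum>i<l. (y i x)\<^sup>2) \<le> 1 - (norm u)\<^sup>2" using norm[of x] by (simp add: u_def)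
      show "0 \<le> \<epsilon>\<^sup>2 * k u" using kpos[OF u] by simp
    qed
    finally have "(norm v)\<^sup>2 \<le> \<epsilon>\<^sup>2 * ((1 - (norm u)\<^sup>2) * k u)"
      by (simp add: mult_ac)
    moreover have "v \<in> span ((\<lambda>i. w i u) ` {..<l})"
      unfolding v by (intro span_sum span_scale span_base) auto
    moreover have "z = f u + v" by (simp add: x(2) G_def u_def v_def)
    ultimately show "z \<in> ?W" using u by blast
  next
    fix z assume "z \<in> ?W"
    then obtain u v where z: "z = f u + v" and u: "u \<in> \<B>" and v: "v \<in> span ((\<lambda>i. w i u) ` {..<l})"
        "(norm v)\<^sup>2 \<le> \<epsilon>\<^sup>2 * ((1 - (norm u)\<^sup>2) * k u)" by blast
    obtain c where c: "v = \<epsilon> *\<^sub>R (\<Sum>i<l. c i *\<^sub>R M i u)" "(\<Sum>i<l. (c i)\<^sup>2) \<le> 1 - (norm u)\<^sup>2"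
      using rep[OF u v] by blast
    obtain x where x: "p x = u" "\<And>i. i < l \<Longrightarrow> y i x = c i"
      using surj[of u c] by blast
    have "(norm x)\<^sup>2 \<le> 1" using norm[of x] c(2) x by simp
    then have "x \<in> \<B>" by (simp add: abs_square_le_1)
    moreover have "z = G x" using x by (simp add: G_def z c(1))
    ultimately show "z \<in> G ` \<B>" by blast
  qed
  moreover have "u = u'" if u: "u \<in> \<B>" and v: "v \<in> span ((\<lambda>i. w i u) ` {..<l})"
      "(norm v)\<^sup>2 \<le> \<epsilon>\<^sup>2 * ((1 - (norm u)\<^sup>2) * k u)"
    and u': "u' \<in> \<B>" and v': "v' \<in> span ((\<lambda>i. w i u') ` {..<l})"
      "(norm v')\<^sup>2 \<le> \<epsilon>\<^sup>2 * ((1 - (norm u')\<^sup>2) * k u')" and eq: "f u + v = f u' + v'" for u v u' v'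
  proof -
    have le1: "\<forall>i<l. \<bar>c i\<bar> \<le> 1" if "(\<Sum>i<l. (c i)\<^sup>2) \<le> 1 - (norm u)\<^sup>2" for c :: "nat \<Rightarrow> real" and u :: 'a
    proof (intro allI impI)
      fix i assume "i < l"
      then have "(c i)\<^sup>2 \<le> (\<Sum>i<l. (c i)\<^sup>2)" by (intro member_le_sum) auto
      also have "\<dots> \<le> 1" using that by (smt (verit) zero_le_power2)
      finally show "\<bar>c i\<bar> \<le> 1" by (simp add: abs_square_le_1)
    qed
    obtain c where c: "v = \<epsilon> *\<^sub>R (\<Sum>i<l. c i *\<^sub>R M i u)" "(\<Sum>i<l. (c i)\<^sup>2) \<le> 1 - (norm u)\<^sup>2"
      using rep[OF u v] by blast
    obtain c' where c': "v' = \<epsilon> *\<^sub>R (\<Sum>i<l. c' i *\<^sub>R M i u')" "(\<Sum>i<l. (c' i)\<^sup>2) \<le> 1 - (norm u')\<^sup>2"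
      using rep[OF u' v'] by blast
    show "u = u'"
      by (rule uniq[OF u u' le1[OF c(2)] le1[OF c'(2)] eq[unfolded c(1) c'(1)]])
  qed
  ultimately show ?thesis
    by (intro that[OF \<epsilon> G injG injDG])
qed

section \<open>Invariant disks of orthogonal actions\<close>

abbreviation A5 :: "(nat \<Rightarrow> nat) set" where
  "A5 \<equiv> carrier (alt_group 5)"

section \<open>The group and its orthogonal actions\<close>

lemma A5_closed: "g \<in> A5 \<Longrightarrow> h \<in> A5 \<Longrightarrow> g \<circ> h \<in> A5"
  using group.is_monoid[OF alt_group_is_group] monoid.m_closed[of "alt_group 5" g h]
  by (simp add: alt_group_mult)

lemma id_in_A5: "id \<in> A5"
  using monoid.one_closed[OF group.is_monoid[OF alt_group_is_group[of 5]]] by (simp add: alt_group_one)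

lemma A5_inverse:
  assumes "g \<in> A5"
  obtains g' where "g' \<in> A5" "g \<circ> g' = id" "g' \<circ> g = id"
proof
  show "inv_into UNIV g \<in> A5" using alt_group_inv_closed[OF assms] .
  have "g permutes {1..5}" using assms by (simp add: alt_group_carrier)
  then show "g \<circ> inv_into UNIV g = id" "inv_into UNIV g \<circ> g = id"
    by (rule permutes_inv_o)+
qed

lemma finite_A5: "finite A5"
proof -
  have "A5 \<subseteq> {p. p permutes {1..5}}" by (auto simp: alt_group_carrier)
  then show ?thesis by (rule finite_subset) (simp add: finite_permutations)
qed

text \<open>Replaces a homomorphism into the group of bijections by pointwise equations;
  orthogonality supplies the bijectivity.\<close>

lemma orthogonal_A5_action_iff:
  "orthogonal_A5_action \<rho> \<longleftrightarrow> (\<forall>g\<in>A5. orthogonal_transformation (\<rho> g)) \<and>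
    (\<forall>g\<in>A5. \<forall>h\<in>A5. \<forall>x. \<rho> (g \<circ> h) x = \<rho> g (\<rho> h x))"
proof
  assume "orthogonal_A5_action \<rho>"
  then show "(\<forall>g\<in>A5. orthogonal_transformation (\<rho> g)) \<and> (\<forall>g\<in>A5. \<forall>h\<in>A5. \<forall>x. \<rho> (g \<circ> h) x = \<rho> g (\<rho> h x))"
    unfolding orthogonal_A5_action_def
    using group_action.composition_rule[of "alt_group 5" UNIV \<rho>] by (simp add: alt_group_mult)
next
  assume a: "(\<forall>g\<in>A5. orthogonal_transformation (\<rho> g)) \<and> (\<forall>g\<in>A5. \<forall>h\<in>A5. \<forall>x. \<rho> (g \<circ> h) x = \<rho> g (\<rho> h x))"
  have bij: "\<rho> g \<in> Bij UNIV" if "g \<in> A5" for g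
    using a that orthogonal_transformation_bij by (auto simp: Bij_def)
  have "group_hom (alt_group 5) (BijGroup UNIV) \<rho>"
  proof (intro group_hom.intro alt_group_is_group group_BijGroup group_hom_axioms.intro homI)
    show "\<rho> g \<in> carrier (BijGroup UNIV)" if "g \<in> A5" for g
      using bij[OF that] by (simp add: BijGroup_def)
    show "\<rho> (g \<otimes>\<^bsub>alt_group 5\<^esub> h) = \<rho> g \<otimes>\<^bsub>BijGroup UNIV\<^esub> \<rho> h" if "g \<in> A5" "h \<in> A5" for g h
      using a bij that by (simp add: BijGroup_def alt_group_mult compose_def fun_eq_iff)
  qed
  then show "orthogonal_A5_action \<rho>"
    unfolding orthogonal_A5_action_def group_action_def using a by blast
qed

text \<open>The composition law makes \<open>\<rho> id\<close> idempotent, and an injective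
  idempotent map is the identity.\<close>

lemma orthogonal_A5_action_id:
  assumes "orthogonal_A5_action \<rho>" shows "\<rho> id x = x"
proof -
  have "inj (\<rho> id)" and "\<rho> id (\<rho> id x) = \<rho> id x"
    using assms id_in_A5 orthogonal_transformation_inj unfolding orthogonal_A5_action_iff by (metis comp_id)+
  then show ?thesis by (simp only: inj_eq)
qed

lemma orthogonal_A5_action_inverse:
  assumes "orthogonal_A5_action \<rho>" "g \<in> A5"
  obtains g' where "g' \<in> A5" "\<And>x. \<rho> g' (\<rho> g x) = x" "\<And>x. \<rho> g (\<rho> g' x) = x"
proof -
  obtain g' where g': "g' \<in> A5" "g \<circ> g' = id" "g' \<circ> g = id"
    by (rule A5_inverse[OF assms(2)]) (rule that)
  have "\<rho> g' (\<rho> g x) = \<rho> (g' \<circ> g) x" "\<rho> g (\<rho> g' x) = \<rho> (g \<circ> g') x" for x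
    using assms g'(1) unfolding orthogonal_A5_action_iff by auto
  then show ?thesis
    using that[OF g'(1)] by (simp add: g'(2,3) orthogonal_A5_action_id[OF assms(1)])
qed

text \<open>By invariance of domain \<psi> takes the open ball to an open subset of the closed ball,
  hence into the open ball. If \<open>\<phi> x\<close> were interior, so would be
  \<open>x = \<psi> (\<phi> x)\<close>.\<close>

lemma injective_self_map_cball_sphere:
  fixes \<phi> \<psi> :: "'a::euclidean_space \<Rightarrow> 'a"
  assumes "continuous_on \<B> \<psi>" "\<And>x. x \<in> \<B> \<Longrightarrow> \<phi> x \<in> \<B>"
    "\<And>x. x \<in> \<B> \<Longrightarrow> \<psi> x \<in> \<B>"
    "\<And>x. x \<in> \<B> \<Longrightarrow> \<psi> (\<phi> x) = x" "\<And>x. x \<in> \<B> \<Longrightarrow> \<phi> (\<psi> x) = x" "norm x = 1"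
  shows "norm (\<phi> x) = 1"
proof (rule ccontr)
  assume "norm (\<phi> x) \<noteq> 1"
  moreover have "\<phi> x \<in> \<B>" using assms(2)[of x] assms(6) by simp
  ultimately have in_ball: "\<phi> x \<in> ball 0 1" by simp
  have "inj_on \<psi> (ball 0 1)"
    by (rule inj_on_inverseI[where g=\<phi>]) (use assms(5) in auto)
  then have "open (\<psi> ` ball 0 1)"
    by (intro invariance_of_domain continuous_on_subset[OF assms(1)]) auto
  moreover have "\<psi> ` ball 0 1 \<subseteq> \<B>" using assms(3) by (force simp del: mem_cball)
  ultimately have "\<psi> ` ball 0 1 \<subseteq> interior \<B>" by (rule interior_maximal[rotated])
  then have "\<psi> ` ball 0 1 \<subseteq> ball 0 1" by (simp only: interior_cball)
  then have "\<psi> (\<phi> x) \<in> ball 0 1" using in_ball by blast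
  then show False using assms(4)[of x] assms(6) by simp
qed

text \<open>
  The invariant function \<open>\<Sum>g\<in>A5. 1 - (norm (\<phi> g u))\<^sup>2\<close>, divided by \<open>1 - (norm u)\<^sup>2\<close>, gives the
  squared radius of the fibres; the quotient is at least \<open>1\<close> because of the summand \<open>g = id\<close>.
\<close>

lemma invariant_disk_bundle:
  fixes f :: "'a::euclidean_space \<Rightarrow> real^'m" and \<rho> :: "(nat \<Rightarrow> nat) \<Rightarrow> real^'m \<Rightarrow> real^'m"
  assumes f: "smooth_on_cball f" and inj: "inj_on f \<B>"
    and injD: "\<And>x. x \<in> \<B> \<Longrightarrow> inj (D_cball f x)"
    and act: "orthogonal_A5_action \<rho>" and invar: "A5_invariant \<rho> (f ` \<B>)"
    and free: "A5_fixed_point_free \<rho> (f ` \<B>)"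
    and w: "\<And>i. i < l \<Longrightarrow> smooth_on_cball (w i)"
    and on: "\<And>x. x \<in> \<B> \<Longrightarrow> orthonormal_family l (\<lambda>i. w i x)"
    and normal: "\<And>x a i. x \<in> \<B> \<Longrightarrow> i < l \<Longrightarrow> D_cball f x a \<bullet> w i x = 0"
    and equiv: "\<And>g u u' i. g \<in> A5 \<Longrightarrow> u \<in> \<B> \<Longrightarrow> u' \<in> \<B> \<Longrightarrow> \<rho> g (f u) = f u' \<Longrightarrow> i < l \<Longrightarrow>
      \<rho> g (w i u) \<in> span ((\<lambda>i. w i u') ` {..<l})"
    and card: "DIM('a) + l = CARD('n)"
  shows "\<exists>W. smoothly_embedded_disk TYPE('n::finite) W \<and> A5_invariant \<rho> W \<and> A5_fixed_point_free \<rho> W \<and>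
    W \<in> disk_submanifolds (int CARD('n)) - disk_submanifolds (int CARD('n) - 1)"
proof -
  have orth: "orthogonal_transformation (\<rho> g)" and lin: "linear (\<rho> g)" if "g \<in> A5" for g
    using act that orthogonal_transformation_linear unfolding orthogonal_A5_action_iff by blast+
  have comp: "\<rho> (g \<circ> h) x = \<rho> g (\<rho> h x)" if "g \<in> A5" "h \<in> A5" for g h x
    using act that unfolding orthogonal_A5_action_iff by blast
  \<comment> \<open>The action on the disk, read in the parameter ball.\<close>
  define \<phi> where "\<phi> g u = inv_into \<B> f (\<rho> g (f u))" for g u
  have \<rho>f: "\<rho> g (f u) \<in> f ` \<B>" if "g \<in> A5" "u \<in> \<B>" for g u
    using invar that unfolding A5_invariant_def by blast
  have \<phi>: "\<phi> g u \<in> \<B>" "f (\<phi> g u) = \<rho> g (f u)" if "g \<in> A5" "u \<in> \<B>" for g u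
    using \<rho>f[OF that] unfolding \<phi>_def by (rule inv_into_into, rule f_inv_into_f)
  have \<phi>comp: "\<phi> (g \<circ> h) u = \<phi> g (\<phi> h u)" if "g \<in> A5" "h \<in> A5" "u \<in> \<B>" for g h u
    by (rule inj_onD[OF inj]) (simp_all only: that A5_closed \<phi> comp)
  have \<phi>id: "\<phi> id u = u" if "u \<in> \<B>" for u
    by (rule inj_onD[OF inj]) (simp_all only: that id_in_A5 \<phi> orthogonal_A5_action_id[OF act])
  have s\<phi>: "smooth_on_cball (\<phi> g)" if g: "g \<in> A5" for g
  proof -
    have "smooth_on_cball (\<lambda>u. \<rho> g (f u))"
      by (rule Ck_map_on_compose[OF f Ck_map_on_linear[OF lin[OF g]], of UNIV]) simp
    then show ?thesis
      unfolding \<phi>_def using \<rho>f[OF g]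
      by (intro Ck_map_on_compose[OF _ Ck_map_on_inv_into_cball[OF f inj injD]]) blast+
  qed
  have sphere: "norm (\<phi> g x) = 1" if g: "g \<in> A5" and x: "norm x = 1" for g x
  proof -
    obtain g' where g': "g' \<in> A5" "g \<circ> g' = id" "g' \<circ> g = id"
      by (rule A5_inverse[OF g]) (rule that)
    have "\<phi> g' (\<phi> g u) = u" "\<phi> g (\<phi> g' u) = u" if "u \<in> \<B>" for u
      using \<phi>comp[OF g'(1) g that] \<phi>comp[OF g g'(1) that] \<phi>id[OF that] by (simp_all add: g'(2,3))
    then show ?thesis
      by (intro injective_self_map_cball_sphere[OF Ck_map_on_continuous[OF s\<phi>[OF g'(1)]] \<phi>(1)[OF g] \<phi>(1)[OF g'(1)] _ _ x])
  qed
  define quo where "quo g q \<longleftrightarrow> smooth_on_cball q \<and>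
    (\<forall>u\<in>\<B>. 1 - (norm (\<phi> g u))\<^sup>2 = (1 - (norm u)\<^sup>2) * q u)" for g q
  have "\<exists>q. quo g q" if g: "g \<in> A5" for g
  proof -
    have E: "smooth_on_cball (\<lambda>u. 1 - (norm (\<phi> g u))\<^sup>2)"
      unfolding power2_norm_eq_inner
      by (rule Ck_map_on_diff[OF Ck_map_on_const Ck_map_on_inner[OF s\<phi>[OF g] s\<phi>[OF g]]])
    have E0: "1 - (norm (\<phi> g x))\<^sup>2 = 0" if "norm x = 1" for x
      using sphere[OF g that] by simp
    show ?thesis
      by (rule smooth_division_cball[OF E E0], assumption) (auto simp: quo_def)
  qed
  then obtain q where q: "\<And>g. g \<in> A5 \<Longrightarrow> quo g (q g)" by metis
  define k where "k u = (\<Sum>g\<in>A5. q g u)" for u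
  define h where "h u = (\<Sum>g\<in>A5. 1 - (norm (\<phi> g u))\<^sup>2)" for u
  have k: "smooth_on_cball k"
    unfolding k_def by (rule Ck_map_on_sum) (use q in \<open>simp add: quo_def\<close>)
  have hk: "h u = (1 - (norm u)\<^sup>2) * k u" if "u \<in> \<B>" for u
    unfolding h_def k_def sum_distrib_left using q that by (intro sum.cong) (auto simp: quo_def)
  \<comment> \<open>On the open ball the bound results from cancelling 1 - |u|^2; on the sphere it
    follows by continuity.\<close>
  have k1: "k u \<ge> 1" if "u \<in> \<B>" for u
  proof -
    have "k u \<ge> 1" if u: "u \<in> ball 0 1" for u
    proof -
      have uc: "u \<in> \<B>" using u by simp
      have "1 - (norm (\<phi> id u))\<^sup>2 \<le> h u"
        unfolding h_def
      proof (rule member_le_sum[OF id_in_A5 _ finite_A5])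
        fix g assume "g \<in> A5 - {id}"
        then have "norm (\<phi> g u) \<le> 1" using \<phi>(1)[of g u] uc by simp
        then show "0 \<le> 1 - (norm (\<phi> g u))\<^sup>2" by (simp add: abs_square_le_1)
      qed
      then have "(1 - (norm u)\<^sup>2) * 1 \<le> (1 - (norm u)\<^sup>2) * k u"
        using hk[OF uc] \<phi>id[OF uc] by simp
      moreover have "1 - (norm u)\<^sup>2 > 0" using u by (simp add: abs_square_less_1)
      ultimately show ?thesis by (simp only: mult_le_cancel_left_pos)
    qed
    moreover have "closure (ball (0::'a) 1) = \<B>" by simp
    ultimately show ?thesis
      using continuous_ge_on_closure[of "ball 0 1" k u 1] Ck_map_on_continuous[OF k] that by simp
  qed
  have kpos: "k u > 0" if "u \<in> \<B>" for u
    using k1[OF that] by simp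
  \<comment> \<open>Right translation by \<open>g\<close> permutes the summands.\<close>
  have h\<phi>: "h (\<phi> g u) = h u" if g: "g \<in> A5" and u: "u \<in> \<B>" for g u
  proof -
    obtain g' where g': "g' \<in> A5" "g \<circ> g' = id" "g' \<circ> g = id"
      by (rule A5_inverse[OF g]) (rule that)
    show ?thesis
      unfolding h_def
    proof (rule sum.reindex_bij_witness[of _ "\<lambda>x. x \<circ> g'" "\<lambda>x. x \<circ> g"])
      fix x assume x: "x \<in> A5"
      show "x \<circ> g \<circ> g' = x" "x \<circ> g' \<circ> g = x" using g'(2,3) by (simp_all add: comp_assoc)
      show "x \<circ> g \<in> A5" "x \<circ> g' \<in> A5" using x g g'(1) by (simp_all add: A5_closed)
      show "1 - (norm (\<phi> (x \<circ> g) u))\<^sup>2 = 1 - (norm (\<phi> x (\<phi> g u)))\<^sup>2"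
        using \<phi>comp[OF x g u] by simp
    qed
  qed
  obtain G :: "real^'n \<Rightarrow> real^'m" and \<epsilon> where \<epsilon>: "\<epsilon> > 0" and G: "smooth_on_cball G" "inj_on G \<B>"
    "\<And>x. x \<in> \<B> \<Longrightarrow> inj (D_cball G x)"
    and im: "G ` \<B> = {f u + v | u v. u \<in> \<B> \<and> v \<in> span ((\<lambda>i. w i u) ` {..<l}) \<and>
      (norm v)\<^sup>2 \<le> \<epsilon>\<^sup>2 * ((1 - (norm u)\<^sup>2) * k u)}"
    and uniq: "\<And>u v u' v'. u \<in> \<B> \<Longrightarrow> v \<in> span ((\<lambda>i. w i u) ` {..<l}) \<Longrightarrow>
      (norm v)\<^sup>2 \<le> \<epsilon>\<^sup>2 * ((1 - (norm u)\<^sup>2) * k u) \<Longrightarrow>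
      u' \<in> \<B> \<Longrightarrow> v' \<in> span ((\<lambda>i. w i u') ` {..<l}) \<Longrightarrow>
      (norm v')\<^sup>2 \<le> \<epsilon>\<^sup>2 * ((1 - (norm u')\<^sup>2) * k u') \<Longrightarrow> f u + v = f u' + v' \<Longrightarrow> u = u'"
    by (rule disk_bundle_embedding[OF f inj injD w on normal k kpos card], assumption+) (rule that)
  define W where "W = G ` \<B>"
  \<comment> \<open>The pair (u, v) goes to \<open>(\<phi> g u, \<rho> g v)\<close>: the spans
    correspond by \<open>equiv\<close>, and the radius is governed by the invariant function
    \<open>h\<close>.\<close>
  have move: "\<rho> g v \<in> span ((\<lambda>i. w i (\<phi> g u)) ` {..<l})"
      "(norm (\<rho> g v))\<^sup>2 \<le> \<epsilon>\<^sup>2 * ((1 - (norm (\<phi> g u))\<^sup>2) * k (\<phi> g u))"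
    if g: "g \<in> A5" and u: "u \<in> \<B>" and v: "v \<in> span ((\<lambda>i. w i u) ` {..<l})"
      "(norm v)\<^sup>2 \<le> \<epsilon>\<^sup>2 * ((1 - (norm u)\<^sup>2) * k u)" for g u v
  proof -
    have "\<rho> g ` span ((\<lambda>i. w i u) ` {..<l}) = span (\<rho> g ` (\<lambda>i. w i u) ` {..<l})"
      by (rule span_linear_image[OF lin[OF g], symmetric])
    also have "\<dots> \<subseteq> span ((\<lambda>i. w i (\<phi> g u)) ` {..<l})"
      using equiv[OF g u \<phi>(1)[OF g u]] \<phi>(2)[OF g u] by (intro span_minimal subspace_span) auto
    finally show "\<rho> g v \<in> span ((\<lambda>i. w i (\<phi> g u)) ` {..<l})" using v(1) by blast
    have "norm (\<rho> g v) = norm v"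
      using orth[OF g] by (simp add: orthogonal_transformation)
    then show "(norm (\<rho> g v))\<^sup>2 \<le> \<epsilon>\<^sup>2 * ((1 - (norm (\<phi> g u))\<^sup>2) * k (\<phi> g u))"
      using v(2) h\<phi>[OF g u] by (simp add: hk[OF u] hk[OF \<phi>(1)[OF g u]])
  qed
  have sub: "\<rho> g ` W \<subseteq> W" if g: "g \<in> A5" for g
  proof
    fix z assume "z \<in> \<rho> g ` W"
    then obtain u v where u: "u \<in> \<B>" and v: "v \<in> span ((\<lambda>i. w i u) ` {..<l})"
      "(norm v)\<^sup>2 \<le> \<epsilon>\<^sup>2 * ((1 - (norm u)\<^sup>2) * k u)" and z: "z = \<rho> g (f u + v)"
      unfolding W_def im by blast
    have "z = f (\<phi> g u) + \<rho> g v"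
      by (simp add: z linear_add[OF lin[OF g]] \<phi>(2)[OF g u])
    then show "z \<in> W"
      unfolding W_def im using \<phi>(1)[OF g u] move[OF g u v] by blast
  qed
  have "A5_invariant \<rho> W"
    unfolding A5_invariant_def
  proof (intro ballI equalityI sub)
    fix g assume g: "g \<in> A5"
    obtain g' where g': "g' \<in> A5" "\<And>x. \<rho> g' (\<rho> g x) = x" "\<And>x. \<rho> g (\<rho> g' x) = x"
      by (rule orthogonal_A5_action_inverse[OF act g]) (rule that)
    show "W \<subseteq> \<rho> g ` W"
    proof
      fix z assume "z \<in> W"
      then have "\<rho> g' z \<in> W" using sub[OF g'(1)] by blast
      then show "z \<in> \<rho> g ` W" using g'(3)[of z] by (metis imageI)
    qed
  qed
  moreover have "A5_fixed_point_free \<rho> W"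
    unfolding A5_fixed_point_free_def
  proof
    assume "\<exists>x\<in>W. \<forall>g\<in>A5. \<rho> g x = x"
    then obtain u v where u: "u \<in> \<B>" and v: "v \<in> span ((\<lambda>i. w i u) ` {..<l})"
      "(norm v)\<^sup>2 \<le> \<epsilon>\<^sup>2 * ((1 - (norm u)\<^sup>2) * k u)" and fix': "\<forall>g\<in>A5. \<rho> g (f u + v) = f u + v"
      unfolding W_def im by blast
    have "\<rho> g (f u) = f u" if g: "g \<in> A5" for g
    proof -
      have "f (\<phi> g u) + \<rho> g v = f u + v"
        using bspec[OF fix' g] unfolding linear_add[OF lin[OF g]] \<phi>(2)[OF g u] .
      then have "\<phi> g u = u"
        by (rule uniq[OF \<phi>(1)[OF g u] move[OF g u v] u v])
      then show ?thesis using \<phi>(2)[OF g u] by simp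
    qed
    then show False
      using free u unfolding A5_fixed_point_free_def by blast
  qed
  moreover have "smoothly_embedded_disk TYPE('n) W"
  proof -
    have "\<exists>g. homeomorphism \<B> (G ` \<B>) G g"
      using homeomorphism_compact[OF compact_cball Ck_map_on_continuous[OF G(1)] refl G(2)] by blast
    moreover have "inj_on (D_cball G x) (tangent_space \<B> x)"
      if "x \<in> \<B>" for x
      using G(3)[OF that] by (rule inj_on_subset) simp
    ultimately have "Ck_embedding \<infinity> \<B> G"
      unfolding Ck_embedding_def using G(1) by blast
    then show ?thesis
      unfolding smoothly_embedded_disk_def W_def by blast
  qed
  moreover have "W \<in> disk_submanifolds (int CARD('n)) - disk_submanifolds (int CARD('n) - 1)"
    unfolding W_def by (rule image_cball_in_disk_submanifolds[OF G])
  ultimately show ?thesis by blast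
qed

text \<open>With g' inverse to \<open>g\<close>, the maps \<open>\<rho> g' \<circ> f\<close> and
  \<open>f \<circ> \<psi>\<close> agree on the ball. By the chain rule \<open>\<rho> g'\<close>
  takes tangent vectors at \<open>f u'\<close> to tangent vectors at \<open>f u\<close>; by
  orthogonality \<open>\<rho> g\<close> takes normal vectors to normal vectors.\<close>

lemma normal_space_equivariant:
  fixes f :: "'a::euclidean_space \<Rightarrow> real^'m" and \<rho> :: "(nat \<Rightarrow> nat) \<Rightarrow> real^'m \<Rightarrow> real^'m"
  assumes f: "smooth_on_cball f" and inj: "inj_on f \<B>"
    and injD: "\<And>x. x \<in> \<B> \<Longrightarrow> inj (D_cball f x)"
    and act: "orthogonal_A5_action \<rho>" and invar: "A5_invariant \<rho> (f ` \<B>)"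
    and g: "g \<in> A5" and u: "u \<in> \<B>" "u' \<in> \<B>" "\<rho> g (f u) = f u'"
    and v: "\<And>a. D_cball f u a \<bullet> v = 0"
  shows "D_cball f u' a \<bullet> \<rho> g v = 0"
proof -
  obtain g' where g': "g' \<in> A5" "\<And>x. \<rho> g' (\<rho> g x) = x" "\<And>x. \<rho> g (\<rho> g' x) = x"
    by (rule orthogonal_A5_action_inverse[OF act g]) (rule that)
  have orth: "orthogonal_transformation (\<rho> g')"
    using act g'(1) unfolding orthogonal_A5_action_iff by blast
  then have lin: "linear (\<rho> g')" by (rule orthogonal_transformation_linear)
  define \<psi> where "\<psi> x = inv_into \<B> f (\<rho> g' (f x))" for x
  have \<rho>f: "\<rho> g' (f x) \<in> f ` \<B>" if "x \<in> \<B>" for x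
    using invar g'(1) that unfolding A5_invariant_def by blast
  have f\<psi>: "\<psi> x \<in> \<B>" "f (\<psi> x) = \<rho> g' (f x)" if "x \<in> \<B>" for x
    using \<rho>f[OF that] unfolding \<psi>_def by (rule inv_into_into, rule f_inv_into_f)
  have s\<rho>f: "smooth_on_cball (\<lambda>x. \<rho> g' (f x))"
    by (rule Ck_map_on_compose[OF f Ck_map_on_linear[OF lin], of UNIV]) simp
  have "smooth_on_cball \<psi>"
    unfolding \<psi>_def using \<rho>f by (intro Ck_map_on_compose[OF s\<rho>f Ck_map_on_inv_into_cball[OF f inj injD]]) blast+
  note \<psi>D = Ck_map_on_cball_derivative(1)[OF this u(2)]
  have \<psi>u: "\<psi> u' = u"
    by (rule inj_onD[OF inj _ f\<psi>(1)[OF u(2)] u(1)]) (simp add: f\<psi>(2)[OF u(2)] u(3)[symmetric] g'(2))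
  note fD = Ck_map_on_cball_derivative(1)[OF f]
  let ?D = "\<lambda>x. D_cball f x" and ?D\<psi> = "D_cball \<psi> u'"
  have "(f has_derivative ?D u) (at (\<psi> u') within \<psi> ` \<B>)"
    unfolding \<psi>u using f\<psi>(1) by (intro has_derivative_subset[OF fD[OF u(1)]]) blast
  from has_derivative_in_compose[OF \<psi>D this]
  have "((\<lambda>x. f (\<psi> x)) has_derivative (\<lambda>a. ?D u (?D\<psi> a))) (at u' within \<B>)" .
  then have "((\<lambda>x. \<rho> g' (f x)) has_derivative (\<lambda>a. ?D u (?D\<psi> a))) (at u' within \<B>)"
    by (rule has_derivative_transform[OF u(2), rotated]) (simp add: f\<psi>(2))
  moreover have "((\<lambda>x. \<rho> g' (f x)) has_derivative (\<lambda>a. \<rho> g' (?D u' a))) (at u' within \<B>)"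
    using lin by (intro bounded_linear.has_derivative[OF _ fD[OF u(2)]]) (simp add: linear_conv_bounded_linear)
  ultimately have eq: "\<rho> g' (?D u' a) = ?D u (?D\<psi> a)"
    using frechet_derivative_cball_eq[OF u(2)] by metis
  have "?D u' a \<bullet> \<rho> g v = \<rho> g' (?D u' a) \<bullet> \<rho> g' (\<rho> g v)"
    using orth by (simp add: orthogonal_transformation_def)
  then show ?thesis by (simp add: eq g'(2) v)
qed

text \<open>The \<open>z i\<close> form an orthonormal basis of the complement of the range; they
  become the directions on which the group acts trivially.\<close>

lemma isometric_embedding_complement:
  assumes "CARD('r::finite) \<le> CARD('m::finite)"
  obtains J :: "real^'r \<Rightarrow> real^'m" and z :: "nat \<Rightarrow> real^'m" where "linear J" "\<And>x y. J x \<bullet> J y = x \<bullet> y"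
    "orthonormal_family (CARD('m) - CARD('r)) z" "\<And>i x. i < CARD('m) - CARD('r) \<Longrightarrow> J x \<bullet> z i = 0"
proof -
  have "dim (UNIV :: (real^'r) set) \<le> dim (UNIV :: (real^'m) set)"
    using assms by (simp add: dim_UNIV)
  then obtain J :: "real^'r \<Rightarrow> real^'m" where J: "linear J" "\<And>x. norm (J x) = norm x"
    using isometry_subset_subspace[OF subspace_UNIV subspace_UNIV] by (metis UNIV_I)
  have inner: "J x \<bullet> J y = x \<bullet> y" for x y
    using J by (simp add: dot_norm flip: linear_add)
  define N where "N = {v. \<forall>x. J x \<bullet> v = 0}"
  have sub: "subspace (range J)" using J(1) linear_subspace_image subspace_UNIV by blast
  have "inj J" using J(2) by (metis J(1) linear_injective_0 norm_eq_zero)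
  then have "dim (range J) = CARD('r)"
    using dim_image_eq[OF J(1), of UNIV] by (simp add: dim_UNIV)
  moreover have "{y \<in> UNIV. \<forall>x\<in>range J. orthogonal x y} = N"
    by (auto simp: N_def orthogonal_def)
  ultimately have dimN: "dim N = CARD('m) - CARD('r)"
    using dim_subspace_orthogonal_to_vectors[OF sub subspace_UNIV subset_UNIV] by (simp add: dim_UNIV)
  have "subspace N" unfolding N_def by (rule subspaceI) (simp_all add: inner_add_right)
  then obtain z where "orthonormal_family (CARD('m) - CARD('r)) z" "\<And>i. i < CARD('m) - CARD('r) \<Longrightarrow> z i \<in> N"
    using orthonormal_family_subspace dimN by metis
  then show ?thesis using that[OF J(1) inner] unfolding N_def by blast
qed

text \<open>The adjoint of an isometric \<open>J\<close> is a left inverse, and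
  \<open>J \<circ> P\<close> is the orthogonal projection onto the range. The new action is \<rho>
  there and trivial on the complement.\<close>

lemma extended_orthogonal_A5_action:
  fixes J :: "real^'r \<Rightarrow> real^'m"
  assumes J: "linear J" "\<And>x y. J x \<bullet> J y = x \<bullet> y" and act: "orthogonal_A5_action \<rho>"
  obtains \<rho>' where "orthogonal_A5_action \<rho>'" "\<And>g x. g \<in> A5 \<Longrightarrow> \<rho>' g (J x) = J (\<rho> g x)"
    "\<And>g v. g \<in> A5 \<Longrightarrow> \<forall>x. J x \<bullet> v = 0 \<Longrightarrow> \<rho>' g v = v"
proof -
  define P where "P = adjoint J"
  have linP: "linear P" unfolding P_def by (rule adjoint_linear[OF J(1)])
  have PJ: "P (J x) = x" for x
  proof -
    have "y \<bullet> P (J x) = y \<bullet> x" for y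
      using adjoint_works[OF J(1), of y "J x"] J(2)[of y x] unfolding P_def by simp
    then show ?thesis using vector_eq_ldot[of "P (J x)" x] by blast
  qed
  have JP: "J x \<bullet> (v - J (P v)) = 0" for x v
    using adjoint_works[OF J(1), of x v] by (simp add: inner_diff_right J(2) P_def inner_commute)
  have lin\<rho>: "linear (\<rho> g)" and orth\<rho>: "orthogonal_transformation (\<rho> g)" if "g \<in> A5" for g
    using act that orthogonal_transformation_linear unfolding orthogonal_A5_action_iff by blast+
  define \<rho>' where "\<rho>' g v = J (\<rho> g (P v)) + (v - J (P v))" for g v
  have "orthogonal_A5_action \<rho>'"
    unfolding orthogonal_A5_action_iff
  proof (intro conjI ballI allI)
    fix g assume g: "g \<in> A5"
    have "linear (\<rho>' g)"
      unfolding \<rho>'_def using lin\<rho>[OF g] linP J(1)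
      by (intro linear_compose_add linear_compose_sub linear_id[unfolded id_def])
        (auto intro: linear_compose[unfolded o_def])
    moreover have "norm (\<rho>' g v) = norm v" for v
    proof -
      have split: "(norm (J x + (v - J (P v))))\<^sup>2 = (norm x)\<^sup>2 + (norm (v - J (P v)))\<^sup>2" for x
        using JP[of x v] J(2)[of x x] by (simp add: power2_norm_eq_inner inner_add inner_commute)
      have "(norm (\<rho>' g v))\<^sup>2 = (norm (P v))\<^sup>2 + (norm (v - J (P v)))\<^sup>2"
        unfolding \<rho>'_def split using orth\<rho>[OF g] by (simp add: orthogonal_transformation)
      also have "\<dots> = (norm v)\<^sup>2"
        using split[of "P v"] by simp
      finally show ?thesis by (simp add: power2_eq_iff_nonneg)
    qed
    ultimately show "orthogonal_transformation (\<rho>' g)"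
      unfolding orthogonal_transformation by blast
  next
    fix g h v assume gh: "g \<in> A5" "h \<in> A5"
    have "P (\<rho>' h v) = \<rho> h (P v)"
      by (simp add: \<rho>'_def linear_add[OF linP] linear_diff[OF linP] PJ)
    then have "\<rho>' g (\<rho>' h v) = J (\<rho> g (\<rho> h (P v))) + (\<rho>' h v - J (\<rho> h (P v)))"
      unfolding \<rho>'_def[of g] by simp
    also have "\<dots> = J (\<rho> g (\<rho> h (P v))) + (v - J (P v))"
      unfolding \<rho>'_def by simp
    also have "\<rho> g (\<rho> h (P v)) = \<rho> (g \<circ> h) (P v)"
      using act gh unfolding orthogonal_A5_action_iff by simp
    finally show "\<rho>' (g \<circ> h) v = \<rho>' g (\<rho>' h v)"
      unfolding \<rho>'_def[of "g \<circ> h"] by simp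
  qed
  moreover have "\<rho>' g (J x) = J (\<rho> g x)" for g x
    by (simp add: \<rho>'_def PJ)
  moreover have "\<rho>' g v = v" if g: "g \<in> A5" and v: "\<forall>x. J x \<bullet> v = 0" for g v
  proof -
    have "y \<bullet> P v = y \<bullet> 0" for y
      using adjoint_works[OF J(1), of y v] v unfolding P_def by simp
    then have "P v = 0" using vector_eq_ldot[of "P v" 0] by blast
    then show ?thesis
      by (simp add: \<rho>'_def linear_0[OF lin\<rho>[OF g]] linear_0[OF J(1)])
  qed
  ultimately show ?thesis using that by blast
qed

text \<open>The inequalities are written with sums because subtraction of natural numbers truncates.
  In the first case n - d of the m - r trivial directions form the bundle; in the second the normal
  bundle in R^r contributes r - d directions, and n - r trivial ones are added.\<close>

lemma fixed_point_free_disk: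
  fixes \<rho> :: "(nat \<Rightarrow> nat) \<Rightarrow> real^'r \<Rightarrow> real^'r"
  assumes act: "orthogonal_A5_action \<rho>" and disk: "smoothly_embedded_disk TYPE('d::finite) D"
    and invar: "A5_invariant \<rho> D" and free: "A5_fixed_point_free \<rho> D"
    and dims: "CARD('d) \<le> CARD('n) \<and> CARD('n) + CARD('r) \<le> CARD('m) + CARD('d) \<and> CARD('r) \<le> CARD('m) \<or>
      CARD('r) \<le> CARD('n) \<and> CARD('n) \<le> CARD('m)"
  shows "\<exists>(\<rho>' :: (nat \<Rightarrow> nat) \<Rightarrow> real^'m \<Rightarrow> real^'m) W. orthogonal_A5_action \<rho>' \<and> smoothly_embedded_disk TYPE('n::finite) W \<and>
    A5_invariant \<rho>' W \<and> A5_fixed_point_free \<rho>' W \<and>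
    W \<in> disk_submanifolds (int CARD('n)) - disk_submanifolds (int CARD('n) - 1)"
proof -
  obtain f :: "real^'d \<Rightarrow> real^'r" where emb: "Ck_embedding \<infinity> \<B> f" and D: "D = f ` \<B>"
    using disk unfolding smoothly_embedded_disk_def by blast
  have f: "smooth_on_cball f" using emb by (simp add: Ck_embedding_def)
  obtain g where "homeomorphism \<B> (f ` \<B>) f g"
    using emb unfolding Ck_embedding_def by blast
  then have inj: "inj_on f \<B>"
    using homeomorphism_apply1 by (intro inj_on_inverseI[where g=g]) blast
  have injD: "inj (D_cball f x)" if "x \<in> \<B>" for x
    using emb that tangent_space_cball[OF that] unfolding Ck_embedding_def by metis
  have rm: "CARD('r) \<le> CARD('m)" using dims by linarith
  obtain J :: "real^'r \<Rightarrow> real^'m" and z where J: "linear J" "\<And>x y. J x \<bullet> J y = x \<bullet> y"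
    and z: "orthonormal_family (CARD('m) - CARD('r)) z" "\<And>i x. i < CARD('m) - CARD('r) \<Longrightarrow> J x \<bullet> z i = 0"
    by (rule isometric_embedding_complement[OF rm]) (rule that)
  obtain \<rho>' where \<rho>': "orthogonal_A5_action \<rho>'" "\<And>g x. g \<in> A5 \<Longrightarrow> \<rho>' g (J x) = J (\<rho> g x)"
    "\<And>g v. g \<in> A5 \<Longrightarrow> \<forall>x. J x \<bullet> v = 0 \<Longrightarrow> \<rho>' g v = v"
    by (rule extended_orthogonal_A5_action[OF J act]) (rule that)
  have Jeq: "J x = J y \<longleftrightarrow> x = y" for x y
    using J(2)[of "x - y" "x - y"] by (auto simp: linear_diff[OF J(1)])
  define F where "F x = J (f x)" for x
  have F: "smooth_on_cball F"
    unfolding F_def by (rule Ck_map_on_compose[OF f Ck_map_on_linear[OF J(1)], of UNIV]) simp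
  have injF: "inj_on F \<B>"
    using inj by (simp add: F_def inj_on_def Jeq)
  have FD: "D_cball F x = (\<lambda>a. J (D_cball f x a))"
    if x: "x \<in> \<B>" for x
    unfolding F_def using J(1)
    by (intro frechet_derivative_cball_eq[OF x] bounded_linear.has_derivative[OF _ Ck_map_on_cball_derivative(1)[OF f x]])
      (simp add: linear_conv_bounded_linear)
  have injFD: "inj (D_cball F x)" if x: "x \<in> \<B>" for x
    unfolding FD[OF x] using injD[OF x] by (simp add: inj_def Jeq)
  have F\<rho>: "\<rho>' g (F x) = J (\<rho> g (f x))" if "g \<in> A5" for g x
    unfolding F_def by (rule \<rho>'(2)[OF that])
  have invarF: "A5_invariant \<rho>' (F ` \<B>)"
    unfolding A5_invariant_def
  proof
    fix g assume g: "g \<in> A5"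
    have "\<rho>' g ` F ` \<B> = J ` \<rho> g ` f ` \<B>"
      by (simp add: image_image F\<rho>[OF g])
    also have "\<rho> g ` f ` \<B> = f ` \<B>"
      using invar g unfolding A5_invariant_def D by blast
    finally show "\<rho>' g ` F ` \<B> = F ` \<B>"
      by (simp add: image_image F_def)
  qed
  have freeF: "A5_fixed_point_free \<rho>' (F ` \<B>)"
    using free unfolding A5_fixed_point_free_def D by (auto simp: F\<rho>) (auto simp: F_def Jeq)
  have zfix: "\<rho>' g (z i) = z i" if "g \<in> A5" "i < CARD('m) - CARD('r)" for g i
    using \<rho>'(3)[OF that(1)] z(2)[OF that(2)] by blast
  have "\<exists>W. smoothly_embedded_disk TYPE('n) W \<and> A5_invariant \<rho>' W \<and> A5_fixed_point_free \<rho>' W \<and>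
    W \<in> disk_submanifolds (int CARD('n)) - disk_submanifolds (int CARD('n) - 1)"
    using dims
  proof
    assume d: "CARD('d) \<le> CARD('n) \<and> CARD('n) + CARD('r) \<le> CARD('m) + CARD('d) \<and> CARD('r) \<le> CARD('m)"
    define l where "l = CARD('n) - CARD('d)"
    have l: "l \<le> CARD('m) - CARD('r)"
      using d unfolding l_def by arith
    have card: "DIM(real^'d) + l = CARD('n)"
      using d by (simp add: l_def)
    show ?thesis
    proof (rule invariant_disk_bundle[OF F injF injFD \<rho>'(1) invarF freeF, where w="\<lambda>i x. z i" and l=l, OF _ _ _ _ _ card])
      fix x :: "real^'d" and a i assume x: "x \<in> \<B>" and "i < l"
      then show "D_cball F x a \<bullet> z i = 0"
        using l z(2) by (simp add: FD[OF x])
    next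
      show "orthonormal_family l z"
        using z(1) l unfolding orthonormal_family_def by auto
    next
      fix g and i assume "g \<in> A5" "i < l"
      then show "\<rho>' g (z i) \<in> span (z ` {..<l})"
        using zfix[of g i] l by (auto intro: span_base)
    qed (auto intro: Ck_map_on_const)
  next
    assume d: "CARD('r) \<le> CARD('n) \<and> CARD('n) \<le> CARD('m)"
    obtain l0 w0 where l0: "DIM(real^'d) + l0 = DIM(real^'r)" and w0: "\<And>i. i < l0 \<Longrightarrow> smooth_on_cball (w0 i)"
      "\<And>x. x \<in> \<B> \<Longrightarrow> orthonormal_family l0 (\<lambda>i. w0 i x)"
      "\<And>x. x \<in> \<B> \<Longrightarrow>
        span ((\<lambda>i. w0 i x) ` {..<l0}) = {v. \<forall>a. D_cball f x a \<bullet> v = 0}"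
      by (rule smooth_normal_frame[OF f injD], assumption) (rule that)
    define l where "l = l0 + (CARD('n) - CARD('r))"
    have l: "\<And>i. i < l \<Longrightarrow> \<not> i < l0 \<Longrightarrow> i - l0 < CARD('m) - CARD('r)" and card: "DIM(real^'d) + l = CARD('n)"
      using d l0 by (auto simp: l_def)
    \<comment> \<open>The shift \<open>i - l0\<close> numbers the trivial directions after those of
      the normal frame.\<close>
    define w where "w i x = (if i < l0 then J (w0 i x) else z (i - l0))" for i x
    have w0n: "D_cball f x a \<bullet> w0 i x = 0" if "x \<in> \<B>" "i < l0" for x a i
      using w0(3)[OF that(1)] span_base[of "w0 i x" "(\<lambda>i. w0 i x) ` {..<l0}"] that(2) by blast
    show ?thesis
    proof (rule invariant_disk_bundle[OF F injF injFD \<rho>'(1) invarF freeF, where w=w and l=l, OF _ _ _ _ _ card])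
      fix i assume "i < l"
      show "smooth_on_cball (w i)"
      proof (cases "i < l0")
        case True
        have "smooth_on_cball (\<lambda>x. J (w0 i x))"
          by (rule Ck_map_on_compose[OF w0(1)[OF True] Ck_map_on_linear[OF J(1)], of UNIV]) simp
        then show ?thesis using True by (simp add: w_def[abs_def])
      qed (simp add: w_def[abs_def] Ck_map_on_const)
    next
      fix x :: "real^'d" assume x: "x \<in> \<B>"
      show "orthonormal_family l (\<lambda>i. w i x)"
        unfolding orthonormal_family_def
      proof (intro allI impI)
        fix i j assume ij: "i < l" "j < l"
        show "w i x \<bullet> w j x = (if i = j then 1 else 0)"
          using w0(2)[OF x] z(1) l[OF ij(1)] l[OF ij(2)] unfolding orthonormal_family_def
          by (cases "i < l0"; cases "j < l0") (auto simp: w_def J(2) z(2) inner_commute[of "z _" "J _"])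
      qed
      fix a i assume i: "i < l"
      show "D_cball F x a \<bullet> w i x = 0"
        using w0n[OF x] l[OF i] by (simp add: FD[OF x] w_def J(2) z(2))
    next
      fix g and u u' :: "real^'d" and i
      assume g: "g \<in> A5" and u: "u \<in> \<B>" "u' \<in> \<B>" and eq: "\<rho>' g (F u) = F u'" and i: "i < l"
      have ll: "w j u' \<in> span ((\<lambda>i. w i u') ` {..<l})" if "j < l" for j
        using that by (intro span_base) blast
      show "\<rho>' g (w i u) \<in> span ((\<lambda>i. w i u') ` {..<l})"
      proof (cases "i < l0")
        case False
        then have "\<rho>' g (w i u) = w i u'"
          using zfix[OF g l[OF i False]] by (simp add: w_def)
        then show ?thesis using ll[OF i] by simp
      next
        case True
        have eq': "\<rho> g (f u) = f u'"
          using eq F\<rho>[OF g] by (simp add: F_def Jeq)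
        \<comment> \<open>The moved frame vector need not be a frame vector at \<open>u'\<close>; it
          is normal there, and the frame spans the whole normal space.\<close>
        have "D_cball f u' a \<bullet> \<rho> g (w0 i u) = 0" for a
          by (rule normal_space_equivariant[OF f inj injD act invar[unfolded D] g u eq' w0n[OF u(1) True]])
        then have "\<rho> g (w0 i u) \<in> span ((\<lambda>i. w0 i u') ` {..<l0})"
          using w0(3)[OF u(2)] by blast
        then have "J (\<rho> g (w0 i u)) \<in> J ` span ((\<lambda>i. w0 i u') ` {..<l0})"
          by blast
        also have "\<dots> = span (J ` (\<lambda>i. w0 i u') ` {..<l0})"
          by (rule span_linear_image[OF J(1), symmetric])
        also have "\<dots> \<subseteq> span ((\<lambda>i. w i u') ` {..<l})"
          by (intro span_mono) (auto simp: w_def l_def image_iff intro!: bexI[of _ "_ :: nat"])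
        finally show ?thesis using \<rho>'(2)[OF g] True by (simp add: w_def)
      qed
    qed
  qed
  then show ?thesis using \<rho>'(1) by blast
qed

section \<open>The two ranges of dimensions and the absence of centers\<close>

theorem proposition1p6:
  fixes r m n :: int
  assumes "r = int CARD('r::finite)" and "m = int CARD('m::finite)" and "n = int CARD('n::finite)"
    and "\<exists>(\<rho> :: (nat \<Rightarrow> nat) \<Rightarrow> real^'r \<Rightarrow> real^'r) D.
           orthogonal_A5_action \<rho> \<and> smoothly_embedded_disk TYPE(6) D \<and>
           A5_invariant \<rho> D \<and> A5_fixed_point_free \<rho> D"
    and "(m \<ge> n + r - 6 \<and> n + r - 6 \<ge> r) \<or> (m \<ge> n \<and> n \<ge> r)"
  shows "(\<exists>(\<rho> :: (nat \<Rightarrow> nat) \<Rightarrow> real^'m \<Rightarrow> real^'m) D.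
            orthogonal_A5_action \<rho> \<and> smoothly_embedded_disk TYPE('n) D \<and>
            A5_invariant \<rho> D \<and> A5_fixed_point_free \<rho> D) \<and>
         \<not> (\<exists>c. equivariant_center
              (disk_submanifolds n - disk_submanifolds (n - 1) :: (real^'m) set set) c)"
proof -
  obtain \<rho> :: "(nat \<Rightarrow> nat) \<Rightarrow> real^'r \<Rightarrow> real^'r" and D where
    D: "orthogonal_A5_action \<rho>" "smoothly_embedded_disk TYPE(6) D" "A5_invariant \<rho> D" "A5_fixed_point_free \<rho> D"
    using assms(4) by blast
  \<comment> \<open>In the first range n >= 6 comes from n + r - 6 >= r.\<close>
  have "CARD(6) \<le> CARD('n) \<and> CARD('n) + CARD('r) \<le> CARD('m) + CARD(6) \<and> CARD('r) \<le> CARD('m) \<or>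
      CARD('r) \<le> CARD('n) \<and> CARD('n) \<le> CARD('m)"
    using assms(1-3,5) by simp linarith
  from fixed_point_free_disk[OF D this]
  obtain \<rho>' :: "(nat \<Rightarrow> nat) \<Rightarrow> real^'m \<Rightarrow> real^'m" and W where
    W: "orthogonal_A5_action \<rho>'" "smoothly_embedded_disk TYPE('n) W" "A5_invariant \<rho>' W" "A5_fixed_point_free \<rho>' W"
      "W \<in> disk_submanifolds n - disk_submanifolds (n - 1)"
    using assms(3) by blast
  moreover have False if "equivariant_center (disk_submanifolds n - disk_submanifolds (n - 1) :: (real^'m) set set) c" for c
  proof -
    have "c W \<in> W"
      using that W(5) unfolding equivariant_center_def by blast
    \<comment> \<open>Since \<open>W\<close> is invariant, equivariance of \<open>c\<close> under
      the orthogonal map \<open>\<rho>' g\<close> says that this map fixes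
      \<open>c W\<close>.\<close>
    moreover have "\<rho>' g (c W) = c W" if g: "g \<in> A5" for g
    proof -
      have "orthogonal_transformation (\<rho>' g)" "\<rho>' g ` W = W"
        using W(1,3) g unfolding orthogonal_A5_action_iff A5_invariant_def by blast+
      then show ?thesis
        using \<open>equivariant_center _ c\<close> W(5) unfolding equivariant_center_def by metis
    qed
    ultimately show False
      using W(4) unfolding A5_fixed_point_free_def by blast
  qed
  ultimately show ?thesis by blast
qed

end
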